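(* Consider a Borel-space Markov decision process in the model class (UC), with weight function $w$. Fix a state $\bar x\in\mathbb X$, let $h_\alpha(x)=v_\alpha(x)-v_\alpha(\bar x)$ for $x\in\mathbb X$, $\alpha\in(0,1)$, and assume: (1) $\sup_{\alpha\in(0,1)}\|h_\alpha\|_w<\infty$. (2) For each $x\in\mathbb X$ and $\epsilon>0$ the following hold: (i) there exist a compact set $K\subset\mathbb A$ and $0<\bar\alpha<1$ such that for all $\alpha\in[\bar\alpha,1)$, $$\inf_{a\in K\cap A(x)}\Big\{c(x,a)+\alpha\int_{\mathbb X}v_\alpha(y)\,q(dy\mid x,a)\Big\}\le v_\alpha(x)+\epsilon;$$ (ii) there exists a (nonnegative) finite measure $\nu$ on $\mathcal B(\mathbb X)$ such that $\sup_{a\in K\cap A(x)}q(B\mid x,a)\le\nu(B)$ for all $B\in\mathcal B(\mathbb X)$; (iii) $\displaystyle\lim_{\ell\to\infty}\sup_{a\in K\cap A(x)}\int_{\mathbb X}w(y)\,\mathbf 1[w(y)\ge\ell]\,q(dy\mid x,a)=0.$ Let $\{\alpha_n\}_{n\ge0}\subset(0,1)$ be a sequence with $\alpha_n\uparrow1$ such that $(1-\alpha_n)v_{\alpha_n}(\bar x)\to\rho^*$ for some finite number $\rho^*$, and let $\underline h=\liminf_{n\to\infty}h_{\alpha_n}$ (pointwise). Then the optimal average cost function satisfies $g^*(x)=\rho^*$ for all $x\in\mathbb X$; $\underline h\in\mathcal A(\mathbb X)\cap\mathcal M_w(\mathbb X)$; and $(\rho^*,\underline h)$ satisfies the average cost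 optimality inequality $$\rho^*+\underline h(x)\ge\inf_{a\in A(x)}\Big\{c(x,a)+\int_{\mathbb X}\underline h(y)\,q(dy\mid x,a)\Big\},\qquad x\in\mathbb X.$$ Hence there exist an (average-cost) optimal nonrandomized Markov policy and, for each $\epsilon>0$, an $\epsilon$-optimal nonrandomized stationary policy.
   Context: **Measurability.** A Borel space is a topological space homeomorphic to a Borel subset of a Polish space. For a Borel space $X$, $\mathcal B(X)$ is its Borel $\sigma$-algebra and $\mathcal P(X)$ the set of Borel probability measures on it. The universal $\sigma$-algebra is $\mathcal U(X)=\bigcap_{p\in\mathcal P(X)}\mathcal B_p(X)$, where $\mathcal B_p(X)$ is the completion of $\mathcal B(X)$ under $p$; functions measurable w.r.t. $\mathcal U(X)$ are universally measurable. Integrals of universally measurable functions against $p$ are taken w.r.t. the completion of $p$. A Borel (universally) measurable stochastic kernel $q(dy\mid x)$ on $Y$ given $X$ is a map $X\to\mathcal P(Y)$ such that $q(B\mid\cdot)$ is Borel (universally) measurable for each $B\in\mathcal B(Y)$. A set is analytic if it is empty or is the image of a Borel subset of a Polish space under a Borel measurable map into a Polish space. A function $f:D\to[-\infty,\infty]$ is lower semi-analytic if $D$ is analytic and $\{x\in D: f(x)\le r\}$ is analytic for every $r\in\mathbb R$. Conventions: $\infty-\infty=-\infty+\infty=\infty$, $0\cdot(\pm\infty)=0$. **Borel-space MDP.** The state space $\mathbb X$ and action space $\mathbb A$ are Borel spaces. For each $x\in\mathbb X$, $A(x)\subset\mathbb A$ is a nonempty set of admissible actions, and $\Gamma=\{(x,a):x\in\mathbb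 X,a\in A(x)\}$ is analytic. The one-stage cost $c:\Gamma\to[-\infty,\infty]$ is lower semi-analytic. The state transition kernel $q(dy\mid x,a)$ is a Borel measurable stochastic kernel on $\mathbb X$ given $\mathbb X\times\mathbb A$. **Policies.** A policy is a sequence $\pi=(\mu_0,\mu_1,\dots)$, where $\mu_k(da_k\mid x_0,a_0,\dots,a_{k-1},x_k)$ is a universally measurable stochastic kernel on $\mathbb A$ given $(\mathbb X\times\mathbb A)^k\times\mathbb X$ with $\mu_k(A(x_k)\mid x_0,\dots,x_k)=1$ for all histories. $\Pi$ is the set of all policies. $\pi$ is nonrandomized if every $\mu_k(\cdot\mid\cdot)$ is a Dirac measure at an action in $A(x_k)$; Markov if each $\mu_k$ depends only on $x_k$; stationary if it is Markov with $\mu_k=\mu$ for all $k$. $\mathbb E^\pi_x$ is expectation w.r.t. the probability measure on trajectories induced by $\pi$, $q$ and $x_0=x$. **Criteria.** $J_n(\pi,x)=\mathbb E^\pi_x[\sum_{k=0}^{n-1}c(x_k,a_k)]$, $J(\pi,x)=\limsup_{n\to\infty}J_n(\pi,x)/n$, $g^*(x)=\inf_{\pi\in\Pi}J(\pi,x)$. For $0<\alpha<1$: $v^\pi_\alpha(x)=\limsup_{n\to\infty}\mathbb E^\pi_x[\sum_{k=0}^{n-1}\alpha^kc(x_k,a_k)]$, $v_\alpha(x)=\inf_{\pi\in\Pi}v^\pi_\alpha(x)$. A policy $\pi$ is optimal if $J(\pi,x)=g^*(x)$ for all $x\in\mathbb X$, and $\epsilon$-optimal if $J(\pi,x)\le g^*(x)+\epsilon$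 for all $x\in\mathbb X$. **Function spaces.** $\mathcal A(\mathbb X)$: extended real-valued lower semi-analytic functions on $\mathbb X$. For a universally measurable weight function $w:\mathbb X\to(0,\infty)$, $\mathcal M_w(\mathbb X)$ is the set of universally measurable $f:\mathbb X\to[-\infty,\infty]$ with $\|f\|_w=\sup_x|f(x)|/w(x)<\infty$. **Model (UC).** There exist a universally measurable weight function $w(\cdot)\ge1$ and constants $b,\hat c\ge0$, $\lambda\in[0,1)$ such that for all $x\in\mathbb X$: (a) $\sup_{a\in A(x)}|c(x,a)|\le\hat c\,w(x)$; (b) $\sup_{a\in A(x)}\int_{\mathbb X}w(y)\,q(dy\mid x,a)\le\lambda w(x)+b$. *)

theory Defs
  imports "HOL-Probability.Probability"
begin

definition polish_topology :: "'p topology \<Rightarrow> bool" where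
  "polish_topology Z \<longleftrightarrow> completely_metrizable_space Z \<and> separable_space Z"

definition borel_sigma :: "'p topology \<Rightarrow> 'p measure" where
  "borel_sigma Z = sigma (topspace Z) {U. openin Z U}"

text \<open>
  HOL cannot quantify existentially over types. Every Polish space has at most continuum many
  points, so topologies whose points are reals (with an arbitrary topology, unrelated to the usual
  one) represent all Polish spaces up to homeomorphism. Existential quantifiers over Polish spaces
  are rendered in this way.
\<close>

class borel_space = topological_space +
  assumes homeomorphic_borel_subset:
    "\<exists>(Z :: real topology) B. polish_topology Z \<and> B \<in> sets (borel_sigma Z) \<and>
       topology open homeomorphic_space subtopology Z B"

text \<open>
  A Borel space is itself a Borel subset of a Polish space (up to homeomorphism), so a Borel map
  into the Borel space is also a Borel map into that Polish space.
\<close>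

definition analytic :: "'s::topological_space set \<Rightarrow> bool" where
  "analytic D \<longleftrightarrow> D = {} \<or>
     (\<exists>(Z :: real topology) B f. polish_topology Z \<and> B \<in> sets (borel_sigma Z) \<and>
        f \<in> restrict_space (borel_sigma Z) B \<rightarrow>\<^sub>M borel \<and> D = f ` B)"

definition lower_semianalytic_on :: "'s::topological_space set \<Rightarrow> ('s \<Rightarrow> ereal) \<Rightarrow> bool" where
  "lower_semianalytic_on D f \<longleftrightarrow> analytic D \<and> (\<forall>r::real. analytic {x \<in> D. f x \<le> ereal r})"

definition universal :: "'s measure \<Rightarrow> 's measure" where
  "universal M = sigma (space M)
     (\<Inter>p \<in> {p. prob_space p \<and> sets p = sets M}. sets (completion p))"

text \<open>
  Integral of an extended real function against the completion of \<open>p\<close>. In \<^typ>\<open>ereal\<close>,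
  \<open>\<infinity> - \<infinity> = -\<infinity> + \<infinity> = \<infinity>\<close> and \<open>0 * (\<plusminus>\<infinity>) = 0\<close>, and the function
  \<open>e2ennreal\<close> sends negative numbers to 0.
\<close>

definition eint :: "'s measure \<Rightarrow> ('s \<Rightarrow> ereal) \<Rightarrow> ereal" where
  "eint p f = enn2ereal (\<integral>\<^sup>+ s. e2ennreal (f s) \<partial>completion p)
            - enn2ereal (\<integral>\<^sup>+ s. e2ennreal (- f s) \<partial>completion p)"

definition wnorm :: "('x \<Rightarrow> real) \<Rightarrow> ('x \<Rightarrow> ereal) \<Rightarrow> ereal" where
  "wnorm w f = (SUP x. \<bar>f x\<bar> / ereal (w x))"

definition M_w :: "('x::topological_space \<Rightarrow> real) \<Rightarrow> ('x \<Rightarrow> ereal) set" where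
  "M_w w = {f. f \<in> universal borel \<rightarrow>\<^sub>M borel \<and> wnorm w f < \<infinity>}"

text \<open>
  The state and action spaces are the types \<open>'x\<close> and \<open>'a\<close>. Values of the cost
  outside the graph are irrelevant.
\<close>

definition graph :: "('x \<Rightarrow> 'a set) \<Rightarrow> ('x \<times> 'a) set" where
  "graph A = {(x, a). a \<in> A x}"

definition borel_mdp ::
  "('x::borel_space \<Rightarrow> 'a::borel_space set) \<Rightarrow> ('x \<times> 'a \<Rightarrow> ereal) \<Rightarrow> ('x \<times> 'a \<Rightarrow> 'x measure) \<Rightarrow> bool" where
  "borel_mdp A c q \<longleftrightarrow>
     (\<forall>x. A x \<noteq> {}) \<and> analytic (graph A) \<and> lower_semianalytic_on (graph A) c \<and>
     q \<in> borel \<rightarrow>\<^sub>M prob_algebra borel"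

definition model_UC ::
  "('x::borel_space \<Rightarrow> 'a::borel_space set) \<Rightarrow> ('x \<times> 'a \<Rightarrow> ereal) \<Rightarrow> ('x \<times> 'a \<Rightarrow> 'x measure) \<Rightarrow>
   ('x \<Rightarrow> real) \<Rightarrow> bool" where
  "model_UC A c q w \<longleftrightarrow>
     w \<in> universal borel \<rightarrow>\<^sub>M borel \<and> (\<forall>x. 1 \<le> w x) \<and>
     (\<exists>b c' l. 0 \<le> b \<and> 0 \<le> c' \<and> 0 \<le> l \<and> l < 1 \<and>
        (\<forall>x. (SUP a\<in>A x. \<bar>c (x, a)\<bar>) \<le> ereal (c' * w x) \<and>
             (SUP a\<in>A x. eint (q (x, a)) (\<lambda>y. ereal (w y))) \<le> ereal (l * w x + b)))"

text \<open>
  A history \<open>(x\<^sub>0, a\<^sub>0, \<dots>, x\<^sub>k)\<close> is a pair of the finite sequence of the first \<open>k\<close>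
  state-action pairs and the current state. Since Borel spaces are second countable, the product
  sigma-algebra is the Borel sigma-algebra of the product.
\<close>

type_synonym ('x, 'a) history = "(nat \<Rightarrow> 'x \<times> 'a) \<times> 'x"
type_synonym ('x, 'a) policy = "nat \<Rightarrow> ('x, 'a) history \<Rightarrow> 'a measure"

definition hist :: "nat \<Rightarrow> ('x::topological_space, 'a::topological_space) history measure" where
  "hist k = (\<Pi>\<^sub>M i\<in>{..<k}. borel) \<Otimes>\<^sub>M borel"

definition policies ::
  "('x::borel_space \<Rightarrow> 'a::borel_space set) \<Rightarrow> ('x, 'a) policy set" where
  "policies A = {\<pi>. \<forall>k. \<pi> k \<in> universal (hist k) \<rightarrow>\<^sub>M prob_algebra borel \<and>
     (\<forall>(h, x) \<in> space (hist k). emeasure (completion (\<pi> k (h, x))) (A x) = 1)}"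

definition nonrandomized ::
  "('x::borel_space \<Rightarrow> 'a::borel_space set) \<Rightarrow> ('x, 'a) policy \<Rightarrow> bool" where
  "nonrandomized A \<pi> \<longleftrightarrow>
     (\<forall>k. \<forall>(h, x) \<in> space (hist k). \<exists>a\<in>A x. \<pi> k (h, x) = return borel a)"

definition Markov :: "('x::borel_space, 'a::borel_space) policy \<Rightarrow> bool" where
  "Markov \<pi> \<longleftrightarrow> (\<exists>\<mu>. \<forall>k. \<forall>(h, x) \<in> space (hist k). \<pi> k (h, x) = \<mu> k x)"

definition stationary :: "('x::borel_space, 'a::borel_space) policy \<Rightarrow> bool" where
  "stationary \<pi> \<longleftrightarrow> (\<exists>\<mu>. \<forall>k. \<forall>(h, x) \<in> space (hist k). \<pi> k (h, x) = \<mu> x)"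

text \<open>
  Law of the history at time \<open>k\<close>. The policy kernels are only universally measurable, hence
  the completion in front of the monadic bind.
\<close>

primrec hist_law ::
  "('x::borel_space \<times> 'a::borel_space \<Rightarrow> 'x measure) \<Rightarrow> ('x, 'a) policy \<Rightarrow> 'x \<Rightarrow> nat \<Rightarrow>
   ('x, 'a) history measure" where
  "hist_law q \<pi> x 0 = return (hist 0) (\<lambda>_. undefined, x)"
| "hist_law q \<pi> x (Suc k) =
     completion (hist_law q \<pi> x k) \<bind> (\<lambda>(h, y). \<pi> k (h, y) \<bind>
       (\<lambda>a. distr (q (y, a)) (hist (Suc k)) (\<lambda>y'. (h(k := (y, a)), y'))))"

text \<open>
  The history laws are consistent and determine a unique measure on trajectories (Ionescu Tulcea).
  The locale for that theorem in the library does not apply here, as the kernels are not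
  product measurable.
\<close>

definition traj_law ::
  "('x::borel_space \<times> 'a::borel_space \<Rightarrow> 'x measure) \<Rightarrow> ('x, 'a) policy \<Rightarrow> 'x \<Rightarrow>
   (nat \<Rightarrow> 'x \<times> 'a) measure" where
  "traj_law q \<pi> x = (THE P. prob_space P \<and> sets P = sets (\<Pi>\<^sub>M i\<in>UNIV. borel) \<and>
     (\<forall>k. distr P (hist k) (\<lambda>\<omega>. (restrict \<omega> {..<k}, fst (\<omega> k))) = hist_law q \<pi> x k))"

definition J_fin where
  "J_fin c q n \<pi> x = eint (traj_law q \<pi> x) (\<lambda>\<omega>. \<Sum>k<n. c (\<omega> k))"

definition J_avg where
  "J_avg c q \<pi> x = limsup (\<lambda>n. J_fin c q n \<pi> x / ereal (real n))"

definition g_star where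
  "g_star A c q x = (INF \<pi>\<in>policies A. J_avg c q \<pi> x)"

definition v_pol where
  "v_pol c q \<alpha> \<pi> x =
     limsup (\<lambda>n. eint (traj_law q \<pi> x) (\<lambda>\<omega>. \<Sum>k<n. ereal (\<alpha> ^ k) * c (\<omega> k)))"

definition v_opt where
  "v_opt A c q \<alpha> x = (INF \<pi>\<in>policies A. v_pol c q \<alpha> \<pi> x)"

definition h_rel where
  "h_rel A c q xbar \<alpha> x = v_opt A c q \<alpha> x - v_opt A c q \<alpha> xbar"

definition avg_optimal where
  "avg_optimal A c q \<pi> \<longleftrightarrow> \<pi> \<in> policies A \<and> (\<forall>x. J_avg c q \<pi> x = g_star A c q x)"

definition avg_eps_optimal where
  "avg_eps_optimal A c q \<epsilon> \<pi> \<longleftrightarrow>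
     \<pi> \<in> policies A \<and> (\<forall>x. J_avg c q \<pi> x \<le> g_star A c q x + ereal \<epsilon>)"

end

theory Submission
  imports Defs
begin

text \<open>
  The discounted value functions are fixed points of the Bellman operator, which is a contraction for
  the weight \<open>w + \<kappa>\<close> with a suitable constant \<open>\<kappa>\<close>. Along \<open>\<alpha>\<^sub>n\<close>, the discounted optimality
  equation, after subtraction of \<open>\<alpha>\<^sub>n\<close> times the value at the reference state, passes to the limit and gives the
  optimality inequality: because the transition probabilities from a state are dominated by one
  finite measure, the integrals converge uniformly in the action. Selectors that attain the infimum
  in the inequality up to an error \<open>\<epsilon>\<close> (respectively \<open>2\<^sup>-\<^sup>k\<close> at time \<open>k\<close>) give policies with
  average cost at most \<open>\<rho> + \<epsilon>\<close> (respectively \<open>\<rho>\<close>), and Abel summation shows that the average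
  cost of any policy is at least the limit of \<open>(1 - \<alpha>\<^sub>n)\<close> times the discounted values, which is \<open>\<rho>\<close>.

  The measurability questions are reduced to two facts about analytic sets: the selection theorem of
  Jankov and von Neumann, and the analyticity of the set of all parameters for which the integral
  of a lower semianalytic function against a Borel kernel is less than a given number.
\<close>

subsection \<open>Coding Borel spaces by reals\<close>

text \<open>Minimization over actions leads out of the Borel functions, and the infimum need not be
  attained. The class that survives all operations of the proof (infimum over the sections of an
  analytic graph, integration against a Borel kernel, pointwise liminf) consists of the functions
  with analytic strict sublevel sets. Near-minimizers are then only universally measurable, so laws
  are handled on their completions, through Borel versions that agree almost everywhere. The values
  at discount \<alpha> may grow like \<open>\<rho> / (1 - \<alpha>)\<close>; only their differences
  stay bounded in the weight. Since \<open>h_low\<close> is a mere liminf, at a given state it is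
  approximated from above for infinitely many indices only, and these depend on the state; from
  below it is approximated eventually. The inequality needs exactly this asymmetry: the integral of
  \<open>h_low\<close> must be bounded above by integrals of the differences, while the
  approximation from above is used at the single state \<open>x\<close>. This is why an inequality,
  not an equation, results.\<close>

lemma space_borel_sigma [simp]: "space (borel_sigma Z) = topspace Z"
  unfolding borel_sigma_def by (rule space_measure_of) (auto dest: openin_subset)

lemma sets_borel_sigma: "sets (borel_sigma Z) = sigma_sets (topspace Z) {U. openin Z U}"
  unfolding borel_sigma_def by (rule sets_measure_of) (auto dest: openin_subset)

lemma openin_borel_sigma: "openin Z U \<Longrightarrow> U \<in> sets (borel_sigma Z)"
  by (auto simp: sets_borel_sigma)

lemma closedin_borel_sigma: "closedin Z U \<Longrightarrow> U \<in> sets (borel_sigma Z)"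
  using sets.compl_sets[OF openin_borel_sigma, of Z "topspace Z - U"]
  by (metis closedin_def double_diff dual_order.refl space_borel_sigma)

text \<open>
  The range of the encoding \<open>e\<close> is automatically Borel, being \<open>{t. e (d t) = t}\<close>. Working with a pair
  of maps therefore avoids the Lusin-Souslin theorem on injective Borel images.
\<close>

definition coded :: "'s measure \<Rightarrow> bool" where
  "coded M \<longleftrightarrow> (\<exists>(e :: 's \<Rightarrow> real) d. e \<in> M \<rightarrow>\<^sub>M borel \<and> d \<in> borel \<rightarrow>\<^sub>M M \<and> (\<forall>s\<in>space M. d (e s) = s))"

lemma coded_real [simp]: "coded (borel :: real measure)"
  unfolding coded_def by (intro exI[of _ "\<lambda>x. x"]) auto

lemma codedI:
  assumes N: "coded N" and e: "e \<in> M \<rightarrow>\<^sub>M N" and d: "d \<in> N \<rightarrow>\<^sub>M M" and de: "\<And>s. s \<in> space M \<Longrightarrow> d (e s) = s"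
  shows "coded M"
proof -
  obtain e' d' where "e' \<in> N \<rightarrow>\<^sub>M (borel::real measure)" "d' \<in> borel \<rightarrow>\<^sub>M N" "\<forall>s\<in>space N. d' (e' s) = s"
    using N unfolding coded_def by auto
  then show ?thesis
    unfolding coded_def using e d de measurable_space[OF e]
    by (intro exI[of _ "\<lambda>x. e' (e x)"] exI[of _ "\<lambda>x. d (d' x)"]) auto
qed

text \<open>Base 4 with digits 0 and 1 only: after scaling by \<open>4 ^ Suc n\<close> the earlier
  digits contribute an even integer, digit \<open>n\<close> contributes the parity, and the tail is
  at most 1/3, so it cannot disturb the floor. In base 2 a tail of ones would be ambiguous.\<close>

lemma floor_code_digit:
  fixes b :: "nat \<Rightarrow> bool"
  defines "t \<equiv> (\<Sum>i. of_bool (b i) * (1/4::real) ^ Suc i)"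
  shows "odd \<lfloor>4 ^ Suc n * t\<rfloor> \<longleftrightarrow> b n"
proof -
  let ?f = "\<lambda>i. of_bool (b i) * (1/4::real) ^ Suc i"
  have sf: "summable ?f"
    by (rule summable_comparison_test'[where g="\<lambda>i. (1/4::real) ^ Suc i" and N=0])
       (auto simp: of_bool_def intro!: summable_mult summable_geometric)
  have sg: "summable (\<lambda>i. (1/4::real) ^ Suc (i + Suc n))"
    by (simp add: power_add) (intro summable_mult2 summable_mult summable_geometric; simp)
  have split: "t = (\<Sum>i. ?f (i + Suc n)) + (\<Sum>i<Suc n. ?f i)"
    unfolding t_def by (rule suminf_split_initial_segment[OF sf])
  let ?r = "\<Sum>i. ?f (i + Suc n)"
  have r0: "0 \<le> ?r"
    by (rule suminf_nonneg) (use sf summable_ignore_initial_segment[OF sf, of "Suc n"] in auto)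
  have "?r \<le> (\<Sum>i. (1/4::real) ^ Suc (i + Suc n))"
    by (rule suminf_le) (use summable_ignore_initial_segment[OF sf, of "Suc n"] sg in \<open>auto simp: of_bool_def\<close>)
  also have "\<dots> = (\<Sum>i. (1/4) ^ Suc (Suc n) * (1/4::real) ^ i)"
    by (simp add: power_add mult_ac)
  also have "\<dots> = (1/4) ^ Suc (Suc n) * (4/3)"
    by (subst suminf_mult) (auto simp: suminf_geometric intro!: summable_geometric)
  finally have r1: "4 ^ Suc n * ?r \<le> 1/3"
    by (simp add: field_simps)
  define k where "k = (\<Sum>i<n. of_bool (b i) * 4 ^ (n - i) :: int)"
  have "4 ^ Suc n * (\<Sum>i<n. ?f i) = (\<Sum>i<n. of_bool (b i) * 4 ^ (n - i))"
    unfolding sum_distrib_left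
  proof (rule sum.cong)
    fix i assume "i \<in> {..<n}"
    then have "(4::real) ^ Suc n = 4 ^ (n - i) * 4 ^ Suc i"
      by (subst power_add[symmetric]) auto
    then show "4 ^ Suc n * ?f i = of_bool (b i) * 4 ^ (n - i)"
      by (simp add: power_divide)
  qed simp
  then have "4 ^ Suc n * t = 4 ^ Suc n * ?r + real_of_int (k + of_bool (b n))"
    unfolding split k_def by (simp add: algebra_simps power_divide)
  moreover have "0 \<le> 4 ^ Suc n * ?r" using r0 by simp
  ultimately have "\<lfloor>4 ^ Suc n * t\<rfloor> = k + of_bool (b n)"
    using r1 by (intro floor_unique) auto
  moreover have "even k"
    unfolding k_def by (intro dvd_sum) auto
  ultimately show ?thesis by simp
qed

lemma coded_bits: "coded (PiM UNIV (\<lambda>_::nat. count_space (UNIV :: bool set)))"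
proof -
  let ?P = "PiM UNIV (\<lambda>_::nat. count_space (UNIV :: bool set))"
  define e :: "(nat \<Rightarrow> bool) \<Rightarrow> real" where "e = (\<lambda>b. \<Sum>i. of_bool (b i) * (1/4) ^ Suc i)"
  define d :: "real \<Rightarrow> nat \<Rightarrow> bool" where "d = (\<lambda>t n. odd \<lfloor>4 ^ Suc n * t\<rfloor>)"
  have "(\<lambda>b. of_bool (b i)) \<in> ?P \<rightarrow>\<^sub>M (borel :: real measure)" for i
    by (rule measurable_compose[OF measurable_component_singleton[of i]]) auto
  then have "e \<in> ?P \<rightarrow>\<^sub>M borel"
    unfolding e_def by (intro borel_measurable_suminf borel_measurable_times) auto
  moreover have "d \<in> borel \<rightarrow>\<^sub>M ?P"
    unfolding d_def
    by (rule measurable_PiM_single') (auto intro!: measurable_compose[OF _ measurable_count_space])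
  moreover have "d (e b) = b" for b
    unfolding d_def e_def by (rule ext) (rule floor_code_digit)
  ultimately show ?thesis unfolding coded_def by blast
qed

text \<open>A sequence is replaced by the indicator of its graph, which is a sequence of bits.
  Decoding by \<open>LEAST\<close> is defined, and measurable, also on bit sequences that are no
  graph.\<close>

lemma coded_nat_seq: "coded (PiM UNIV (\<lambda>_::nat. count_space (UNIV :: nat set)))"
proof (rule codedI[OF coded_bits])
  let ?P = "PiM UNIV (\<lambda>_::nat. count_space (UNIV :: nat set))"
  let ?B = "PiM UNIV (\<lambda>_::nat. count_space (UNIV :: bool set))"
  let ?e = "\<lambda>s n. s (fst (prod_decode n)) = snd (prod_decode n)"
  let ?d = "\<lambda>b i. LEAST j::nat. b (prod_encode (i, j))"
  show "?e \<in> ?P \<rightarrow>\<^sub>M ?B"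
    by (rule measurable_PiM_single')
       (auto intro!: measurable_compose[OF measurable_component_singleton])
  show "?d \<in> ?B \<rightarrow>\<^sub>M ?P"
    by (rule measurable_PiM_single')
       (auto intro!: measurable_Least measurable_component_singleton)
  show "?d (?e s) = s" for s
    by (auto intro!: Least_equality)
qed

text \<open>Each term is coded by its Dedekind cut, the bits telling which rationals lie above it,
  and recovered as the infimum of these rationals. \<open>real_of_ereal\<close> makes the decoder
  total on bit sequences that are no cut.\<close>

lemma coded_real_seq: "coded (PiM UNIV (\<lambda>_::nat. borel :: real measure))"
proof (rule codedI[OF coded_bits])
  let ?P = "PiM UNIV (\<lambda>_::nat. borel :: real measure)"
  let ?B = "PiM UNIV (\<lambda>_::nat. count_space (UNIV :: bool set))"
  define q :: "nat \<Rightarrow> real" where "q = (\<lambda>j. of_rat (from_nat_into UNIV j))"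
  let ?e = "\<lambda>s n. s (fst (prod_decode n)) < q (snd (prod_decode n))"
  let ?d = "\<lambda>b i. real_of_ereal (INF j. if b (prod_encode (i, j)) then ereal (q j) else \<infinity>)"
  show "?e \<in> ?P \<rightarrow>\<^sub>M ?B"
  proof (rule measurable_PiM_single')
    fix i :: nat
    have [measurable]: "(\<lambda>s. s (fst (prod_decode i))) \<in> ?P \<rightarrow>\<^sub>M (borel :: real measure)"
      by (rule measurable_component_singleton) simp
    show "(\<lambda>s. ?e s i) \<in> ?P \<rightarrow>\<^sub>M count_space UNIV"
      by measurable
  qed auto
  show "?d \<in> ?B \<rightarrow>\<^sub>M ?P"
  proof (rule measurable_PiM_single')
    fix i :: nat
    have [measurable]: "Measurable.pred ?B (\<lambda>b. b (prod_encode (i, j)))" for j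
      by (rule measurable_component_singleton) simp
    show "(\<lambda>b. ?d b i) \<in> ?B \<rightarrow>\<^sub>M borel"
      by measurable
  qed (auto simp: space_PiM)
  show "?d (?e s) = s" for s
  proof
    fix i
    let ?J = "INF j. if s i < q j then ereal (q j) else \<infinity>"
    have "?J = ereal (s i)"
    proof (rule antisym)
      show "?J \<le> ereal (s i)"
      proof (rule ccontr)
        assume "\<not> ?thesis"
        then obtain y where y: "s i < y" "ereal y < ?J"
          using ereal_dense2[of "ereal (s i)"] by (auto simp: not_le)
        obtain r :: rat where r: "s i < of_rat r" "of_rat r < y"
          using of_rat_dense[OF y(1)] by auto
        obtain j where "q j = of_rat r"
          unfolding q_def using from_nat_into_surj[of "UNIV :: rat set" r] by auto
        then have "?J \<le> ereal y"
          using r by (intro INF_lower2[of j]) auto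
        then show False using y by auto
      qed
    next
      show "ereal (s i) \<le> ?J"
        by (rule INF_greatest) auto
    qed
    then show "?d (?e s) i = s i" by simp
  qed
qed

lemma coded_pair:
  assumes "coded M" "coded N"
  shows "coded (M \<Otimes>\<^sub>M N)"
proof -
  obtain e1 d1 where 1 [measurable]: "e1 \<in> M \<rightarrow>\<^sub>M (borel::real measure)" "d1 \<in> borel \<rightarrow>\<^sub>M M"
    and de1: "\<And>s. s \<in> space M \<Longrightarrow> d1 (e1 s) = s"
    using assms(1) unfolding coded_def by auto
  obtain e2 d2 where 2 [measurable]: "e2 \<in> N \<rightarrow>\<^sub>M (borel::real measure)" "d2 \<in> borel \<rightarrow>\<^sub>M N"
    and de2: "\<And>s. s \<in> space N \<Longrightarrow> d2 (e2 s) = s"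
    using assms(2) unfolding coded_def by auto
  let ?P = "PiM UNIV (\<lambda>_::nat. borel :: real measure)"
  have [measurable]: "(\<lambda>s. s i) \<in> ?P \<rightarrow>\<^sub>M (borel :: real measure)" for i
    by (rule measurable_component_singleton) simp
  show ?thesis
  proof (rule codedI[OF coded_real_seq])
    show "(\<lambda>x i. if i = 0 then e1 (fst x) else e2 (snd x)) \<in> M \<Otimes>\<^sub>M N \<rightarrow>\<^sub>M ?P"
      by (rule measurable_PiM_single') (auto simp: if_distrib)
    show "(\<lambda>s. (d1 (s 0), d2 (s 1))) \<in> ?P \<rightarrow>\<^sub>M M \<Otimes>\<^sub>M N"
      by measurable
  qed (auto simp: space_pair_measure de1 de2)
qed

text \<open>
  A point \<open>x\<close> is coded by the sequence whose \<open>n\<close>-th term is the least index of a member of a countable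
  dense set within distance \<open>2\<^sup>-\<^sup>n\<close> of \<open>x\<close>; completeness makes the decoding Borel.
\<close>

lemma coded_borel_sigma:
  fixes Z :: "'p topology"
  assumes Z: "polish_topology Z" and ne: "topspace Z \<noteq> {}"
  shows "coded (borel_sigma Z)"
proof -
  obtain M d where "Metric_space M d" and comp: "Metric_space.mcomplete M d"
    and Zeq: "Z = Metric_space.mtopology M d"
    using Z unfolding polish_topology_def completely_metrizable_space_def by auto
  interpret Metric_space M d by fact
  have top [simp]: "topspace Z = M" unfolding Zeq by simp
  obtain C where C: "countable C" "C \<subseteq> M" "Z closure_of C = M"
    using Z unfolding polish_topology_def separable_space_def by auto
  have Cne: "C \<noteq> {}" using C ne by auto
  define z where "z = from_nat_into C"
  have zM [simp]: "z i \<in> M" for i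
    unfolding z_def using from_nat_into[OF Cne] C by auto
  have dense: "\<exists>i. d (z i) x \<le> r" if x: "x \<in> M" and r: "0 < r" for x r
  proof -
    have "x \<in> Z closure_of C" using x C by simp
    then have "\<forall>r>0. \<exists>y\<in>C. y \<in> mball x r"
      unfolding Zeq metric_closure_of by blast
    then obtain y where "y \<in> C" "y \<in> mball x r"
      using r by meson
    moreover obtain i where "z i = y"
      unfolding z_def using from_nat_into_surj[OF C(1) \<open>y \<in> C\<close>] by auto
    ultimately show ?thesis using commute[of x y] by (intro exI[of _ i]) auto
  qed
  \<comment> \<open>\<open>G\<close> collects the index sequences whose balls of radius
    \<open>2 ^ -n\<close> are mutually consistent. It is given by countably many conditions on
    indices, hence measurable, and it makes the centres a Cauchy sequence, so that every member
    names a point.\<close>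
  define G where "G = {s :: nat \<Rightarrow> nat. \<forall>n m. d (z (s n)) (z (s m)) \<le> (1/2) ^ n + (1/2) ^ m}"
  have exlim: "\<exists>x\<in>M. \<forall>n. d (z (s n)) x \<le> (1/2) ^ n" if s: "s \<in> G" for s
  proof -
    have tend: "(\<lambda>n. (1/2::real) ^ n) \<longlonglongrightarrow> 0"
      by (rule LIMSEQ_power_zero) auto
    have "MCauchy (\<lambda>n. z (s n))"
      unfolding MCauchy_def
    proof (intro conjI allI impI)
      fix \<epsilon> :: real assume "0 < \<epsilon>"
      then obtain N where N: "\<And>n. n \<ge> N \<Longrightarrow> (1/2::real) ^ n < \<epsilon> / 2"
        using order_tendstoD(2)[OF tend, of "\<epsilon>/2"] unfolding eventually_sequentially by auto
      show "\<exists>N. \<forall>n n'. N \<le> n \<longrightarrow> N \<le> n' \<longrightarrow> d (z (s n)) (z (s n')) < \<epsilon>"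
      proof (intro exI[of _ N] allI impI)
        fix n n' assume "N \<le> n" "N \<le> n'"
        have "d (z (s n)) (z (s n')) \<le> (1/2) ^ n + (1/2) ^ n'"
          using s unfolding G_def by auto
        then show "d (z (s n)) (z (s n')) < \<epsilon>" using N[OF \<open>N \<le> n\<close>] N[OF \<open>N \<le> n'\<close>] by linarith
      qed
    qed auto
    then obtain x where x: "limitin mtopology (\<lambda>n. z (s n)) x sequentially"
      using comp unfolding mcomplete_def by auto
    then have xM: "x \<in> M" by (simp add: limitin_mspace)
    have "d (z (s n)) x \<le> (1/2) ^ n" for n
    proof (rule field_le_epsilon)
      fix \<epsilon> :: real assume "0 < \<epsilon>"
      have "\<forall>\<^sub>F m in sequentially. z (s m) \<in> M \<and> d (z (s m)) x < \<epsilon> / 2"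
        using x half_gt_zero[OF \<open>0 < \<epsilon>\<close>] unfolding limitin_metric by blast
      moreover have "\<forall>\<^sub>F m in sequentially. (1/2::real) ^ m < \<epsilon> / 2"
        using order_tendstoD(2)[OF tend, of "\<epsilon>/2"] \<open>0 < \<epsilon>\<close> by auto
      ultimately have "\<forall>\<^sub>F m in sequentially. d (z (s m)) x < \<epsilon> / 2 \<and> (1/2::real) ^ m < \<epsilon> / 2"
        by eventually_elim auto
      then obtain m where m: "d (z (s m)) x < \<epsilon> / 2" "(1/2::real) ^ m < \<epsilon> / 2"
        unfolding eventually_sequentially by auto
      have "d (z (s n)) x \<le> d (z (s n)) (z (s m)) + d (z (s m)) x"
        by (rule triangle) (use xM in auto)
      also have "d (z (s n)) (z (s m)) \<le> (1/2) ^ n + (1/2) ^ m"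
        using s unfolding G_def by auto
      finally show "d (z (s n)) x \<le> (1/2) ^ n + \<epsilon>" using m by linarith
    qed
    with xM show ?thesis by auto
  qed
  define l where "l s = (if s \<in> G then SOME x. x \<in> M \<and> (\<forall>n. d (z (s n)) x \<le> (1/2) ^ n) else z 0)" for s
  have l: "l s \<in> M" "d (z (s n)) (l s) \<le> (1/2) ^ n" if "s \<in> G" for s n
    using someI_ex[of "\<lambda>x. x \<in> M \<and> (\<forall>n. d (z (s n)) x \<le> (1/2) ^ n)"] exlim[OF that] that
    unfolding l_def by auto
  have lM: "l s \<in> M" for s
    using l(1)[of s] by (cases "s \<in> G") (auto simp: l_def)
  let ?P = "PiM UNIV (\<lambda>_::nat. count_space (UNIV :: nat set))"
  have comp_meas [measurable]: "(\<lambda>s. s n) \<in> ?P \<rightarrow>\<^sub>M count_space UNIV" for n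
    by (rule measurable_component_singleton) simp
  have Gm [measurable]: "G \<in> sets ?P"
  proof -
    have "(\<lambda>s. d (z (s n)) (z (s m))) \<in> ?P \<rightarrow>\<^sub>M borel" for n m
      by measurable
    then have "Measurable.pred ?P (\<lambda>s. \<forall>n m. d (z (s n)) (z (s m)) \<le> (1/2) ^ n + (1/2) ^ m)"
      by measurable
    then show ?thesis unfolding pred_def G_def by (simp add: space_PiM)
  qed
  have lmeas: "l \<in> ?P \<rightarrow>\<^sub>M borel_sigma Z"
    unfolding borel_sigma_def
  proof (rule measurable_measure_of)
    fix U assume "U \<in> {U. openin Z U}"
    then have U: "openin mtopology U" by (simp add: Zeq)
    \<comment> \<open>Whether a named point lies in an open set is decided by a single ball of its
      name. The inclusion of that ball in \<open>U\<close> depends on one index only, so the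
      preimage of \<open>U\<close> is a countable union of cylinders within
      \<open>G\<close>.\<close>
    have iff: "l s \<in> U \<longleftrightarrow> (\<exists>n. mcball (z (s n)) ((1/2) ^ n) \<subseteq> U)" if "s \<in> G" for s
    proof
      assume "l s \<in> U"
      then obtain r where r: "r > 0" "mball (l s) r \<subseteq> U"
        using U unfolding openin_mtopology by auto
      obtain n where n: "(1/2::real) ^ n < r / 2"
        using real_arch_pow_inv[of "r/2" "1/2"] r by auto
      have "mcball (z (s n)) ((1/2) ^ n) \<subseteq> mball (l s) r"
      proof
        fix y assume y: "y \<in> mcball (z (s n)) ((1/2) ^ n)"
        have "d (l s) y \<le> d (l s) (z (s n)) + d (z (s n)) y"
          by (rule triangle) (use lM y in auto)
        also have "d (l s) (z (s n)) \<le> (1/2) ^ n" using l(2)[OF that] commute by metis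
        also have "d (z (s n)) y \<le> (1/2) ^ n" using y by auto
        finally show "y \<in> mball (l s) r" using n y lM by auto
      qed
      then show "\<exists>n. mcball (z (s n)) ((1/2) ^ n) \<subseteq> U" using r by blast
    qed (use l[OF that] in auto)
    have "l -` U \<inter> space ?P = (G \<inter> {s\<in>space ?P. \<exists>n. mcball (z (s n)) ((1/2) ^ n) \<subseteq> U}) \<union> (if z 0 \<in> U then space ?P - G else {})"
    proof (rule set_eqI)
      fix s show "s \<in> l -` U \<inter> space ?P \<longleftrightarrow> s \<in> (G \<inter> {s\<in>space ?P. \<exists>n. mcball (z (s n)) ((1/2) ^ n) \<subseteq> U}) \<union> (if z 0 \<in> U then space ?P - G else {})"
        using iff[of s] l_def[of s] by (cases "s \<in> G") (simp_all add: space_PiM)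
    qed
    also have "\<dots> \<in> sets ?P"
    proof -
      have [measurable]: "Measurable.pred ?P (\<lambda>s. mcball (z (s n)) ((1/2) ^ n) \<subseteq> U)" for n
        by (rule measurable_compose[OF comp_meas]) simp
      have "{s\<in>space ?P. \<exists>n. mcball (z (s n)) ((1/2) ^ n) \<subseteq> U} \<in> sets ?P"
        by measurable
      then show ?thesis using Gm by (intro sets.Un sets.Int) auto
    qed
    finally show "l -` U \<inter> space ?P \<in> sets ?P" .
  qed (use lM in \<open>auto dest!: openin_subset[of Z, unfolded top]\<close>)
  define e where "e x n = (LEAST i. d (z i) x \<le> (1/2) ^ n)" for x n
  have e: "d (z (e x n)) x \<le> (1/2) ^ n" if "x \<in> M" for x n
    unfolding e_def by (rule LeastI_ex) (use dense[OF that] in auto)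
  have eG: "e x \<in> G" if "x \<in> M" for x
    unfolding G_def
  proof (safe)
    fix n m
    have "d (z (e x n)) (z (e x m)) \<le> d (z (e x n)) x + d x (z (e x m))"
      by (rule triangle) (use that in auto)
    then show "d (z (e x n)) (z (e x m)) \<le> (1/2) ^ n + (1/2) ^ m"
      using e[OF that, of n] e[OF that, of m] commute[of x "z (e x m)"] by linarith
  qed
  have le: "l (e x) = x" if x: "x \<in> M" for x
  proof -
    have "d (l (e x)) x \<le> 2 * (1/2) ^ n" for n
    proof -
      have "d (l (e x)) x \<le> d (l (e x)) (z (e x n)) + d (z (e x n)) x"
        by (rule triangle) (use x lM in auto)
      then show ?thesis using l(2)[OF eG[OF x], of n] e[OF x, of n] commute[of "l (e x)" "z (e x n)"] by linarith
    qed
    moreover have "(\<lambda>n. 2 * (1/2::real) ^ n) \<longlonglongrightarrow> 2 * 0"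
      by (intro tendsto_intros LIMSEQ_power_zero) auto
    ultimately have "d (l (e x)) x \<le> 0"
      using LIMSEQ_le_const[of "\<lambda>n. 2 * (1/2::real) ^ n"] by auto
    then show ?thesis using zero[OF lM x] nonneg[of "l (e x)" x] by auto
  qed
  have emeas: "e \<in> borel_sigma Z \<rightarrow>\<^sub>M ?P"
  proof (rule measurable_PiM_single')
    fix n
    have "{x \<in> M. d (z i) x \<le> (1/2) ^ n} \<in> sets (borel_sigma Z)" for i
    proof -
      have "{x \<in> M. d (z i) x \<le> (1/2) ^ n} = mcball (z i) ((1/2) ^ n)" by auto
      then show ?thesis using closedin_borel_sigma[of Z] closedin_mcball unfolding Zeq by simp
    qed
    then show "(\<lambda>x. e x n) \<in> borel_sigma Z \<rightarrow>\<^sub>M count_space UNIV"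
      unfolding e_def by (intro measurable_Least) (auto simp: pred_def)
  qed auto
  show ?thesis
    by (rule codedI[OF coded_nat_seq emeas lmeas]) (use le in auto)
qed

lemma coded_borel: "coded (borel :: 's::borel_space measure)"
proof -
  obtain Z :: "real topology" and B where Z: "polish_topology Z" and B [measurable]: "B \<in> sets (borel_sigma Z)"
    and h: "(euclidean :: 's topology) homeomorphic_space subtopology Z B"
    using homeomorphic_borel_subset by blast
  obtain f :: "'s \<Rightarrow> real" and g where fg: "homeomorphic_maps euclidean (subtopology Z B) f g"
    using h unfolding homeomorphic_space_def by auto
  have f: "continuous_map euclidean Z f" "\<And>x. f x \<in> B" and g: "continuous_map (subtopology Z B) euclidean g"
    and gf: "\<And>x. g (f x) = x"
    using fg unfolding homeomorphic_maps_def by (auto simp: continuous_map_in_subtopology)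
  have BZ: "B \<subseteq> topspace Z" using sets.sets_into_space[OF B] by simp
  have fZ: "f x \<in> topspace Z" for x using f BZ by auto
  show ?thesis
  proof (rule codedI[OF coded_borel_sigma[OF Z]])
    show "topspace Z \<noteq> {}" using fZ by auto
    show "f \<in> borel \<rightarrow>\<^sub>M borel_sigma Z"
      unfolding borel_sigma_def
    proof (rule measurable_measure_of)
      fix U assume "U \<in> {U. openin Z U}"
      then have "open {x. f x \<in> U}" using f(1) unfolding continuous_map_def by simp
      then show "f -` U \<inter> space borel \<in> sets borel" by (simp add: vimage_def)
    qed (use fZ in \<open>auto dest: openin_subset\<close>)
    \<comment> \<open>The inverse homeomorphism lives on \<open>B\<close> only. Since
      \<open>B\<close> is Borel, extending it by a constant keeps it measurable.\<close>
    show "(\<lambda>t. if t \<in> B then g t else undefined) \<in> borel_sigma Z \<rightarrow>\<^sub>M borel"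
    proof (rule borel_measurableI)
      fix W :: "'s set" assume "open W"
      then have "openin (subtopology Z B) {t \<in> topspace (subtopology Z B). g t \<in> W}"
        using g unfolding continuous_map_def by simp
      then obtain U where U: "openin Z U" "{t \<in> topspace (subtopology Z B). g t \<in> W} = U \<inter> B"
        unfolding openin_subtopology by auto
      then have "(\<lambda>t. if t \<in> B then g t else undefined) -` W \<inter> space (borel_sigma Z) =
         (U \<inter> B) \<union> (if undefined \<in> W then topspace Z - B else {})"
        using BZ by (auto split: if_splits)
      also have "\<dots> \<in> sets (borel_sigma Z)"
        using openin_borel_sigma[OF U(1)] B openin_borel_sigma[OF openin_topspace, of Z] by auto
      finally show "(\<lambda>t. if t \<in> B then g t else undefined) -` W \<inter> space (borel_sigma Z) \<in> sets (borel_sigma Z)" .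
    qed
  qed (use f gf in auto)
qed

section \<open>Second countability of Borel spaces\<close>

lemma polish_second_countable:
  assumes "polish_topology Z"
  shows "second_countable Z"
proof -
  obtain M d where "Metric_space M d" and Zeq: "Z = Metric_space.mtopology M d"
    using assms unfolding polish_topology_def completely_metrizable_space_def by auto
  interpret Metric_space M d by fact
  obtain C where C: "countable C" "C \<subseteq> M" "mtopology closure_of C = M"
    using assms unfolding polish_topology_def separable_space_def Zeq by auto
  let ?B = "(\<lambda>(y, n). mball y (1 / real (Suc n))) ` (C \<times> (UNIV :: nat set))"
  show ?thesis
    unfolding second_countable_def
  proof (intro exI[of _ ?B] conjI allI impI ballI)
    show "countable ?B" using C(1) by auto
    show "openin Z V" if "V \<in> ?B" for V using that by (auto simp: Zeq)
  next
    fix U x assume Ux: "openin Z U \<and> x \<in> U"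
    then have "U \<subseteq> M" "\<exists>r>0. mball x r \<subseteq> U"
      unfolding Zeq openin_mtopology by auto
    then obtain r where r: "r > 0" "mball x r \<subseteq> U" and xM: "x \<in> M"
      using Ux by auto
    obtain n where n: "1 / real (Suc n) < r / 2"
      using r(1) nat_approx_posE[of "r/2"] by auto
    have "\<forall>r>0. \<exists>y\<in>C. y \<in> mball x r"
      using C(3) xM unfolding metric_closure_of by blast
    then obtain y where y: "y \<in> C" "y \<in> mball x (1 / real (Suc n))"
      by (metis of_nat_0_less_iff zero_less_Suc zero_less_divide_1_iff)
    have "mball y (1 / real (Suc n)) \<subseteq> mball x r"
    proof
      fix u assume u: "u \<in> mball y (1 / real (Suc n))"
      have "d x u \<le> d x y + d y u" by (rule triangle) (use xM u in auto)
      then show "u \<in> mball x r" using u y n by auto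
    qed
    then show "\<exists>V\<in>?B. x \<in> V \<and> V \<subseteq> U"
      using y r C(2) commute[of x y] by (intro bexI[of _ "mball y (1 / real (Suc n))"]) auto
  qed
qed

text \<open>Second countability identifies the Borel sigma-algebra of a product of Borel spaces with
  the product of the Borel sigma-algebras (\<open>borel_prod\<close>), so that Borel maps into
  products can be built from components.\<close>

instance borel_space \<subseteq> second_countable_topology
proof
  obtain Z :: "real topology" and B where Z: "polish_topology Z"
    and h: "(euclidean :: 'a topology) homeomorphic_space subtopology Z B"
    using homeomorphic_borel_subset by blast
  have "second_countable (euclidean :: 'a topology)"
    using second_countable_subtopology[OF polish_second_countable[OF Z], of B] h
      homeomorphic_space_second_countability by blast
  then obtain \<B> :: "'a set set" where \<B>: "countable \<B>" "\<And>V. V \<in> \<B> \<Longrightarrow> open V"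
    "\<And>U x. open U \<Longrightarrow> x \<in> U \<Longrightarrow> \<exists>V\<in>\<B>. x \<in> V \<and> V \<subseteq> U"
    unfolding second_countable_def by auto
  have "open = generate_topology \<B>"
  proof (intro ext iffI)
    fix U :: "'a set" assume U: "open U"
    have "U = \<Union>{V\<in>\<B>. V \<subseteq> U}" using \<B>(3)[OF U] by blast
    also have "generate_topology \<B> \<dots>"
      by (intro generate_topology.UN) (auto intro: generate_topology.Basis)
    finally show "generate_topology \<B> U" .
  next
    fix U assume "generate_topology \<B> U"
    then show "open U" by induction (auto intro: \<B>(2))
  qed
  with \<B>(1) show "\<exists>B::'a set set. countable B \<and> open = generate_topology B" by blast
qed

subsection \<open>Universal measurability\<close>

text \<open>A point of the space supplies a Dirac measure, so the intersection is over a nonempty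
  family and consists of subsets of the space. An intersection of sigma-algebras is one already, so
  \<open>sigma\<close> adds no sets.\<close>

lemma universal_Inter_iff:
  assumes "space M \<noteq> {}"
  shows "space (universal M) = space M"
    and "A \<in> sets (universal M) \<longleftrightarrow> (\<forall>p. prob_space p \<and> sets p = sets M \<longrightarrow> A \<in> sets (completion p))"
proof -
  let ?P = "{p. prob_space p \<and> sets p = sets M}"
  let ?I = "\<Inter>p \<in> ?P. sets (completion p)"
  obtain x where "x \<in> space M" using assms by auto
  then have ret: "return M x \<in> ?P" by (auto intro: prob_space_return)
  have sp: "space p = space M" if "p \<in> ?P" for p
    using that sets_eq_imp_space_eq by auto
  have "?I \<subseteq> sets (completion (return M x))" using ret by blast
  also have "\<dots> \<subseteq> Pow (space M)" using sets.space_closed[of "completion (return M x)"] by simp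
  finally have sub: "?I \<subseteq> Pow (space M)" .
  show sp_eq: "space (universal M) = space M"
    unfolding universal_def by (rule space_measure_of[OF sub])
  have "sigma_sets (space M) ?I = ?I"
  proof
    show "sigma_sets (space M) ?I \<subseteq> ?I"
    proof safe
      fix A p assume "A \<in> sigma_sets (space M) ?I" "prob_space p" "sets p = sets M"
      then show "A \<in> sets (completion p)"
      proof (induction A rule: sigma_sets.induct)
        case (Compl a)
        then have "space (completion p) - a \<in> sets (completion p)" by (intro sets.compl_sets) auto
        then show ?case using sp[of p] Compl by simp
      qed auto
    qed
  qed auto
  moreover have "sets (universal M) = sigma_sets (space M) ?I"
    unfolding universal_def by (rule sets_measure_of[OF sub])
  ultimately show "A \<in> sets (universal M) \<longleftrightarrow> (\<forall>p. prob_space p \<and> sets p = sets M \<longrightarrow> A \<in> sets (completion p))"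
    by auto
qed

lemma space_universal [simp]: "space M \<noteq> {} \<Longrightarrow> space (universal M) = space M"
  by (rule universal_Inter_iff)

lemma sets_universalI:
  assumes "space M \<noteq> {}" "\<And>p. prob_space p \<Longrightarrow> sets p = sets M \<Longrightarrow> A \<in> sets (completion p)"
  shows "A \<in> sets (universal M)"
  using assms by (simp add: universal_Inter_iff(2))

lemma sets_universalD:
  assumes "A \<in> sets (universal M)" "prob_space p" "sets p = sets M"
  shows "A \<in> sets (completion p)"
proof -
  have "space M \<noteq> {}"
    using prob_space.not_empty[OF assms(2)] sets_eq_imp_space_eq[OF assms(3)] by simp
  then show ?thesis using assms by (simp add: universal_Inter_iff(2))
qed

lemma measurable_universalD:
  assumes f: "f \<in> universal M \<rightarrow>\<^sub>M N" and p: "prob_space p" "sets p = sets M"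
  shows "f \<in> completion p \<rightarrow>\<^sub>M N"
proof -
  have sp: "space p = space M" using sets_eq_imp_space_eq[OF p(2)] .
  then have ne: "space M \<noteq> {}" using prob_space.not_empty[OF p(1)] by simp
  show ?thesis
  proof (rule measurableI)
    fix x assume "x \<in> space (completion p)"
    then show "f x \<in> space N" using measurable_space[OF f, of x] sp ne by simp
  next
    fix A assume "A \<in> sets N"
    from sets_universalD[OF measurable_sets[OF f this] p]
    show "f -` A \<inter> space (completion p) \<in> sets (completion p)" using sp ne by simp
  qed
qed

lemma measurable_universalI:
  assumes ne: "space M \<noteq> {}" and f: "\<And>p. prob_space p \<Longrightarrow> sets p = sets M \<Longrightarrow> f \<in> completion p \<rightarrow>\<^sub>M N"
  shows "f \<in> universal M \<rightarrow>\<^sub>M N"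
proof (rule measurableI)
  obtain x where "x \<in> space M" using ne by auto
  then have "f \<in> completion (return M x) \<rightarrow>\<^sub>M N" by (intro f prob_space_return) auto
  then show "y \<in> space (universal M) \<Longrightarrow> f y \<in> space N" for y
    using ne by (auto dest: measurable_space)
  fix A assume A: "A \<in> sets N"
  show "f -` A \<inter> space (universal M) \<in> sets (universal M)"
  proof (rule sets_universalI[OF ne])
    fix p assume p: "prob_space p" "sets p = sets M"
    show "f -` A \<inter> space (universal M) \<in> sets (completion p)"
      using measurable_sets[OF f[OF p] A] sets_eq_imp_space_eq[OF p(2)] ne by simp
  qed
qed

lemma measurable_universal_mono: "f \<in> M \<rightarrow>\<^sub>M N \<Longrightarrow> space M \<noteq> {} \<Longrightarrow> f \<in> universal M \<rightarrow>\<^sub>M N"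
proof (rule measurable_universalI)
  fix p :: "'a measure" assume "f \<in> M \<rightarrow>\<^sub>M N" and p: "sets p = sets M"
  then have "f \<in> p \<rightarrow>\<^sub>M N" by (simp only: measurable_cong_sets[OF p refl])
  then show "f \<in> completion p \<rightarrow>\<^sub>M N" by (rule measurable_completion)
qed

text \<open>Closure of universal measurability under composition. Under the image law
  \<open>?q\<close> a universally measurable set is a measurable one up to a part of a null set, and
  preimages of \<open>?q\<close>-null sets are \<open>p\<close>-null.\<close>

lemma measurable_universal_universal:
  assumes f: "f \<in> universal M \<rightarrow>\<^sub>M N" and ne: "space M \<noteq> {}"
  shows "f \<in> universal M \<rightarrow>\<^sub>M universal N"
proof (rule measurable_universalI[OF ne])
  fix p assume p: "prob_space p" "sets p = sets M"
  have neN: "space N \<noteq> {}" using f ne measurable_space[OF f] by auto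
  interpret p: prob_space "completion p" by (rule prob_space.prob_space_completion[OF p(1)])
  have fm: "f \<in> completion p \<rightarrow>\<^sub>M N" by (rule measurable_universalD[OF f p])
  let ?q = "distr (completion p) N f"
  have q: "prob_space ?q" by (rule p.prob_space_distr[OF fm])
  have "f \<in> completion p \<rightarrow>\<^sub>M completion ?q"
  proof (rule measurableI)
    fix A assume "A \<in> sets (completion ?q)"
    then obtain S N' N'' where A: "A = S \<union> N'" "N' \<subseteq> N''" "N'' \<in> null_sets ?q" "S \<in> sets ?q"
      by (rule sets_completionE)
    have "f -` N'' \<inter> space p \<in> null_sets (completion p)"
      using A(3) fm unfolding null_sets_distr_iff[OF fm] by simp
    then have "f -` N' \<inter> space p \<in> sets (completion p)"
      using A(2) by (intro null_sets_completion_subset[THEN null_setsD2, of _ "f -` N'' \<inter> space p"]) auto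
    moreover have "f -` S \<inter> space p \<in> sets (completion p)"
      using measurable_sets[OF fm, of S] A(4) by simp
    ultimately have "(f -` S \<inter> space p) \<union> (f -` N' \<inter> space p) \<in> sets (completion p)" by auto
    also have "(f -` S \<inter> space p) \<union> (f -` N' \<inter> space p) = f -` A \<inter> space (completion p)"
      using A(1) by auto
    finally show "f -` A \<inter> space (completion p) \<in> sets (completion p)" .
  qed (use measurable_space[OF fm] in auto)
  then have fq: "f \<in> completion p \<rightarrow>\<^sub>M completion ?q" .
  show "f \<in> completion p \<rightarrow>\<^sub>M universal N"
  proof (rule measurableI)
    fix x assume "x \<in> space (completion p)"
    then show "f x \<in> space (universal N)" using measurable_space[OF fm, of x] neN by simp
  next
    fix A assume "A \<in> sets (universal N)"
    then have "A \<in> sets (completion ?q)" by (rule sets_universalD[OF _ q]) simp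
    from measurable_sets[OF fq this]
    show "f -` A \<inter> space (completion p) \<in> sets (completion p)" .
  qed
qed

subsection \<open>Analytic sets\<close>

lemma sets_borel_sigma_euclidean: "sets (borel_sigma euclidean) = sets borel"
  by (simp add: sets_borel_sigma borel_def sets_measure_of)

lemma polish_topology_real: "polish_topology (euclidean :: real topology)"
proof -
  obtain B :: "real set set" where "countable B" "\<And>C. C \<in> B \<Longrightarrow> open C"
    "\<And>S. open S \<Longrightarrow> \<exists>U. U \<subseteq> B \<and> S = \<Union>U"
    using univ_second_countable by blast
  then have "second_countable (euclidean :: real topology)"
    unfolding second_countable_def by (intro exI[of _ B]) (force)
  then show ?thesis
    by (simp add: polish_topology_def completely_metrizable_space_euclidean second_countable_imp_separable_space)
qed

lemma analytic_imageI:
  assumes N: "coded N" and B: "B \<in> sets N" and f: "f \<in> N \<rightarrow>\<^sub>M borel"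
  shows "analytic (f ` B)"
proof -
  obtain e d where e: "e \<in> N \<rightarrow>\<^sub>M (borel :: real measure)" and d [measurable]: "d \<in> borel \<rightarrow>\<^sub>M N"
    and de: "\<And>s. s \<in> space N \<Longrightarrow> d (e s) = s"
    using N unfolding coded_def by auto
  let ?B = "d -` B"
  have B': "?B \<in> sets (borel_sigma euclidean)"
    using measurable_sets[OF d B] by (simp add: sets_borel_sigma_euclidean)
  have "B \<subseteq> d ` ?B"
  proof
    fix s assume "s \<in> B"
    then have "d (e s) = s" using de sets.sets_into_space[OF B] by auto
    then show "s \<in> d ` ?B" using \<open>s \<in> B\<close> by (metis image_eqI vimageI)
  qed
  then have "f ` B = (\<lambda>t. f (d t)) ` ?B" by (auto simp: image_iff) blast
  moreover have "(\<lambda>t. f (d t)) \<in> borel_sigma euclidean \<rightarrow>\<^sub>M borel"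
    using measurable_compose[OF d f] by (simp add: measurable_cong_sets[OF sets_borel_sigma_euclidean refl])
  then have "(\<lambda>t. f (d t)) \<in> restrict_space (borel_sigma euclidean) ?B \<rightarrow>\<^sub>M borel"
    by (rule measurable_restrict_space1)
  ultimately show ?thesis
    unfolding analytic_def using polish_topology_real B' by blast
qed

text \<open>Frees the parameter space from the arbitrary Polish topology of the definition: a Borel
  subset of the real line with its usual topology always suffices.\<close>

lemma analytic_code:
  assumes "analytic (D :: 's::topological_space set)"
  obtains B f where "B \<in> sets (borel :: real measure)" "f \<in> borel \<rightarrow>\<^sub>M borel" "D = f ` B"
proof (cases "D = {}")
  case True
  then show ?thesis by (intro that[of "{}" "\<lambda>_. undefined"]) auto
next
  case False
  then obtain Z :: "real topology" and B f where Z: "polish_topology Z" and B: "B \<in> sets (borel_sigma Z)"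
    and f: "f \<in> restrict_space (borel_sigma Z) B \<rightarrow>\<^sub>M borel" and D: "D = f ` B"
    using assms unfolding analytic_def by auto
  have BZ: "B \<subseteq> topspace Z" using sets.sets_into_space[OF B] by simp
  then have "coded (borel_sigma Z)" using D False by (intro coded_borel_sigma Z) auto
  then obtain e d where e: "e \<in> borel_sigma Z \<rightarrow>\<^sub>M (borel :: real measure)" and d [measurable]: "d \<in> borel \<rightarrow>\<^sub>M borel_sigma Z"
    and de: "\<And>s. s \<in> topspace Z \<Longrightarrow> d (e s) = s"
    unfolding coded_def by auto
  let ?f = "\<lambda>z. if z \<in> B then f z else undefined"
  have "?f \<in> borel_sigma Z \<rightarrow>\<^sub>M borel"
    using f B BZ by (subst measurable_restrict_space_iff[symmetric]) (auto simp: Int_absorb2)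
  then have "(\<lambda>t. ?f (d t)) \<in> borel \<rightarrow>\<^sub>M borel"
    by (rule measurable_compose[OF d])
  moreover have "d -` B \<in> sets borel" using measurable_sets[OF d B] by simp
  moreover have "D = (\<lambda>t. ?f (d t)) ` (d -` B)"
  proof -
    have "d ` (d -` B) = B"
    proof
      show "B \<subseteq> d ` (d -` B)"
      proof
        fix s assume "s \<in> B"
        then have "d (e s) = s" using de BZ by blast
        then show "s \<in> d ` (d -` B)" using \<open>s \<in> B\<close> by (intro rev_image_eqI[of "e s"]) auto
      qed
    qed auto
    then have "D = f ` d ` (d -` B)" using D by simp
    then show ?thesis by (auto simp: image_iff)
  qed
  ultimately show ?thesis using that by blast
qed

text \<open>The equation is tested on the codes: \<open>d\<close> undoes \<open>e\<close>, so
  \<open>e\<close> is injective on the space, and equality of reals is measurable.\<close>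

lemma coded_eq_measurable:
  assumes N: "coded N" and f [measurable]: "f \<in> M \<rightarrow>\<^sub>M N" and g [measurable]: "g \<in> M \<rightarrow>\<^sub>M N"
  shows "{x\<in>space M. f x = g x} \<in> sets M"
proof -
  obtain e d where e [measurable]: "e \<in> N \<rightarrow>\<^sub>M (borel :: real measure)"
    and de: "\<And>s. s \<in> space N \<Longrightarrow> d (e s) = s"
    using N unfolding coded_def by auto
  have "{x\<in>space M. f x = g x} = {x\<in>space M. e (f x) = e (g x)}"
    using de measurable_space[OF f] measurable_space[OF g] by metis
  also have "\<dots> \<in> sets M" by measurable
  finally show ?thesis .
qed

text \<open>The graph of the parametrization, turned on its side. In this form a point of an
  analytic set has a real witness \<open>t\<close>, and set operations become operations on
  witnesses.\<close>

lemma analytic_projE: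
  assumes S: "coded (borel :: 's measure)" and D: "analytic (D :: 's::topological_space set)"
  obtains R where "R \<in> sets ((borel :: 's measure) \<Otimes>\<^sub>M (borel :: real measure))" "D = {s. \<exists>t. (s, t) \<in> R}"
proof -
  obtain B f where B [measurable]: "B \<in> sets (borel :: real measure)" and f [measurable]: "f \<in> borel \<rightarrow>\<^sub>M (borel :: 's measure)"
    and Df: "D = f ` B"
    using analytic_code[OF D] by auto
  let ?M = "(borel :: 's measure) \<Otimes>\<^sub>M (borel :: real measure)"
  have [measurable]: "{x\<in>space ?M. f (snd x) = fst x} \<in> sets ?M"
    by (rule coded_eq_measurable[OF S]) measurable
  have "{x\<in>space ?M. f (snd x) = fst x} \<inter> {x\<in>space ?M. snd x \<in> B} \<in> sets ?M"
    by measurable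
  then show ?thesis
    by (rule that) (use Df in \<open>auto simp: space_pair_measure\<close>)
qed

lemma analytic_projI:
  assumes "coded (borel :: 's::topological_space measure)" "coded N"
    "R \<in> sets ((borel :: 's measure) \<Otimes>\<^sub>M N)"
  shows "analytic {s. \<exists>t. (s, t) \<in> R}"
proof -
  have "analytic (fst ` R)"
    using assms by (intro analytic_imageI[OF coded_pair]) auto
  also have "fst ` R = {s. \<exists>t. (s, t) \<in> R}" by force
  finally show ?thesis .
qed

lemma analytic_image:
  assumes D: "analytic D" and g: "g \<in> borel \<rightarrow>\<^sub>M borel"
  shows "analytic (g ` D)"
proof -
  obtain B f where B: "B \<in> sets (borel :: real measure)" and f: "f \<in> borel \<rightarrow>\<^sub>M borel"
    and Df: "D = f ` B"
    using analytic_code[OF D] by auto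
  have "analytic ((\<lambda>t. g (f t)) ` B)"
    by (rule analytic_imageI[OF coded_real B measurable_compose[OF f g]])
  then show ?thesis by (simp add: Df image_image)
qed

lemma analytic_borel:
  assumes "coded (borel :: 's::topological_space measure)" "B \<in> sets (borel :: 's measure)"
  shows "analytic B"
  using analytic_imageI[OF assms, of "\<lambda>x. x"] by simp

lemma analytic_UN:
  assumes S: "coded (borel :: 's::topological_space measure)" and D: "\<And>n::nat. analytic (D n :: 's set)"
  shows "analytic (\<Union>n. D n)"
proof -
  have "\<forall>n. \<exists>R. R \<in> sets ((borel :: 's measure) \<Otimes>\<^sub>M (borel :: real measure)) \<and> D n = {s. \<exists>t. (s, t) \<in> R}"
    using analytic_projE[OF S D] by metis
  then obtain R where R: "\<And>n. R n \<in> sets ((borel :: 's measure) \<Otimes>\<^sub>M (borel :: real measure))" 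
    and D': "\<And>n. D n = {s. \<exists>t. (s, t) \<in> R n}"
    by metis
  have "analytic {s. \<exists>t. (s, t) \<in> (\<Union>n. R n)}"
    using R by (intro analytic_projI[OF S coded_real]) auto
  also have "{s. \<exists>t. (s, t) \<in> (\<Union>n. R n)} = (\<Union>n. D n)" by (auto simp: D')
  finally show ?thesis .
qed

text \<open>The witnesses for all \<open>n\<close> are collected into one sequence of reals, and
  sequences of reals can again be coded by reals.\<close>

lemma analytic_INT:
  assumes S: "coded (borel :: 's::topological_space measure)" and D: "\<And>n::nat. analytic (D n :: 's set)"
  shows "analytic (\<Inter>n. D n)"
proof -
  have "\<forall>n. \<exists>R. R \<in> sets ((borel :: 's measure) \<Otimes>\<^sub>M (borel :: real measure)) \<and> D n = {s. \<exists>t. (s, t) \<in> R}"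
    using analytic_projE[OF S D] by metis
  then obtain R where R [measurable]: "\<And>n. R n \<in> sets ((borel :: 's measure) \<Otimes>\<^sub>M (borel :: real measure))" 
    and D': "\<And>n. D n = {s. \<exists>t. (s, t) \<in> R n}"
    by metis
  let ?P = "PiM UNIV (\<lambda>_::nat. borel :: real measure)"
  let ?M = "(borel :: 's measure) \<Otimes>\<^sub>M ?P"
  have [measurable]: "(\<lambda>s. s i) \<in> ?P \<rightarrow>\<^sub>M (borel :: real measure)" for i
    by (rule measurable_component_singleton) simp
  have "{x \<in> space ?M. \<forall>n. (fst x, snd x n) \<in> R n} \<in> sets ?M"
    by measurable
  then have "analytic {s. \<exists>t. (s, t) \<in> {x \<in> space ?M. \<forall>n. (fst x, snd x n) \<in> R n}}"
    by (rule analytic_projI[OF S coded_real_seq])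
  also have "{s. \<exists>t. (s, t) \<in> {x \<in> space ?M. \<forall>n. (fst x, snd x n) \<in> R n}} = (\<Inter>n. D n)"
    by (auto simp: D' space_pair_measure space_PiM) metis
  finally show ?thesis .
qed

lemma analytic_Int:
  assumes "coded (borel :: 's::topological_space measure)" "analytic (A :: 's set)" "analytic B"
  shows "analytic (A \<inter> B)"
proof -
  have "analytic (\<Inter>n::nat. if n = 0 then A else B)"
    by (rule analytic_INT) (use assms in auto)
  also have "(\<Inter>n::nat. if n = 0 then A else B) = A \<inter> B" by (auto split: if_splits)
  finally show ?thesis .
qed

lemma analytic_UN_countable:
  assumes "coded (borel :: 's::topological_space measure)" "\<And>n::'i::countable. analytic (D n :: 's set)"
  shows "analytic (\<Union>n. D n)"
proof -
  have "analytic (\<Union>n::nat. if n \<in> range (to_nat :: 'i \<Rightarrow> nat) then D (from_nat n) else {})"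
    by (rule analytic_UN[OF assms(1)]) (use assms(2) in \<open>auto simp: analytic_def\<close>)
  also have "(\<Union>n::nat. if n \<in> range (to_nat :: 'i \<Rightarrow> nat) then D (from_nat n) else {}) = (\<Union>n. D n)"
    by (auto split: if_splits)
  finally show ?thesis .
qed

lemma analytic_vimage:
  assumes S: "coded (borel :: 's::topological_space measure)" and R: "coded (borel :: 'r::topological_space measure)"
    and D: "analytic (D :: 'r set)" and g [measurable]: "g \<in> (borel :: 's measure) \<rightarrow>\<^sub>M (borel :: 'r measure)"
  shows "analytic {x. g x \<in> D}"
proof -
  obtain Q where Q [measurable]: "Q \<in> sets ((borel :: 'r measure) \<Otimes>\<^sub>M (borel :: real measure))" and D: "D = {s. \<exists>t. (s, t) \<in> Q}"
    by (rule analytic_projE[OF R D])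
  let ?M = "(borel :: 's measure) \<Otimes>\<^sub>M (borel :: real measure)"
  have "{x\<in>space ?M. (g (fst x), snd x) \<in> Q} \<in> sets ?M" by measurable
  from analytic_projI[OF S coded_real this] show ?thesis
    by (simp add: D space_pair_measure)
qed

subsection \<open>The Suslin operation and measurable selection\<close>

definition suslin :: "(nat list \<Rightarrow> 's set) \<Rightarrow> 's set" where
  "suslin C = {x. \<exists>s. \<forall>n. x \<in> C (map s [0..<n])}"

text \<open>The part of the Suslin set obtained from the branches that pass through the node
  \<sigma>.\<close>

definition suslin_from :: "(nat list \<Rightarrow> 's set) \<Rightarrow> nat list \<Rightarrow> 's set" where
  "suslin_from C \<sigma> = {x. \<exists>s. map s [0..<length \<sigma>] = \<sigma> \<and> (\<forall>n. x \<in> C (map s [0..<n]))}"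

lemma suslin_from_Nil: "suslin_from C [] = suslin C"
  by (simp add: suslin_from_def suslin_def)

lemma suslin_from_split: "suslin_from C \<sigma> = (\<Union>i. suslin_from C (\<sigma> @ [i]))"
proof -
  have "map s [0..<length (\<sigma> @ [i])] = \<sigma> @ [i] \<longleftrightarrow> map s [0..<length \<sigma>] = \<sigma> \<and> s (length \<sigma>) = i" for s i
    by simp
  then show ?thesis unfolding suslin_from_def by (simp only:) blast
qed

lemma suslin_from_subset: "suslin_from C \<sigma> \<subseteq> C \<sigma>"
proof
  fix x assume "x \<in> suslin_from C \<sigma>"
  then obtain s where "map s [0..<length \<sigma>] = \<sigma>" "\<And>n. x \<in> C (map s [0..<n])"
    unfolding suslin_from_def by auto
  then show "x \<in> C \<sigma>" by metis
qed

text \<open>The condition says that one of \<sigma> and \<tau> is a prefix of the other. Emptying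
  all other nodes leaves just the branches through \<sigma>, so facts about \<open>suslin\<close>
  carry over to the parts.\<close>

lemma suslin_from_eq:
  fixes C :: "nat list \<Rightarrow> 's set"
  shows "suslin_from C \<sigma> = suslin (\<lambda>\<tau>. if take (length \<tau>) \<sigma> = take (length \<sigma>) \<tau> then C \<tau> else {})"
proof -
  have "map s [0..<length \<sigma>] = \<sigma> \<longleftrightarrow> (\<forall>n. take n \<sigma> = take (length \<sigma>) (map s [0..<n]))" for s :: "nat \<Rightarrow> nat"
  proof
    assume h: "map s [0..<length \<sigma>] = \<sigma>"
    show "\<forall>n. take n \<sigma> = take (length \<sigma>) (map s [0..<n])"
    proof
      fix n
      show "take n \<sigma> = take (length \<sigma>) (map s [0..<n])"
        by (subst h[symmetric]) (cases "n \<le> length \<sigma>"; simp add: take_map)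
    qed
  next
    assume "\<forall>n. take n \<sigma> = take (length \<sigma>) (map s [0..<n])"
    from this[rule_format, of "length \<sigma>"] show "map s [0..<length \<sigma>] = \<sigma>" by simp
  qed
  moreover have "x \<in> (if b then X else {}) \<longleftrightarrow> b \<and> x \<in> X" for x :: 's and b X by simp
  ultimately show ?thesis
    unfolding suslin_from_def suslin_def by (simp add: all_conj_distrib)
qed

lemma branch_eq:
  assumes "\<And>n. g (Suc n) = g n @ [f n]" "g 0 = []"
  shows "map f [0..<n] = g n"
  by (induction n) (use assms in auto)

text \<open>
  Let \<open>B \<sigma>\<close> be a measurable envelope of the part of the Suslin set that belongs to the node \<open>\<sigma>\<close>. It is
  covered by the envelopes of the children of \<open>\<sigma>\<close> up to a null set, and outside these countably many null
  sets one can descend from \<open>B []\<close> along a branch.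
\<close>

lemma suslin_completion:
  assumes p: "finite_measure p" and C: "\<And>\<sigma>. C \<sigma> \<in> sets p"
  shows "suslin C \<in> sets (completion p)"
proof -
  interpret finite_measure p by fact
  have sub: "suslin_from C \<sigma> \<subseteq> space p" for \<sigma>
    using suslin_from_subset[of C \<sigma>] sets.sets_into_space[OF C] by auto
  have "\<exists>E\<in>sets p. suslin_from C \<sigma> \<subseteq> E \<and> outer_measure_of p (suslin_from C \<sigma>) = emeasure p E" for \<sigma>
    by (rule outer_measure_of_attain[OF sub])
  then obtain E where E: "\<And>\<sigma>. E \<sigma> \<in> sets p" "\<And>\<sigma>. suslin_from C \<sigma> \<subseteq> E \<sigma>"
    "\<And>\<sigma>. outer_measure_of p (suslin_from C \<sigma>) = emeasure p (E \<sigma>)"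
    by metis
  define B where "B \<sigma> = E \<sigma> \<inter> C \<sigma>" for \<sigma>
  have B: "B \<sigma> \<in> sets p" "suslin_from C \<sigma> \<subseteq> B \<sigma>" for \<sigma>
    unfolding B_def using E C suslin_from_subset[of C \<sigma>] by auto
  define N where "N \<sigma> = B \<sigma> - (\<Union>i. B (\<sigma> @ [i]))" for \<sigma>
  have "N \<sigma> \<in> null_sets p" for \<sigma>
  proof
    show Ns: "N \<sigma> \<in> sets p" unfolding N_def using B by auto
    let ?F = "B \<sigma> \<inter> (\<Union>i. B (\<sigma> @ [i]))"
    have F: "?F \<in> sets p" using B by auto
    have "suslin_from C \<sigma> \<subseteq> ?F"
    proof -
      have "suslin_from C \<sigma> \<subseteq> (\<Union>i. B (\<sigma> @ [i]))"
        unfolding suslin_from_split[of C \<sigma>] by (rule UN_mono) (use B(2) in auto)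
      then show ?thesis using B(2)[of \<sigma>] by simp
    qed
    \<comment> \<open>\<open>?F\<close> is measurable and still covers the part at \<sigma>, so it
      cannot have less measure than the minimal envelope \<open>E\<close>. As the measure is finite,
      the difference \<open>N\<close> has measure 0.\<close>
    then have "emeasure p (E \<sigma>) \<le> emeasure p ?F"
      using outer_measure_of_mono[of _ ?F p] F by (simp flip: E(3))
    then have "emeasure p (B \<sigma>) \<le> emeasure p ?F"
      using emeasure_mono[of "B \<sigma>" "E \<sigma>" p] E(1) by (force simp: B_def)
    moreover have "emeasure p (B \<sigma>) = emeasure p (N \<sigma>) + emeasure p ?F"
      using Ns F by (subst plus_emeasure) (auto simp: N_def intro!: arg_cong[where f="emeasure p"])
    ultimately show "emeasure p (N \<sigma>) = 0"
      using emeasure_finite[of ?F] ennreal_add_left_cancel_le[of "emeasure p ?F" "emeasure p (N \<sigma>)" 0]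
      by (auto simp: add.commute)
  qed
  then have N: "(\<Union>\<sigma>. N \<sigma>) \<in> null_sets p" by auto
  have "B [] - (\<Union>\<sigma>. N \<sigma>) \<subseteq> suslin C"
  proof
    fix x assume x: "x \<in> B [] - (\<Union>\<sigma>. N \<sigma>)"
    then have ext: "\<exists>i. x \<in> B (\<sigma> @ [i])" if "x \<in> B \<sigma>" for \<sigma>
      using that unfolding N_def by auto
    define g where "g = rec_nat [] (\<lambda>_ \<tau>. \<tau> @ [SOME i. x \<in> B (\<tau> @ [i])])"
    define s where "s n = (SOME i. x \<in> B (g n @ [i]))" for n
    have g: "g 0 = []" "g (Suc n) = g n @ [s n]" for n
      unfolding g_def s_def by auto
    have xB: "x \<in> B (g n)" for n
    proof (induction n)
      case (Suc n)
      then show ?case unfolding g s_def by (rule someI_ex[OF ext])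
    qed (use x g in auto)
    have "x \<in> C (map s [0..<n])" for n
      using xB[of n] branch_eq[of g s n] g unfolding B_def by auto
    then show "x \<in> suslin C" unfolding suslin_def by auto
  qed
  then have "suslin C = (B [] - (\<Union>\<sigma>. N \<sigma>)) \<union> (suslin C \<inter> (\<Union>\<sigma>. N \<sigma>))"
    using B(2)[of "[]"] by (auto simp: suslin_from_Nil)
  then show ?thesis
    by (rule sets_completionI[of _ _ _ "\<Union>\<sigma>. N \<sigma>"]) (use N B in auto)
qed

lemma suslin_universal:
  assumes "space M \<noteq> {}" "\<And>\<sigma>. C \<sigma> \<in> sets M"
  shows "suslin C \<in> sets (universal M)"
  by (rule sets_universalI) (use assms in \<open>auto intro!: suslin_completion prob_space.finite_measure\<close>)

lemma suslin_from_universal: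
  assumes "space M \<noteq> {}" "\<And>\<sigma>. C \<sigma> \<in> sets M"
  shows "suslin_from C \<sigma> \<in> sets (universal M)"
  unfolding suslin_from_eq by (rule suslin_universal) (use assms in auto)

section \<open>Closure of Suslin sets under countable operations\<close>

definition suslin_sets :: "'s set set \<Rightarrow> 's set set" where
  "suslin_sets \<E> = {suslin C |C. \<forall>\<sigma>. C \<sigma> \<in> \<E>}"

lemma suslin_sets_base: "E \<in> \<E> \<Longrightarrow> E \<in> suslin_sets \<E>"
  unfolding suslin_sets_def suslin_def by (rule CollectI, rule exI[of _ "\<lambda>_. E"]) auto

text \<open>The first entry of a branch chooses the index \<open>j\<close>, the remaining entries
  form a branch of the scheme of \<open>A j\<close>. The root imposes no condition, whence
  \<open>UNIV \<in> \<E>\<close>.\<close>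

lemma suslin_sets_UN:
  assumes U: "UNIV \<in> \<E>" and A: "\<And>j::nat. A j \<in> suslin_sets \<E>"
  shows "(\<Union>j. A j) \<in> suslin_sets \<E>"
proof -
  have "\<forall>j. \<exists>C. (\<forall>\<sigma>. C \<sigma> \<in> \<E>) \<and> A j = suslin C"
    using A unfolding suslin_sets_def by blast
  then obtain C where C: "\<And>j \<sigma>. C j \<sigma> \<in> \<E>" "\<And>j. A j = suslin (C j)" by metis
  let ?C = "\<lambda>\<sigma>. case \<sigma> of [] \<Rightarrow> UNIV | j # \<tau> \<Rightarrow> C j \<tau>"
  have map_Suc: "map s [0..<Suc n] = s 0 # map (\<lambda>i. s (Suc i)) [0..<n]" for s :: "nat \<Rightarrow> nat" and n
    by (rule map_upt_Suc)
  have "(\<Union>j. A j) = suslin ?C"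
  proof (intro equalityI subsetI)
    fix x assume "x \<in> (\<Union>j. A j)"
    then obtain j s where s: "\<And>n. x \<in> C j (map s [0..<n])" unfolding C suslin_def by auto
    have "x \<in> ?C (map (case_nat j s) [0..<n])" for n
      using s by (cases n) (auto simp: map_Suc simp del: upt_Suc)
    then show "x \<in> suslin ?C" unfolding suslin_def by blast
  next
    fix x assume "x \<in> suslin ?C"
    then obtain s where s: "\<And>n. x \<in> ?C (map s [0..<n])" unfolding suslin_def by auto
    have "x \<in> C (s 0) (map (\<lambda>i. s (Suc i)) [0..<n])" for n
      using s[of "Suc n"] by (simp add: map_Suc del: upt_Suc)
    then show "x \<in> (\<Union>j. A j)" unfolding C suslin_def by blast
  qed
  moreover have "?C \<sigma> \<in> \<E>" for \<sigma> using C(1) U by (cases \<sigma>) auto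
  ultimately show ?thesis unfolding suslin_sets_def by blast
qed

lemma prod_encode_mono_snd: "i < i' \<Longrightarrow> prod_encode (j, i) < prod_encode (j, i')"
proof -
  assume "i < i'"
  have "strict_mono triangle"
    by (rule strict_monoI_Suc) simp
  then have "triangle (j + i) < triangle (j + i')"
    using \<open>i < i'\<close> strict_monoD[of triangle "j + i" "j + i'"] by simp
  then show ?thesis
    unfolding prod_encode_def by simp
qed

text \<open>
  One sequence \<open>s\<close> codes the sequences \<open>s (prod_encode (j, i))\<close>, one for each \<open>j\<close>. The node of the \<open>j\<close>-th
  scheme at level \<open>i\<close> is tested at level \<open>prod_encode (j, i)\<close>, when its entries are all known.
\<close>

lemma suslin_sets_INT:
  assumes A: "\<And>j::nat. A j \<in> suslin_sets \<E>"
  shows "(\<Inter>j. A j) \<in> suslin_sets \<E>"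
proof -
  have "\<forall>j. \<exists>C. (\<forall>\<sigma>. C \<sigma> \<in> \<E>) \<and> A j = suslin C"
    using A unfolding suslin_sets_def by blast
  then obtain C where C: "\<And>j \<sigma>. C j \<sigma> \<in> \<E>" "\<And>j. A j = suslin (C j)" by metis
  define C' where "C' \<sigma> = (case prod_decode (length \<sigma>) of (j, i) \<Rightarrow> C j (map (\<lambda>i'. \<sigma> ! prod_encode (j, i')) [0..<i]))" for \<sigma>
  have key: "C' (map s [0..<prod_encode (j, i)]) = C j (map (\<lambda>i'. s (prod_encode (j, i'))) [0..<i])" for s j i
  proof -
    have eq: "map (\<lambda>i'. map s [0..<prod_encode (j, i)] ! prod_encode (j, i')) [0..<i] = map (\<lambda>i'. s (prod_encode (j, i'))) [0..<i]"
      using prod_encode_mono_snd[of _ i j] by auto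
    show ?thesis
      unfolding C'_def by (simp only: length_map length_upt diff_zero prod_encode_inverse prod.case eq)
  qed
  have "(\<Inter>j. A j) = suslin C'"
  proof (intro equalityI subsetI)
    fix x assume "x \<in> (\<Inter>j. A j)"
    then have "\<forall>j. \<exists>s. \<forall>n. x \<in> C j (map s [0..<n])" unfolding C suslin_def by auto
    then obtain s where s: "\<And>j n. x \<in> C j (map (s j) [0..<n])" by metis
    let ?s = "\<lambda>n. case prod_decode n of (j, i) \<Rightarrow> s j i"
    have "x \<in> C' (map ?s [0..<n])" for n
    proof -
      obtain j i where n: "n = prod_encode (j, i)" by (metis prod_decode_inverse surj_pair)
      show ?thesis unfolding n key using s[of j i] by simp
    qed
    then show "x \<in> suslin C'" unfolding suslin_def by blast
  next
    fix x assume "x \<in> suslin C'"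
    then obtain s where s: "\<And>n. x \<in> C' (map s [0..<n])" unfolding suslin_def by auto
    have "x \<in> C j (map (\<lambda>i'. s (prod_encode (j, i'))) [0..<i])" for j i
      using s[of "prod_encode (j, i)"] unfolding key .
    then show "x \<in> (\<Inter>j. A j)" unfolding C suslin_def by blast
  qed
  moreover have "C' \<sigma> \<in> \<E>" for \<sigma> unfolding C'_def using C(1) by (auto split: prod.split)
  ultimately show ?thesis unfolding suslin_sets_def by blast
qed

text \<open>The sets that are Suslin together with their complements form a sigma-algebra, because
  unions and intersections are both available. Complements therefore have to be examined for
  generators only.\<close>

lemma sigma_sets_suslin:
  assumes U: "UNIV \<in> \<E>" and compl: "\<And>E. E \<in> \<E> \<Longrightarrow> - E \<in> suslin_sets \<E>" and A: "A \<in> sigma_sets UNIV \<E>"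
  shows "A \<in> suslin_sets \<E>"
proof -
  have "A \<in> suslin_sets \<E> \<and> - A \<in> suslin_sets \<E>"
    using A
  proof (induction A rule: sigma_sets.induct)
    case (Basic a)
    then show ?case using compl suslin_sets_base by auto
  next
    case Empty
    then show ?case using compl[OF U] suslin_sets_base[OF U] by auto
  next
    case (Compl a)
    then show ?case by (simp add: Compl_eq_Diff_UNIV[symmetric])
  next
    case (Union a)
    then show ?case using suslin_sets_UN[OF U, of a] suslin_sets_INT[of "\<lambda>i. - a i"] by auto
  qed
  then show ?thesis ..
qed

text \<open>Closed second factors are what the selection argument needs: a limit of points taken
  along a branch then stays in the node. The complement of a closed set of reals is a countable
  union of closed sets, so these rectangles satisfy the hypothesis on complements.\<close>

lemma pair_real_suslin:
  assumes sp: "space M = UNIV" and R: "R \<in> sets (M \<Otimes>\<^sub>M (borel :: real measure))"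
  shows "R \<in> suslin_sets {E \<times> F |E F. E \<in> sets M \<and> closed F}" (is "_ \<in> suslin_sets ?E")
proof (rule sigma_sets_suslin)
  have U: "UNIV \<in> sets M" using sets.top[of M] sp by simp
  show UE: "UNIV \<in> ?E" using U by (auto intro!: exI[of _ UNIV])
  show "- X \<in> suslin_sets ?E" if X: "X \<in> ?E" for X
  proof -
    obtain E F where EF: "X = E \<times> F" "E \<in> sets M" "closed F" using X by auto
    have "open (- F)" using EF(3) by auto
    then obtain G :: "nat \<Rightarrow> real set" where "\<And>n. compact (G n)" and G2: "\<Union> (range G) = - F"
      by (rule open_Union_compact_subsets) blast
    then have G: "\<And>n. closed (G n)" "\<Union> (range G) = - F"
      by (auto intro: compact_imp_closed)
    let ?R = "\<lambda>n. if n = 0 then (UNIV - E) \<times> UNIV else UNIV \<times> G (n - 1)"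
    have eq: "- X = (\<Union>n. ?R n)"
    proof -
      have "(\<Union>n. ?R n) = (UNIV - E) \<times> UNIV \<union> (\<Union>n. UNIV \<times> G n)"
        by (auto split: if_splits)
      also have "(\<Union>n. UNIV \<times> G n) = UNIV \<times> (\<Union> (range G))" by auto
      finally show ?thesis unfolding G(2) EF(1) by auto
    qed
    have 2: "?R n \<in> ?E" for n
      using EF(2) G(1) U sp sets.compl_sets[OF EF(2)] by (cases n) auto
    show ?thesis
      unfolding eq by (rule suslin_sets_UN[OF UE suslin_sets_base[OF 2]])
  qed
  have rect: "X \<in> sigma_sets UNIV ?E" if X: "X \<in> {a \<times> b |a b. a \<in> sets M \<and> b \<in> sets (borel :: real measure)}" for X
  proof -
    obtain a b where X: "X = a \<times> b" "a \<in> sets M" "b \<in> sets (borel :: real measure)"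
      using X by auto
    have "b \<in> sigma_sets UNIV (Collect closed)"
      using X(3) unfolding borel_eq_closed by simp
    then have b: "(UNIV :: 'a set) \<times> b \<in> sigma_sets UNIV ?E"
    proof (induction b rule: sigma_sets.induct)
      case (Basic F)
      then show ?case using U by (intro sigma_sets.Basic) auto
    next
      case Empty
      then show ?case by (simp add: sigma_sets.Empty)
    next
      case (Compl F)
      then have "UNIV - UNIV \<times> F \<in> sigma_sets UNIV ?E" by (intro sigma_sets.Compl)
      also have "UNIV - UNIV \<times> F = UNIV \<times> (UNIV - F)" by auto
      finally show ?case .
    next
      case (Union F)
      then have "(\<Union>i. UNIV \<times> F i) \<in> sigma_sets UNIV ?E" by (intro sigma_sets.Union)
      also have "(\<Union>i. UNIV \<times> F i) = UNIV \<times> (\<Union>i. F i)" by auto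
      finally show ?case .
    qed
    interpret S: sigma_algebra UNIV "sigma_sets UNIV ?E"
      by (rule sigma_algebra_sigma_sets) auto
    have "a \<times> UNIV \<in> sigma_sets UNIV ?E"
      using X(2) by (intro sigma_sets.Basic) auto
    then have "(a \<times> UNIV) \<inter> (UNIV \<times> b) \<in> sigma_sets UNIV ?E"
      using b by (rule S.Int)
    also have "(a \<times> UNIV) \<inter> (UNIV \<times> b) = X" using X by auto
    finally show ?thesis .
  qed
  show "R \<in> sigma_sets UNIV ?E"
  proof -
    have "R \<in> sigma_sets UNIV {a \<times> b |a b. a \<in> sets M \<and> b \<in> sets (borel :: real measure)}"
      using R by (simp add: sets_pair_measure sp)
    also have "\<dots> \<subseteq> sigma_sets UNIV ?E"
      by (rule sigma_sets_mono) (use rect in blast)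
    finally show ?thesis .
  qed
qed

text \<open>
  The selector follows the leftmost branch through \<open>x\<close>; the second coordinate is the limit of the minima
  of the compact sets \<open>K\<close> along this branch.
\<close>

lemma selection_unit_interval:
  assumes sp: "space M = UNIV" and R: "R \<in> sets (M \<Otimes>\<^sub>M (borel :: real measure))" and R01: "R \<subseteq> UNIV \<times> {0..1}"
  shows "\<exists>\<phi>\<in>universal M \<rightarrow>\<^sub>M (borel :: real measure). \<forall>x y. (x, y) \<in> R \<longrightarrow> (x, \<phi> x) \<in> R"
proof -
  have ne: "space M \<noteq> {}" using sp by simp
  have spU [simp]: "space (universal M) = UNIV" using sp ne by simp
  obtain C where RC: "R = suslin C" and C: "\<forall>\<sigma>. C \<sigma> \<in> {E \<times> F |E F. E \<in> sets M \<and> closed F}"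
    using pair_real_suslin[OF sp R] unfolding suslin_sets_def by auto
  then have "\<forall>\<sigma>. \<exists>E F. C \<sigma> = E \<times> F \<and> E \<in> sets M \<and> closed F" by auto
  then obtain E F where EF: "\<And>\<sigma>. C \<sigma> = E \<sigma> \<times> F \<sigma>" "\<And>\<sigma>. E \<sigma> \<in> sets M" "\<And>\<sigma>. closed (F \<sigma>)"
    by metis
  \<comment> \<open>Intersecting over all prefixes makes the sets decrease along branches; the
    factor \<open>{0..1}\<close> makes them compact.\<close>
  define K where "K \<sigma> = {0..1} \<inter> (\<Inter>n\<le>length \<sigma>. F (take n \<sigma>))" for \<sigma>
  have Kc: "closed (K \<sigma>)" for \<sigma> unfolding K_def using EF(3) by auto
  have KF: "K \<sigma> \<subseteq> F \<sigma>" and K01: "K \<sigma> \<subseteq> {0..1}" for \<sigma> unfolding K_def by auto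
  have Kmono: "K (\<sigma> @ [i]) \<subseteq> K \<sigma>" for \<sigma> i
  proof
    fix y assume y: "y \<in> K (\<sigma> @ [i])"
    have "y \<in> F (take n \<sigma>)" if "n \<le> length \<sigma>" for n
    proof -
      have "n \<le> length (\<sigma> @ [i])" using that by simp
      then have "y \<in> F (take n (\<sigma> @ [i]))" using y unfolding K_def by blast
      then show ?thesis using that by simp
    qed
    then show "y \<in> K \<sigma>" using y unfolding K_def by auto
  qed
  \<comment> \<open>Nodes with empty \<open>K\<close> are deleted. Every branch that keeps
    \<open>x\<close> in the sets \<open>E'\<close> thus carries a decreasing sequence of nonempty
    compact sets and leads to a point of the fibre over \<open>x\<close>, whatever point of the
    fibre the branch was found from.\<close>
  define E' where "E' \<sigma> = (if K \<sigma> = {} then {} else E \<sigma>)" for \<sigma>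
  define A where "A = suslin_from E'"
  have A [measurable]: "A \<sigma> \<in> sets (universal M)" for \<sigma>
    unfolding A_def using EF(2) by (intro suslin_from_universal ne) (auto simp: E'_def)
  define pre where "pre = (\<lambda>n x. rec_nat [] (\<lambda>_ \<tau>. \<tau> @ [LEAST i. x \<in> A (\<tau> @ [i])]) n)"
  have pre: "pre 0 x = []" "pre (Suc n) x = pre n x @ [LEAST i. x \<in> A (pre n x @ [i])]" for n x
    unfolding pre_def by auto
  have pre_meas: "pre n \<in> universal M \<rightarrow>\<^sub>M count_space UNIV" for n
  proof (induction n)
    case (Suc n)
    have "(\<lambda>x. \<tau> @ [LEAST i. x \<in> A (\<tau> @ [i])]) \<in> universal M \<rightarrow>\<^sub>M count_space UNIV" for \<tau>
    proof -
      have "(\<lambda>x. LEAST i. x \<in> A (\<tau> @ [i])) \<in> universal M \<rightarrow>\<^sub>M count_space UNIV" by measurable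
      then show ?thesis by (rule measurable_compose) simp
    qed
    then have "(\<lambda>x. pre n x @ [LEAST i. x \<in> A (pre n x @ [i])]) \<in> universal M \<rightarrow>\<^sub>M count_space UNIV"
      by (rule measurable_compose_countable[where f="\<lambda>\<tau> x. \<tau> @ [LEAST i. x \<in> A (\<tau> @ [i])]", OF _ Suc])
    also have "(\<lambda>x. pre n x @ [LEAST i. x \<in> A (pre n x @ [i])]) = pre (Suc n)"
      by (rule ext) (simp add: pre(2))
    finally show ?case .
  next
    case 0
    have "pre 0 = (\<lambda>_. [])" using pre by auto
    then show ?case by simp
  qed
  define \<phi> where "\<phi> x = lim (\<lambda>n. Inf (K (pre n x)))" for x
  have "\<phi> \<in> borel_measurable (universal M)"
    unfolding \<phi>_def
  proof (rule borel_measurable_lim_metric)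
    fix n show "(\<lambda>x. Inf (K (pre n x))) \<in> borel_measurable (universal M)"
      by (rule measurable_compose[OF pre_meas]) simp
  qed
  moreover have "(x, \<phi> x) \<in> R" if xy: "(x, y) \<in> R" for x y
  proof -
    obtain s where s: "\<And>n. (x, y) \<in> C (map s [0..<n])" using xy unfolding RC suslin_def by auto
    have "y \<in> K (map s [0..<n])" for n
      unfolding K_def using xy R01 s by (auto simp: EF(1) take_map)
    then have "x \<in> E' (map s [0..<n])" for n
      using s[of n] unfolding E'_def EF(1) by auto
    then have xA: "x \<in> A []" unfolding A_def suslin_from_Nil suslin_def by auto
    have xApre: "x \<in> A (pre n x)" for n
    proof (induction n)
      case (Suc n)
      then have "\<exists>i. x \<in> A (pre n x @ [i])" unfolding A_def by (subst (asm) suslin_from_split) auto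
      then show ?case unfolding pre by (rule LeastI_ex)
    qed (simp add: pre xA)
    then have "x \<in> E' (pre n x)" for n using suslin_from_subset[of E'] unfolding A_def by auto
    then have xE: "x \<in> E (pre n x)" and Kne: "K (pre n x) \<noteq> {}" for n
      unfolding E'_def by (metis empty_iff)+
    have bdd: "bdd_below (K (pre n x))" for n
      using K01[of "pre n x"] by (intro bdd_belowI[of _ 0]) auto
    have InfK: "Inf (K (pre n x)) \<in> K (pre n x)" for n
      by (rule closed_contains_Inf[OF Kne bdd Kc])
    have Kdec: "K (pre m x) \<subseteq> K (pre n x)" if "n \<le> m" for n m
      using that by (induction rule: dec_induct) (use Kmono pre in auto)
    have inc: "incseq (\<lambda>n. Inf (K (pre n x)))"
      by (intro incseq_SucI cInf_superset_mono Kne bdd Kdec) auto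
    have "convergent (\<lambda>n. Inf (K (pre n x)))"
    proof (rule Bseq_mono_convergent)
      show "Bseq (\<lambda>n. Inf (K (pre n x)))"
      proof (rule BseqI'[of _ 1])
        show "norm (Inf (K (pre n x))) \<le> 1" for n
          using subsetD[OF K01 InfK, of n] by auto
      qed
    qed (use inc in \<open>auto simp: incseq_def\<close>)
    then have lim: "(\<lambda>n. Inf (K (pre n x))) \<longlonglongrightarrow> \<phi> x"
      unfolding \<phi>_def by (simp add: convergent_LIMSEQ_iff)
    have "\<phi> x \<in> K (pre n x)" for n
    proof (rule closed_sequentially[OF Kc])
      show "(\<lambda>m. Inf (K (pre (m + n) x))) \<longlonglongrightarrow> \<phi> x" using lim by (rule LIMSEQ_ignore_initial_segment)
      show "Inf (K (pre (m + n) x)) \<in> K (pre n x)" for m using InfK Kdec[of n "m + n"] by auto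
    qed
    then have "(x, \<phi> x) \<in> C (pre n x)" for n using xE KF unfolding EF(1) by auto
    moreover have "map (\<lambda>n. LEAST i. x \<in> A (pre n x @ [i])) [0..<n] = pre n x" for n
      by (rule branch_eq) (use pre in auto)
    ultimately show ?thesis unfolding RC suslin_def by (auto intro!: exI[of _ "\<lambda>n. LEAST i. x \<in> A (pre n x @ [i])"])
  qed
  ultimately show ?thesis by blast
qed

text \<open>The line is parametrized by the unit interval through \<open>tan\<close>. The endpoints
  do no harm, since \<open>tan\<close> is total and membership in \<open>?R\<close> already asserts
  that the image point is in \<open>R\<close>.\<close>

lemma selection_real:
  assumes sp: "space M = UNIV" and R [measurable]: "R \<in> sets (M \<Otimes>\<^sub>M (borel :: real measure))"
  shows "\<exists>\<phi>\<in>universal M \<rightarrow>\<^sub>M (borel :: real measure). \<forall>x y. (x, y) \<in> R \<longrightarrow> (x, \<phi> x) \<in> R"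
proof -
  let ?h = "\<lambda>t::real. tan (pi * (t - 1/2))"
  have h [measurable]: "?h \<in> borel \<rightarrow>\<^sub>M borel"
    unfolding tan_def by measurable
  let ?M = "M \<Otimes>\<^sub>M (borel :: real measure)"
  let ?R = "{x \<in> space ?M. (fst x, ?h (snd x)) \<in> R \<and> snd x \<in> {0..1}}"
  have R': "?R \<in> sets ?M" by measurable
  have "?R \<subseteq> UNIV \<times> {0..1}" by auto
  then obtain \<psi> where \<psi> [measurable]: "\<psi> \<in> universal M \<rightarrow>\<^sub>M (borel :: real measure)"
    and sel: "\<And>x y. (x, y) \<in> ?R \<Longrightarrow> (x, \<psi> x) \<in> ?R"
    using selection_unit_interval[OF sp R'] by blast
  have A: "(x, ?h (\<psi> x)) \<in> R" if "(x, y) \<in> R" for x y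
  proof -
    let ?t = "arctan y / pi + 1/2"
    have "?h ?t = y" by (simp add: tan_arctan)
    moreover have "0 \<le> ?t" "?t \<le> 1"
      using arctan_lbound[of y] arctan_ubound[of y] by (auto simp: field_simps)
    ultimately have "(x, ?t) \<in> ?R" using that sp by (simp add: space_pair_measure)
    from sel[OF this] show ?thesis by simp
  qed
  have "(\<lambda>x. ?h (\<psi> x)) \<in> universal M \<rightarrow>\<^sub>M borel" by measurable
  then show ?thesis by (intro bexI[of _ "\<lambda>x. ?h (\<psi> x)"] allI impI) (erule A)
qed

text \<open>With a selector the existential quantifier of the projection disappears:
  \<open>x\<close> belongs to \<open>D\<close> iff \<open>(x, \<phi> x)\<close> belongs to
  \<open>R\<close>, and this is a preimage under a universally measurable map.\<close>

lemma analytic_universal: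
  assumes S: "coded (borel :: 's::topological_space measure)" and D: "analytic (D :: 's set)"
  shows "D \<in> sets (universal borel)"
proof -
  obtain R where R [measurable]: "R \<in> sets ((borel :: 's measure) \<Otimes>\<^sub>M (borel :: real measure))" and DR: "D = {s. \<exists>t. (s, t) \<in> R}"
    by (rule analytic_projE[OF S D])
  obtain \<phi> where \<phi>: "\<phi> \<in> universal borel \<rightarrow>\<^sub>M (borel :: real measure)" and sel: "\<And>x y. (x, y) \<in> R \<Longrightarrow> (x, \<phi> x) \<in> R"
    using selection_real[OF _ R] by auto
  have [measurable]: "(\<lambda>x. (x, \<phi> x)) \<in> universal borel \<rightarrow>\<^sub>M (borel :: 's measure) \<Otimes>\<^sub>M (borel :: real measure)"
    using \<phi> measurable_universal_mono[of "\<lambda>x. x" borel borel] by (intro measurable_Pair) auto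
  have "D = (\<lambda>x. (x, \<phi> x)) -` R \<inter> space (universal borel)" using sel DR by auto
  also have "\<dots> \<in> sets (universal borel)" by (rule measurable_sets[OF _ R]) measurable
  finally show ?thesis .
qed

text \<open>Not the action but a real code \<open>t\<close> with \<open>f t\<close> in the fibre
  over \<open>x\<close> is selected. The relation between \<open>x\<close> and \<open>t\<close> is
  Borel, so the selection theorem for relations with real second coordinate applies.\<close>

theorem jankov_von_neumann:
  fixes D :: "('x::borel_space \<times> 'a::borel_space) set"
  assumes D: "analytic D"
  shows "\<exists>\<phi>\<in>universal borel \<rightarrow>\<^sub>M borel. \<forall>x a. (x, a) \<in> D \<longrightarrow> (x, \<phi> x) \<in> D"
proof -
  obtain B f where B [measurable]: "B \<in> sets (borel :: real measure)" and f: "f \<in> borel \<rightarrow>\<^sub>M (borel :: ('x \<times> 'a) measure)"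
    and Df: "D = f ` B"
    using analytic_code[OF D] by auto
  have f' [measurable]: "f \<in> borel \<rightarrow>\<^sub>M (borel :: 'x measure) \<Otimes>\<^sub>M (borel :: 'a measure)"
    using f by (simp add: borel_prod)
  let ?M = "(borel :: 'x measure) \<Otimes>\<^sub>M (borel :: real measure)"
  have [measurable]: "{x\<in>space ?M. fst (f (snd x)) = fst x} \<in> sets ?M"
    by (rule coded_eq_measurable[OF coded_borel]) measurable
  have R: "{x\<in>space ?M. fst (f (snd x)) = fst x} \<inter> {x\<in>space ?M. snd x \<in> B} \<in> sets ?M" (is "?R \<in> _")
    by measurable
  obtain \<phi> where \<phi> [measurable]: "\<phi> \<in> universal borel \<rightarrow>\<^sub>M (borel :: real measure)" and sel: "\<And>x y. (x, y) \<in> ?R \<Longrightarrow> (x, \<phi> x) \<in> ?R"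
    using selection_real[OF _ R] by auto
  have A: "(x, snd (f (\<phi> x))) \<in> D" if "(x, a) \<in> D" for x a
  proof -
    obtain t where t: "t \<in> B" "f t = (x, a)" using \<open>(x, a) \<in> D\<close> unfolding Df by auto
    then have "(x, t) \<in> ?R" by (simp add: space_pair_measure)
    from sel[OF this] have "\<phi> x \<in> B" "fst (f (\<phi> x)) = x" by auto
    then show ?thesis unfolding Df by (metis image_eqI prod.collapse)
  qed
  have "(\<lambda>x. snd (f (\<phi> x))) \<in> universal borel \<rightarrow>\<^sub>M borel" by measurable
  then show ?thesis by (intro bexI[of _ "\<lambda>x. snd (f (\<phi> x))"] allI impI) (erule A)
qed

subsection \<open>Integration against completions\<close>

lemma measurable_completion_AE:
  assumes f: "f \<in> completion p \<rightarrow>\<^sub>M N" and ae: "AE x in p. f x = g x" and sp: "\<And>x. x \<in> space p \<Longrightarrow> g x \<in> space N"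
  shows "g \<in> completion p \<rightarrow>\<^sub>M N"
proof (rule measurableI)
  fix A assume "A \<in> sets N"
  then have m: "f -` A \<inter> space p \<in> sets (completion p)" using measurable_sets[OF f] by simp
  have "AE x in completion p. x \<in> f -` A \<inter> space p \<longleftrightarrow> x \<in> g -` A \<inter> space p"
    using AE_completion[OF ae] by eventually_elim auto
  from completion.in_sets_AE[OF this m] show "g -` A \<inter> space (completion p) \<in> sets (completion p)"
    by auto
qed (use sp in auto)

lemma
  fixes f :: "'s \<Rightarrow> real"
  assumes f: "f \<in> borel_measurable (completion p)" and g: "g \<in> borel_measurable p" and ae: "AE x in p. f x = g x"
  shows integrable_completion_version: "integrable (completion p) f \<longleftrightarrow> integrable p g"
    and integral_completion_version: "integral\<^sup>L (completion p) f = integral\<^sup>L p g"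
  by (simp_all only: integrable_cong_AE[OF f measurable_completion[OF g] AE_completion[OF ae]]
    integral_cong_AE[OF f measurable_completion[OF g] AE_completion[OF ae]]
    integrable_completion[OF g] integral_completion[OF g])

lemma universal_version:
  fixes f :: "'s \<Rightarrow> real"
  assumes f: "f \<in> universal M \<rightarrow>\<^sub>M borel" and p: "prob_space p" "sets p = sets M"
  obtains g where "g \<in> borel_measurable M" "AE x in p. f x = g x"
proof -
  obtain g where g: "g \<in> borel_measurable p" "AE x in p. f x = g x"
    using completion_ex_borel_measurable_real[OF measurable_universalD[OF f p]] by auto
  moreover have "g \<in> borel_measurable M" using g(1) by (simp only: measurable_cong_sets[OF p(2) refl])
  ultimately show ?thesis using that by blast
qed

lemma eint_integrable:
  assumes "integrable (completion p) f"
  shows "eint p (\<lambda>x. ereal (f x)) = ereal (integral\<^sup>L (completion p) f)"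
proof -
  have fin: "(\<integral>\<^sup>+ x. ennreal (f x) \<partial>completion p) \<noteq> \<infinity>" "(\<integral>\<^sup>+ x. ennreal (- f x) \<partial>completion p) \<noteq> \<infinity>"
    using assms unfolding real_integrable_def by auto
  then obtain a b where ab: "(\<integral>\<^sup>+ x. ennreal (f x) \<partial>completion p) = ennreal a" "0 \<le> a"
    "(\<integral>\<^sup>+ x. ennreal (- f x) \<partial>completion p) = ennreal b" "0 \<le> b"
    by (metis ennreal_cases infinity_ennreal_def)
  then show ?thesis
    unfolding eint_def real_lebesgue_integral_def[OF assms] by (simp add: enn2ereal_ennreal)
qed

lemma eint_cong_AE:
  assumes "AE x in completion p. f x = g x"
  shows "eint p f = eint p g"
proof -
  have "(\<integral>\<^sup>+ s. e2ennreal (f s) \<partial>completion p) = (\<integral>\<^sup>+ s. e2ennreal (g s) \<partial>completion p)"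
    "(\<integral>\<^sup>+ s. e2ennreal (- f s) \<partial>completion p) = (\<integral>\<^sup>+ s. e2ennreal (- g s) \<partial>completion p)"
    by (rule nn_integral_cong_AE; use assms in \<open>eventually_elim, simp\<close>)+
  then show ?thesis unfolding eint_def by simp
qed

text \<open>\<open>P\<close> may be nonmeasurable, so its exceptional set is first enclosed in a
  measurable null set of the mixture, to which \<open>AE_bind\<close> applies.\<close>

lemma AE_bindD:
  assumes K: "K \<in> M \<rightarrow>\<^sub>M subprob_algebra N" and ae: "AE y in M \<bind> K. P y" and ne: "space M \<noteq> {}"
  shows "AE x in M. AE y in K x. P y"
proof -
  obtain E where E: "{y\<in>space (M \<bind> K). \<not> P y} \<subseteq> E" "E \<in> null_sets (M \<bind> K)"
    using ae unfolding eventually_ae_filter by auto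
  have EN [measurable]: "E \<in> sets N" using E(2) sets_bind[OF sets_kernel[OF K] ne] by auto
  have "AE y in M \<bind> K. y \<notin> E" using E(2) by (rule AE_not_in)
  then have "AE x in M. AE y in K x. y \<notin> E"
    by (subst (asm) AE_bind[OF K]) auto
  moreover have "AE x in M. x \<in> space M" by simp
  ultimately show ?thesis
  proof eventually_elim
    case (elim x)
    have "space (K x) = space N" using sets_eq_imp_space_eq[OF sets_kernel[OF K elim(2)]] .
    moreover have "space (M \<bind> K) = space N" by (rule space_bind[OF sets_kernel[OF K] ne])
    ultimately have "AE y in K x. y \<in> space (M \<bind> K)" using AE_space[of "K x"] by simp
    with elim(1) show ?case by eventually_elim (use E(1) in auto)
  qed
qed

section \<open>Mixtures over universally measurable kernels\<close>

locale universal_kernel =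
  fixes M :: "'s measure" and N :: "'r measure" and K :: "'s \<Rightarrow> 'r measure"
  assumes kernel: "K \<in> universal M \<rightarrow>\<^sub>M prob_algebra N" and nonempty: "space M \<noteq> {}"
begin

lemma kernel_prob: "x \<in> space M \<Longrightarrow> prob_space (K x)"
  and kernel_sets: "x \<in> space M \<Longrightarrow> sets (K x) = sets N"
  using measurable_space[OF kernel, of x] nonempty by (auto simp: space_prob_algebra)

context
  fixes p assumes p: "prob_space p" "sets p = sets M"
begin

lemma kernel_completion: "K \<in> completion p \<rightarrow>\<^sub>M prob_algebra N"
  by (rule measurable_universalD[OF kernel p])

lemma kernel_completion_subprob: "K \<in> completion p \<rightarrow>\<^sub>M subprob_algebra N"
  by (rule measurable_prob_algebraD[OF kernel_completion])

lemma space_p: "space p = space M" using sets_eq_imp_space_eq[OF p(2)] .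

lemma ne_p: "space (completion p) \<noteq> {}" using nonempty space_p by simp

lemma completion_in_prob: "completion p \<in> space (prob_algebra (completion p))"
  using prob_space.prob_space_completion[OF p(1)] by (simp add: space_prob_algebra)

lemma prob_space_bind_universal: "prob_space (completion p \<bind> K)"
  by (rule prob_space_bind'[OF completion_in_prob kernel_completion])

lemma sets_bind_universal: "sets (completion p \<bind> K) = sets N"
  by (rule sets_bind'[OF completion_in_prob kernel_completion])

text \<open>One measurable version, chosen for the mixture, serves almost all \<open>K x\<close> at
  once, because a null set of the mixture is null for almost every component. Versions chosen
  separately for each \<open>x\<close> would not depend measurably on \<open>x\<close>.\<close>

lemma version_bind:
  fixes f :: "'r \<Rightarrow> real"
  assumes f: "f \<in> universal N \<rightarrow>\<^sub>M borel"
  obtains g where "g \<in> borel_measurable N" "AE y in completion p \<bind> K. f y = g y"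
    "AE x in completion p. AE y in K x. f y = g y"
proof -
  obtain g where g: "g \<in> borel_measurable N" "AE y in completion p \<bind> K. f y = g y"
    by (rule universal_version[OF f prob_space_bind_universal sets_bind_universal])
  then show ?thesis
    using that AE_bindD[OF kernel_completion_subprob g(2) ne_p] by blast
qed

lemma integral_kernel_version:
  fixes f :: "'r \<Rightarrow> real"
  assumes f: "f \<in> universal N \<rightarrow>\<^sub>M borel" and g: "g \<in> borel_measurable N"
    and ae: "AE x in completion p. AE y in K x. f y = g y"
  shows "AE x in completion p. integral\<^sup>L (completion (K x)) f = integral\<^sup>L (K x) g \<and>
    (integrable (completion (K x)) f \<longleftrightarrow> integrable (K x) g)"
proof -
  have "AE x in completion p. x \<in> space M" using AE_space[of "completion p"] by (simp add: space_p)
  with ae show ?thesis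
  proof eventually_elim
    case (elim x)
    have f': "f \<in> borel_measurable (completion (K x))"
      by (rule measurable_universalD[OF f kernel_prob kernel_sets]) (use elim in auto)
    have g': "g \<in> borel_measurable (K x)"
      using g by (simp only: measurable_cong_sets[OF kernel_sets[OF elim(2)] refl])
    show ?case
      using integral_completion_version[OF f' g' elim(1)] integrable_completion_version[OF f' g' elim(1)] by simp
  qed
qed

lemma integral_kernel_measurable_completion:
  fixes f :: "'r \<Rightarrow> real"
  assumes f: "f \<in> universal N \<rightarrow>\<^sub>M borel"
  shows "(\<lambda>x. integral\<^sup>L (completion (K x)) f) \<in> borel_measurable (completion p)"
proof -
  obtain g where g [measurable]: "g \<in> borel_measurable N" and ae: "AE x in completion p. AE y in K x. f y = g y"
    using version_bind[OF f] .
  have "(\<lambda>x. integral\<^sup>L (K x) g) \<in> borel_measurable (completion p)"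
    by (rule measurable_compose[OF kernel_completion_subprob integral_measurable_subprob_algebra]) simp
  moreover have "AE x in p. integral\<^sup>L (K x) g = integral\<^sup>L (completion (K x)) f"
    using integral_kernel_version[OF f g ae] unfolding AE_completion_iff by eventually_elim simp
  ultimately show ?thesis by (rule measurable_completion_AE) simp
qed

lemma
  fixes f :: "'r \<Rightarrow> real"
  assumes f: "f \<in> universal N \<rightarrow>\<^sub>M borel" and int: "integrable (completion (completion p \<bind> K)) f"
  shows integrable_integral_kernel: "integrable (completion p) (\<lambda>x. integral\<^sup>L (completion (K x)) f)"
    and integral_bind_universal: "integral\<^sup>L (completion (completion p \<bind> K)) f = (\<integral>x. integral\<^sup>L (completion (K x)) f \<partial>completion p)"
proof -
  let ?q = "completion p \<bind> K"
  obtain g where g [measurable]: "g \<in> borel_measurable N" and ae1: "AE y in ?q. f y = g y"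
     and ae2: "AE x in completion p. AE y in K x. f y = g y"
    using version_bind[OF f] .
  have fq: "f \<in> borel_measurable (completion ?q)"
    by (rule measurable_universalD[OF f prob_space_bind_universal sets_bind_universal])
  have gq: "g \<in> borel_measurable ?q"
    using g by (simp only: measurable_cong_sets[OF sets_bind_universal refl])
  have iq: "integrable ?q g" using int integrable_completion_version[OF fq gq ae1] by simp
  \<comment> \<open>Integrals against the mixture are computed for nonnegative functions, so the
    positive and negative parts are treated separately. \<open>P\<close> and \<open>Q\<close> are
    finite almost everywhere only; \<open>enn2real\<close> turns the infinite values on the null set
    into 0.\<close>
  define P where "P x = (\<integral>\<^sup>+ y. ennreal (g y) \<partial>K x)" for x
  define Q where "Q x = (\<integral>\<^sup>+ y. ennreal (- g y) \<partial>K x)" for x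
  have "(\<lambda>x. \<integral>\<^sup>+ y. u y \<partial>K x) \<in> borel_measurable (completion p)" if "u \<in> borel_measurable N" for u :: "'r \<Rightarrow> ennreal"
    by (rule measurable_compose[OF kernel_completion_subprob nn_integral_measurable_subprob_algebra[OF that]])
  from this[of "\<lambda>y. ennreal (g y)"] this[of "\<lambda>y. ennreal (- g y)"]
  have m [measurable]: "P \<in> borel_measurable (completion p)" "Q \<in> borel_measurable (completion p)"
    unfolding P_def[symmetric] Q_def[symmetric] by simp_all
  have IP: "(\<integral>\<^sup>+ y. ennreal (g y) \<partial>?q) = (\<integral>\<^sup>+ x. P x \<partial>completion p)"
    and IQ: "(\<integral>\<^sup>+ y. ennreal (- g y) \<partial>?q) = (\<integral>\<^sup>+ x. Q x \<partial>completion p)"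
    unfolding P_def Q_def by (rule nn_integral_bind[where B=N, OF _ kernel_completion_subprob], measurable)+
  have fin: "(\<integral>\<^sup>+ x. P x \<partial>completion p) \<noteq> \<infinity>" "(\<integral>\<^sup>+ x. Q x \<partial>completion p) \<noteq> \<infinity>"
    using iq unfolding real_integrable_def IP[symmetric] IQ[symmetric] by auto
  have fP: "AE x in completion p. P x \<noteq> \<infinity>" and fQ: "AE x in completion p. Q x \<noteq> \<infinity>"
    using nn_integral_PInf_AE[OF m(1) fin(1)] nn_integral_PInf_AE[OF m(2) fin(2)] by auto
  have spM: "AE x in completion p. x \<in> space M" using AE_space[of "completion p"] by (simp add: space_p)
  have iK: "AE x in completion p. integral\<^sup>L (K x) g = enn2real (P x) - enn2real (Q x)"
    using fP fQ spM
  proof eventually_elim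
    case (elim x)
    have "g \<in> borel_measurable (K x)"
      using g by (simp only: measurable_cong_sets[OF kernel_sets[OF elim(3)] refl])
    then have "integrable (K x) g"
      using elim unfolding real_integrable_def P_def Q_def by simp
    then show ?case
      using real_lebesgue_integral_def unfolding P_def Q_def by auto
  qed
  have key: "AE x in completion p. integral\<^sup>L (completion (K x)) f = enn2real (P x) - enn2real (Q x)"
    using iK integral_kernel_version[OF f g ae2] by eventually_elim simp
  have eP: "(\<integral>\<^sup>+ x. ennreal (enn2real (P x)) \<partial>completion p) = (\<integral>\<^sup>+ x. P x \<partial>completion p)"
    by (rule nn_integral_cong_AE) (use fP in \<open>eventually_elim, simp add: less_top\<close>)
  have eQ: "(\<integral>\<^sup>+ x. ennreal (enn2real (Q x)) \<partial>completion p) = (\<integral>\<^sup>+ x. Q x \<partial>completion p)"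
    by (rule nn_integral_cong_AE) (use fQ in \<open>eventually_elim, simp add: less_top\<close>)
  have iP: "integrable (completion p) (\<lambda>x. enn2real (P x))" and iQ: "integrable (completion p) (\<lambda>x. enn2real (Q x))"
    by (rule integrableI_nonneg; use fin eP eQ in \<open>auto simp: less_top\<close>)+
  have mf: "(\<lambda>x. integral\<^sup>L (completion (K x)) f) \<in> borel_measurable (completion p)"
    by (rule integral_kernel_measurable_completion[OF f])
  have mPQ: "(\<lambda>x. enn2real (P x) - enn2real (Q x)) \<in> borel_measurable (completion p)"
    by measurable
  show "integrable (completion p) (\<lambda>x. integral\<^sup>L (completion (K x)) f)"
    using integrable_cong_AE[OF mf mPQ key] iP iQ by simp
  have "(\<integral>x. integral\<^sup>L (completion (K x)) f \<partial>completion p) = (\<integral>x. enn2real (P x) - enn2real (Q x) \<partial>completion p)"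
    by (rule integral_cong_AE[OF mf mPQ key])
  also have "\<dots> = (\<integral>x. enn2real (P x) \<partial>completion p) - (\<integral>x. enn2real (Q x) \<partial>completion p)"
    using iP iQ by simp
  also have "(\<integral>x. enn2real (P x) \<partial>completion p) = enn2real (\<integral>\<^sup>+ x. P x \<partial>completion p)"
    by (subst integral_eq_nn_integral) (auto simp: eP)
  also have "(\<integral>x. enn2real (Q x) \<partial>completion p) = enn2real (\<integral>\<^sup>+ x. Q x \<partial>completion p)"
    by (subst integral_eq_nn_integral) (auto simp: eQ)
  also have "enn2real (\<integral>\<^sup>+ x. P x \<partial>completion p) - enn2real (\<integral>\<^sup>+ x. Q x \<partial>completion p) = integral\<^sup>L ?q g"
    using real_lebesgue_integral_def[OF iq] IP IQ by simp
  also have "\<dots> = integral\<^sup>L (completion ?q) f"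
    using integral_completion_version[OF fq gq ae1] by simp
  finally show "integral\<^sup>L (completion ?q) f = (\<integral>x. integral\<^sup>L (completion (K x)) f \<partial>completion p)" ..
qed

end

end

subsection \<open>A Borel parametrization of the probability measures on the line\<close>

text \<open>
  A real \<open>t\<close> codes the values of a quantile function at the rationals. Every \<open>t\<close> yields a
  probability measure, whether or not the coded values are monotone, so that no admissibility
  condition on codes is needed.
\<close>

lemma prob_measures_parametrization:
  "\<exists>K\<in>borel \<rightarrow>\<^sub>M prob_algebra (borel :: real measure). \<forall>P. prob_space P \<and> sets P = sets borel \<longrightarrow> (\<exists>t::real. K t = P)"
proof -
  obtain e :: "(nat \<Rightarrow> real) \<Rightarrow> real" and d where d [measurable]: "d \<in> borel \<rightarrow>\<^sub>M PiM UNIV (\<lambda>_::nat. borel :: real measure)"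
    and de: "\<And>s. s \<in> space (PiM UNIV (\<lambda>_::nat. borel :: real measure)) \<Longrightarrow> d (e s) = s"
    using coded_real_seq unfolding coded_def by blast
  have [measurable]: "(\<lambda>t. d t i) \<in> borel \<rightarrow>\<^sub>M (borel :: real measure)" for i
    by (rule measurable_compose[OF d measurable_component_singleton]) simp
  define q :: "nat \<Rightarrow> real" where "q = (\<lambda>j. of_rat (from_nat_into UNIV j))"
  have q: "\<exists>j. q j = of_rat r" for r
    unfolding q_def using from_nat_into_surj[of "UNIV :: rat set" r] by auto
  \<comment> \<open>The supremum over the rationals below \<open>u\<close> is jointly measurable in
    \<open>t\<close> and \<open>u\<close> for every code, and it restores a left-continuous
    increasing function from its rational values. \<open>real_of_ereal\<close> sends infinite
    suprema to 0.\<close>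
  define h where "h t u = real_of_ereal (SUP j. if 0 < q j \<and> q j < u then ereal (d t j) else -\<infinity>)" for t u :: real
  let ?U = "restrict_space lborel {0<..<1::real}"
  have U: "prob_space ?U"
    by (auto simp add: emeasure_restrict_space space_restrict_space intro!: prob_spaceI)
  have sU: "sets ?U = sets (restrict_space borel {0<..<1})" by (rule sets_restrict_space_cong) simp
  define K where "K t = distr ?U borel (h t)" for t
  have h: "(\<lambda>(t, u). h t u) \<in> borel \<Otimes>\<^sub>M ?U \<rightarrow>\<^sub>M borel"
  proof -
    have [measurable]: "(\<lambda>u. u) \<in> ?U \<rightarrow>\<^sub>M borel"
      by (rule measurable_restrict_space1) simp
    have [measurable]: "(\<lambda>x. snd x) \<in> (borel :: real measure) \<Otimes>\<^sub>M ?U \<rightarrow>\<^sub>M borel"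
      by (rule measurable_compose[OF measurable_snd]) simp
    show ?thesis unfolding h_def split_beta by measurable
  qed
  have Km: "K \<in> borel \<rightarrow>\<^sub>M prob_algebra (borel :: real measure)"
    unfolding K_def
  proof (rule measurable_distr_prob_space2[OF _ h])
    show "(\<lambda>x. ?U) \<in> borel \<rightarrow>\<^sub>M prob_algebra ?U"
      using U by (intro measurable_const) (auto simp: space_prob_algebra)
  qed
  have surj: "\<exists>t. K t = P" if P: "prob_space P \<and> sets P = sets borel" for P
  proof -
    interpret P: prob_space P using P by simp
    have rd: "real_distribution P"
      using P sets_eq_imp_space_eq[of P borel] by unfold_locales auto
    interpret cdf_distribution P
      using rd by (simp add: cdf_distribution_def)
    \<comment> \<open>\<open>I\<close> is the left-continuous quantile function of \<open>P\<close>,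
      which maps Lebesgue measure on the unit interval to \<open>P\<close>. Its values at rationals
      outside (0, 1) are coded as well but are never consulted, since \<open>h\<close> requires
      \<open>0 < q j\<close> and \<open>q j < u\<close>.\<close>
    let ?t = "e (\<lambda>j. I (q j))"
    have dt: "d ?t = (\<lambda>j. I (q j))" by (rule de) (simp add: space_PiM)
    have "h ?t u = I u" if u: "u \<in> {0<..<1}" for u
    proof -
      let ?S = "SUP j. if 0 < q j \<and> q j < u then ereal (I (q j)) else -\<infinity>"
      have "?S = ereal (I u)"
      proof (rule antisym)
        show "?S \<le> ereal (I u)"
          using u by (intro SUP_least) (auto intro!: mono_onD[OF mono_I])
        show "ereal (I u) \<le> ?S"
        proof (rule ccontr)
          assume "\<not> ?thesis"
          then have "?S < ereal (I u)"
            by (simp only: not_le)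
          from ereal_dense2[OF this]
          obtain y where y: "?S < ereal y" "y < I u"
            by (elim exE conjE) (simp only: less_ereal.simps(1))
          have "v \<le> cdf P y" if v: "0 < v" "v < u" for v
          proof (rule dense_le)
            fix v' assume "v' < v"
            obtain r where r: "max v' 0 < of_rat r" "of_rat r < v" using of_rat_dense[of "max v' 0" v] v \<open>v' < v\<close> by auto
            obtain j where j: "q j = of_rat r" using q by auto
            have "ereal (I (q j)) \<le> ?S"
              using j r v by (intro SUP_upper2[of j]) auto
            then have "ereal (I (q j)) \<le> ereal y" by (rule order.trans) (rule less_imp_le[OF y(1)])
            then have "I (q j) \<le> y" by simp
            moreover have "0 < q j" using j r by simp
            moreover have "q j < 1" using j r(2) v(2) u unfolding greaterThanLessThan_iff by linarith
            ultimately have "q j \<le> cdf P y" using pseudoinverse[of "q j" y] by blast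
            then show "v' \<le> cdf P y" using j r by auto
          qed
          then have "u \<le> cdf P y" using u by (intro dense_le_bounded[of 0 u]) auto
          then have "I u \<le> y" using pseudoinverse[of u y] u by auto
          then show False using y by simp
        qed
      qed
      then show ?thesis unfolding h_def dt by simp
    qed
    then have "distr ?U borel (h ?t) = distr ?U borel I"
      by (intro distr_cong) (auto simp: space_restrict_space)
    then show ?thesis using distr_I_eq_M unfolding K_def by auto
  qed
  show ?thesis by (rule bexI[OF _ Km]) (use surj in simp)
qed

subsection \<open>Integrals of lower semianalytic functions\<close>

lemma sets_borel_atMost_rat: "sets (borel :: real measure) = sigma_sets UNIV (range (\<lambda>r::rat. {..real_of_rat r}))"
proof -
  have "sigma_sets UNIV (range (\<lambda>a::real. {..a})) = sigma_sets UNIV (range (\<lambda>r::rat. {..real_of_rat r}))"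
  proof (rule sigma_sets_eqI)
    fix A :: "real set" assume "A \<in> range (\<lambda>a. {..a})"
    then obtain a where A: "A = {..a}" by auto
    have "A = (\<Inter>r\<in>{r::rat. a < of_rat r}. {..real_of_rat r})"
    proof safe
      fix x assume "x \<in> (\<Inter>r\<in>{r::rat. a < of_rat r}. {..real_of_rat r})"
      then have x: "\<And>r. a < of_rat r \<Longrightarrow> x \<le> of_rat r" by auto
      show "x \<in> A"
      proof (rule ccontr)
        assume "x \<notin> A"
        then obtain r where "a < of_rat r" "of_rat r < x" using of_rat_dense[of a x] A by auto
        then show False using x[of r] by simp
      qed
    qed (auto simp: A)
    moreover have "(\<Inter>r\<in>{r::rat. a < of_rat r}. {..real_of_rat r}) \<in> sigma_sets UNIV (range (\<lambda>r::rat. {..real_of_rat r}))"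
    proof -
      interpret S: sigma_algebra UNIV "sigma_sets UNIV (range (\<lambda>r::rat. {..real_of_rat r}))"
        by (rule sigma_algebra_sigma_sets) auto
      obtain r :: rat where "a < of_rat r" using of_rat_dense[of a "a + 1"] by auto
      then show ?thesis by (intro S.countable_INT'') auto
    qed
    ultimately show "A \<in> sigma_sets UNIV (range (\<lambda>r::rat. {..real_of_rat r}))" by simp
  qed auto
  then show ?thesis by (simp add: borel_eq_atMost)
qed

text \<open>Reduces the equality of two laws to countably many equations between measurable
  functions of the parameters. Half-lines with rational endpoints generate the Borel sets of codes,
  and \<open>d\<close> carries the law of the code back.\<close>

lemma prob_eq_code:
  fixes e :: "'s \<Rightarrow> real"
  assumes P: "prob_space P" "sets P = sets M" and Q: "prob_space Q" "sets Q = sets M"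
    and e: "e \<in> M \<rightarrow>\<^sub>M borel" and d: "d \<in> borel \<rightarrow>\<^sub>M M" and de: "\<And>s. s \<in> space M \<Longrightarrow> d (e s) = s"
    and eq: "\<And>r::rat. measure P (e -` {..of_rat r} \<inter> space M) = measure Q (e -` {..of_rat r} \<inter> space M)"
  shows "P = Q"
proof -
  interpret P: prob_space P by fact
  interpret Q: prob_space Q by fact
  have sp: "space P = space M" "space Q = space M" using P(2) Q(2) by (auto dest: sets_eq_imp_space_eq)
  have eP: "e \<in> P \<rightarrow>\<^sub>M borel" and eQ: "e \<in> Q \<rightarrow>\<^sub>M borel"
    using e by (simp_all only: measurable_cong_sets[OF P(2) refl] measurable_cong_sets[OF Q(2) refl])
  interpret P': prob_space "distr P borel e" by (rule P.prob_space_distr[OF eP])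
  have D: "distr P borel e = distr Q borel e"
  proof (rule measure_eqI_generator_eq[where \<Omega>=UNIV and E="range (\<lambda>r::rat. {..real_of_rat r})" and A="\<lambda>n. {..real_of_rat (of_nat n)}"])
    show "Int_stable (range (\<lambda>r::rat. {..real_of_rat r}))"
    proof (rule Int_stableI, safe)
      fix r s :: rat
      have "{..real_of_rat r} \<inter> {..real_of_rat s} = {..real_of_rat (min r s)}"
        by (auto simp: min_def of_rat_less_eq)
      then show "{..real_of_rat r} \<inter> {..real_of_rat s} \<in> range (\<lambda>r::rat. {..real_of_rat r})" by auto
    qed
    show "emeasure (distr P borel e) X = emeasure (distr Q borel e) X" if "X \<in> range (\<lambda>r::rat. {..real_of_rat r})" for X
      using that eq sp by (auto simp: emeasure_distr eP eQ P.emeasure_eq_measure Q.emeasure_eq_measure)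
    show "(\<Union>i. {..real_of_rat (of_nat i)}) = UNIV" using real_arch_simple by auto
    show "range (\<lambda>n. {..real_of_rat (of_nat n)}) \<subseteq> range (\<lambda>r::rat. {..real_of_rat r})"
      by (rule image_subsetI, rule rangeI)
  qed (auto simp: sets_borel_atMost_rat)
  have "distr (distr P borel e) M d = distr P M (\<lambda>x. d (e x))"
    by (subst distr_distr[OF d eP]) (simp add: comp_def)
  also have "\<dots> = distr P P (\<lambda>x. x)" by (rule distr_cong) (use de sp P(2) in auto)
  also have "\<dots> = P" by simp
  finally have 1: "distr (distr P borel e) M d = P" .
  have "distr (distr Q borel e) M d = distr Q M (\<lambda>x. d (e x))"
    by (subst distr_distr[OF d eQ]) (simp add: comp_def)
  also have "\<dots> = distr Q Q (\<lambda>x. x)" by (rule distr_cong) (use de sp Q(2) in auto)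
  also have "\<dots> = Q" by simp
  finally show ?thesis using 1 D by simp
qed

lemma completion_distr:
  fixes f :: "'r \<Rightarrow> real"
  assumes P: "prob_space P" and g: "g \<in> P \<rightarrow>\<^sub>M N" and f: "f \<in> universal N \<rightarrow>\<^sub>M borel"
  shows "integrable (completion (distr P N g)) f \<longleftrightarrow> integrable (completion P) (\<lambda>x. f (g x))"
    and "integral\<^sup>L (completion (distr P N g)) f = integral\<^sup>L (completion P) (\<lambda>x. f (g x))"
proof -
  interpret P: prob_space P by fact
  have D: "prob_space (distr P N g)" by (rule P.prob_space_distr[OF g])
  obtain f1 where f1 [measurable]: "f1 \<in> borel_measurable N" and ae: "AE x in distr P N g. f x = f1 x"
    by (rule universal_version[OF f D sets_distr])
  have ae': "AE x in P. f (g x) = f1 (g x)" by (rule AE_distrD[OF g ae])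
  have fD: "f \<in> borel_measurable (completion (distr P N g))"
    by (rule measurable_universalD[OF f D sets_distr])
  have f1g: "(\<lambda>x. f1 (g x)) \<in> borel_measurable P" using g by measurable
  have fg: "(\<lambda>x. f (g x)) \<in> borel_measurable (completion P)"
    by (rule measurable_completion_AE[OF measurable_completion[OF f1g]]) (use ae' in auto)
  show "integrable (completion (distr P N g)) f \<longleftrightarrow> integrable (completion P) (\<lambda>x. f (g x))"
    using integrable_completion_version[OF fD _ ae] integrable_completion_version[OF fg f1g ae']
      integrable_distr_eq[OF g f1] by simp
  show "integral\<^sup>L (completion (distr P N g)) f = integral\<^sup>L (completion P) (\<lambda>x. f (g x))"
    using integral_completion_version[OF fD _ ae] integral_completion_version[OF fg f1g ae']
      integral_distr[OF g f1] by simp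
qed

lemma lsa_universal:
  fixes f :: "'s::topological_space \<Rightarrow> real"
  assumes S: "coded (borel :: 's measure)" and lsa: "\<And>r. analytic {x. f x < r}"
  shows "f \<in> universal borel \<rightarrow>\<^sub>M borel"
  unfolding borel_measurable_iff_less using analytic_universal[OF S lsa] by simp

text \<open>
  The strict epigraph of \<open>f\<close> is the image of a Borel set \<open>B\<close> of reals under some \<open>(g1, g2)\<close>. Then
  \<open>\<integral> f dp < r\<close> iff there is a probability measure on \<open>B\<close> whose image under \<open>g1\<close> is \<open>p\<close> and for
  which the integral of \<open>g2\<close> is less than \<open>r\<close>; for the forward direction, \<open>p\<close> is transported by a
  measurable selector.
\<close>

theorem analytic_integral_less:
  fixes f :: "'x::borel_space \<Rightarrow> real" and \<Gamma> :: "'z::topological_space set"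
  assumes Z: "coded (borel :: 'z measure)" and lsa: "\<And>r. analytic {x. f x < r}"
    and q [measurable]: "q \<in> borel \<rightarrow>\<^sub>M prob_algebra borel" and \<Gamma>: "analytic \<Gamma>"
    and int: "\<And>z. z \<in> \<Gamma> \<Longrightarrow> integrable (completion (q z)) f"
  shows "analytic {z\<in>\<Gamma>. integral\<^sup>L (completion (q z)) f < r}"
proof -
  have f: "f \<in> universal borel \<rightarrow>\<^sub>M borel" by (rule lsa_universal[OF coded_borel lsa])
  have qz: "prob_space (q z)" "sets (q z) = sets borel" for z
    using measurable_space[OF q, of z] by (auto simp: space_prob_algebra)
  have XR: "coded (borel :: ('x \<times> real) measure)"
    using coded_pair[OF coded_borel[where 's='x] coded_real] by (simp add: borel_prod)
  define D where "D = {(x, s). f x < s}"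
  have "analytic D"
  proof -
    have Deq: "D = (\<Union>t::rat. {z. fst z \<in> {x. f x < of_rat t}} \<inter> {z. of_rat t < snd z})"
      unfolding D_def using of_rat_dense by (fastforce dest: less_trans)
    have an: "analytic ({z :: 'x \<times> real. fst z \<in> {x. f x < of_rat t}} \<inter> {z. of_rat t < snd z})" for t :: rat
    proof (rule analytic_Int[OF XR])
      show "analytic {z :: 'x \<times> real. fst z \<in> {x. f x < of_rat t}}"
        by (rule analytic_vimage[OF XR coded_borel lsa]) (simp flip: borel_prod)
      have "{z\<in>space (borel \<Otimes>\<^sub>M borel). real_of_rat t < snd z} \<in> sets ((borel :: 'x measure) \<Otimes>\<^sub>M borel)"
        by measurable
      then show "analytic {z :: 'x \<times> real. of_rat t < snd z}"
        by (intro analytic_borel[OF XR]) (simp add: borel_prod[symmetric] space_pair_measure)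
    qed
    show ?thesis unfolding Deq by (rule analytic_UN_countable[OF XR an])
  qed
  then obtain B g where B [measurable]: "B \<in> sets (borel :: real measure)" and g: "g \<in> borel \<rightarrow>\<^sub>M (borel :: ('x \<times> real) measure)"
    and Dg: "D = g ` B"
    by (rule analytic_code)
  have [measurable]: "g \<in> borel \<rightarrow>\<^sub>M (borel :: 'x measure) \<Otimes>\<^sub>M borel" using g by (simp add: borel_prod)
  define g1 g2 where "g1 t = fst (g t)" and "g2 t = snd (g t)" for t
  have g1 [measurable]: "g1 \<in> borel \<rightarrow>\<^sub>M borel" and g2 [measurable]: "g2 \<in> borel \<rightarrow>\<^sub>M borel"
    unfolding g1_def g2_def by measurable
  have gB: "f (g1 t) < g2 t" if "t \<in> B" for t
    using that Dg unfolding D_def g1_def g2_def by (auto simp: set_eq_iff)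
  obtain K where K [measurable]: "K \<in> borel \<rightarrow>\<^sub>M prob_algebra (borel :: real measure)"
    and surj: "\<And>P. prob_space P \<Longrightarrow> sets P = sets borel \<Longrightarrow> \<exists>t::real. K t = P"
    using prob_measures_parametrization by blast
  have Kt: "prob_space (K t)" "sets (K t) = sets borel" for t
    using measurable_space[OF K, of t] by (auto simp: space_prob_algebra)
  have KS [measurable]: "K \<in> borel \<rightarrow>\<^sub>M subprob_algebra borel" by (rule measurable_prob_algebraD[OF K])
  have qS [measurable]: "q \<in> borel \<rightarrow>\<^sub>M subprob_algebra borel" by (rule measurable_prob_algebraD[OF q])
  obtain e d where e [measurable]: "e \<in> borel \<rightarrow>\<^sub>M (borel :: real measure)" and d: "d \<in> borel \<rightarrow>\<^sub>M (borel :: 'x measure)"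
    and de: "\<And>s. d (e s) = s"
    using coded_borel[where 's='x] unfolding coded_def by auto
  have DK: "(\<lambda>t. distr (K t) borel g1) \<in> borel \<rightarrow>\<^sub>M prob_algebra (borel :: 'x measure)"
    by (rule measurable_compose[OF K measurable_distr_prob_space[OF g1]])
  have DKS [measurable]: "(\<lambda>t. distr (K t) borel g1) \<in> borel \<rightarrow>\<^sub>M subprob_algebra (borel :: 'x measure)"
    by (rule measurable_prob_algebraD[OF DK])
  have DKt: "prob_space (distr (K t) borel g1)" for t
    using measurable_space[OF DK, of t] by (auto simp: space_prob_algebra)
  let ?M = "(borel :: 'z measure) \<Otimes>\<^sub>M (borel :: real measure)"
  \<comment> \<open>The four conditions say that the coded law \<open>K t\<close> lives on
    \<open>B\<close>, has image \<open>q z\<close> under \<open>g1\<close>, makes \<open>g2\<close>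
    integrable and gives it an integral below \<open>r\<close>. The second one is tested on rational
    half-lines only, which keeps \<open>H\<close> Borel.\<close>
  define H where "H = {x\<in>space ?M. measure (K (snd x)) B = 1 \<and>
     (\<forall>r::rat. measure (distr (K (snd x)) borel g1) (e -` {..of_rat r}) = measure (q (fst x)) (e -` {..of_rat r})) \<and>
     integrable (K (snd x)) g2 \<and> integral\<^sup>L (K (snd x)) g2 < r}"
  have "H \<in> sets ?M"
  proof -
    have 1: "(\<lambda>x. measure (K (snd x)) B) \<in> borel_measurable ?M"
      by (rule measurable_compose[OF measurable_snd measurable_compose[OF KS measurable_measure_subprob_algebra[OF B]]])
    have eS: "e -` {..of_rat r} \<in> sets borel" for r :: rat
      using measurable_sets[OF e, of "{..of_rat r}"] by simp
    have 2: "(\<lambda>x. measure (distr (K (snd x)) borel g1) (e -` {..of_rat r})) \<in> borel_measurable ?M" for r :: rat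
      by (rule measurable_compose[OF measurable_snd measurable_compose[OF DKS measurable_measure_subprob_algebra[OF eS]]])
    have 3: "(\<lambda>x. measure (q (fst x)) (e -` {..of_rat r})) \<in> borel_measurable ?M" for r :: rat
      by (rule measurable_compose[OF measurable_fst measurable_compose[OF qS measurable_measure_subprob_algebra[OF eS]]])
    have 4: "Measurable.pred ?M (\<lambda>x. integrable (K (snd x)) g2)"
      by (rule measurable_compose[OF measurable_snd measurable_compose[OF KS integrable_measurable_subprob_algebra]]) simp
    have 5: "(\<lambda>x. integral\<^sup>L (K (snd x)) g2) \<in> borel_measurable ?M"
      by (rule measurable_compose[OF measurable_snd measurable_compose[OF KS integral_measurable_subprob_algebra]]) simp
    note [measurable] = 1 2 3 4 5
    show ?thesis unfolding H_def by measurable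
  qed
  then have anH: "analytic {z. \<exists>t. (z, t) \<in> H}" by (rule analytic_projI[OF Z coded_real])
  have "{z\<in>\<Gamma>. integral\<^sup>L (completion (q z)) f < r} = \<Gamma> \<inter> {z. \<exists>t. (z, t) \<in> H}"
  proof (intro equalityI subsetI)
    fix z assume "z \<in> \<Gamma> \<inter> {z. \<exists>t. (z, t) \<in> H}"
    then obtain t where z: "z \<in> \<Gamma>" and H: "(z, t) \<in> H" by auto
    interpret P: prob_space "K t" by (rule Kt)
    have g1K: "g1 \<in> K t \<rightarrow>\<^sub>M borel" and g2K: "g2 \<in> K t \<rightarrow>\<^sub>M borel" and BK: "B \<in> sets (K t)"
      using g1 g2 by (simp_all only: measurable_cong_sets[OF Kt(2) refl] Kt(2) B)
    have eq: "distr (K t) borel g1 = q z"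
      by (rule prob_eq_code[OF DKt _ qz e d]) (use H de in \<open>auto simp: H_def\<close>)
    have int': "integrable (completion (K t)) (\<lambda>t. f (g1 t))"
      using completion_distr(1)[OF Kt(1) g1K f] int[OF z] eq by simp
    have "AE t in K t. t \<in> B" using H BK by (intro P.AE_prob_1) (auto simp: H_def)
    then have le: "AE t in completion (K t). f (g1 t) \<le> g2 t"
      unfolding AE_completion_iff by eventually_elim (use gB in force)
    have "integral\<^sup>L (completion (q z)) f = integral\<^sup>L (completion (K t)) (\<lambda>t. f (g1 t))"
      using completion_distr(2)[OF Kt(1) g1K f] eq by simp
    also have "\<dots> \<le> integral\<^sup>L (completion (K t)) g2"
      by (rule integral_mono_AE[OF int' _ le]) (use H integrable_completion[OF g2K] in \<open>auto simp: H_def\<close>)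
    also have "\<dots> = integral\<^sup>L (K t) g2" by (rule integral_completion[OF g2K])
    also have "\<dots> < r" using H by (auto simp: H_def)
    finally show "z \<in> {z\<in>\<Gamma>. integral\<^sup>L (completion (q z)) f < r}" using z by simp
  next
    fix z assume "z \<in> {z\<in>\<Gamma>. integral\<^sup>L (completion (q z)) f < r}"
    then have z: "z \<in> \<Gamma>" and less: "integral\<^sup>L (completion (q z)) f < r" by auto
    interpret p: prob_space "q z" by (rule qz)
    interpret cp: prob_space "completion (q z)" by (rule p.prob_space_completion)
    define \<epsilon> where "\<epsilon> = (r - integral\<^sup>L (completion (q z)) f) / 2"
    have \<epsilon>: "0 < \<epsilon>" using less by (simp add: \<epsilon>_def)
    \<comment> \<open>\<open>f\<close> itself is only universally measurable; with a Borel version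
      in its place the relation \<open>?R\<close> is Borel. The slack \<epsilon> is half of the gap
      below \<open>r\<close>, so the integral of \<open>g2\<close> along the selector stays below
      \<open>r\<close>.\<close>
    obtain f' where f' [measurable]: "f' \<in> borel_measurable borel" and ae: "AE x in q z. f x = f' x"
      by (rule universal_version[OF f qz])
    let ?N = "(borel :: 'x measure) \<Otimes>\<^sub>M (borel :: real measure)"
    have [measurable]: "{x\<in>space ?N. g1 (snd x) = fst x} \<in> sets ?N"
      by (rule coded_eq_measurable[OF coded_borel]) measurable
    have R: "{x\<in>space ?N. g1 (snd x) = fst x} \<inter> {x\<in>space ?N. snd x \<in> B \<and> g2 (snd x) < f' (fst x) + \<epsilon>} \<in> sets ?N" (is "?R \<in> _")
      by measurable
    have memR: "(x, t) \<in> ?R \<longleftrightarrow> g1 t = x \<and> t \<in> B \<and> g2 t < f' x + \<epsilon>" for x t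
      by (auto simp: space_pair_measure)
    from selection_real[OF space_borel R] obtain \<phi>
      where \<phi>: "\<phi> \<in> universal borel \<rightarrow>\<^sub>M (borel :: real measure)"
        and sel': "\<forall>x y. (x, y) \<in> ?R \<longrightarrow> (x, \<phi> x) \<in> ?R"
      by (rule bexE)
    have sel: "(x, \<phi> x) \<in> ?R" if "(x, y) \<in> ?R" for x y
      by (rule sel'[rule_format, OF that])
    have \<phi>c: "\<phi> \<in> completion (q z) \<rightarrow>\<^sub>M borel" by (rule measurable_universalD[OF \<phi> qz])
    have good: "AE x in completion (q z). g1 (\<phi> x) = x \<and> \<phi> x \<in> B \<and> g2 (\<phi> x) < f x + \<epsilon>"
      using ae unfolding AE_completion_iff
    proof eventually_elim
      case (elim x)
      have "(x, f x + \<epsilon> / 2) \<in> g ` B" unfolding Dg[symmetric] D_def using \<epsilon> by simp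
      then obtain t where "t \<in> B" "g t = (x, f x + \<epsilon> / 2)" by auto
      then have "g1 t = x \<and> t \<in> B \<and> g2 t < f' x + \<epsilon>" using elim \<epsilon> by (simp add: g1_def g2_def)
      then have "(x, t) \<in> ?R" by (rule memR[THEN iffD2])
      from sel[OF this] show ?case unfolding memR using elim by simp
    qed
    let ?P = "distr (completion (q z)) borel \<phi>"
    have P: "prob_space ?P" by (rule cp.prob_space_distr[OF \<phi>c])
    then obtain t where t: "K t = ?P" using surj[of ?P] by auto
    interpret P: prob_space ?P by (rule P)
    have "AE t in ?P. t \<in> B"
      by (subst AE_distr_iff[OF \<phi>c]) (use good in \<open>auto elim: eventually_mono\<close>)
    then have H1: "measure (K t) B = 1" unfolding t using B by (intro P.prob_eq_1[THEN iffD2]) auto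
    have "distr ?P borel g1 = distr (completion (q z)) borel (\<lambda>x. g1 (\<phi> x))"
      by (subst distr_distr[OF g1 \<phi>c]) (simp add: comp_def)
    also have "\<dots> = distr (completion (q z)) borel (\<lambda>x. x)"
    proof (rule distr_cong_AE)
      show "AE x in completion (q z). g1 (\<phi> x) = x" using good by eventually_elim simp
      show "(\<lambda>x. x) \<in> completion (q z) \<rightarrow>\<^sub>M borel"
        by (rule measurable_completion) (simp add: measurable_cong_sets[OF qz(2) refl])
      show "(\<lambda>x. g1 (\<phi> x)) \<in> completion (q z) \<rightarrow>\<^sub>M borel" by (rule measurable_compose[OF \<phi>c g1])
    qed auto
    also have "\<dots> = distr (q z) borel (\<lambda>x. x)"
      by (rule distr_completion) (simp add: measurable_cong_sets[OF qz(2) refl])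
    also have "\<dots> = distr (q z) (q z) (\<lambda>x. x)" by (rule distr_cong) (use qz in auto)
    also have "\<dots> = q z" by simp
    finally have H2: "distr (K t) borel g1 = q z" unfolding t .
    have g2\<phi>: "(\<lambda>x. g2 (\<phi> x)) \<in> borel_measurable (completion (q z))" by (rule measurable_compose[OF \<phi>c g2])
    have bd: "AE x in completion (q z). f x \<le> g2 (\<phi> x) \<and> g2 (\<phi> x) \<le> f x + \<epsilon>"
      using good by eventually_elim (use gB in force)
    have ifz: "integrable (completion (q z)) f" by (rule int[OF z])
    have i2: "integrable (completion (q z)) (\<lambda>x. g2 (\<phi> x))"
    proof (rule Bochner_Integration.integrable_bound[OF _ g2\<phi>])
      show "integrable (completion (q z)) (\<lambda>x. \<bar>f x\<bar> + \<epsilon>)" using ifz by simp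
      show "AE x in completion (q z). norm (g2 (\<phi> x)) \<le> norm (\<bar>f x\<bar> + \<epsilon>)"
        using bd by eventually_elim (use \<epsilon> in auto)
    qed
    have "integral\<^sup>L (completion (q z)) (\<lambda>x. g2 (\<phi> x)) \<le> integral\<^sup>L (completion (q z)) (\<lambda>x. f x + \<epsilon>)"
      using bd by (intro integral_mono_AE i2) (use ifz in auto)
    also have "\<dots> = integral\<^sup>L (completion (q z)) f + \<epsilon>" using ifz cp.prob_space by simp
    also have "\<dots> < r" using less by (simp add: \<epsilon>_def field_simps)
    finally have H3: "integrable (K t) g2 \<and> integral\<^sup>L (K t) g2 < r"
      unfolding t using integrable_distr_eq[OF \<phi>c g2] integral_distr[OF \<phi>c g2] i2 by simp
    have "(z, t) \<in> H" using H1 H2 H3 unfolding H_def by (simp add: space_pair_measure)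
    then show "z \<in> \<Gamma> \<inter> {z. \<exists>t. (z, t) \<in> H}" using z by auto
  qed
  then show ?thesis using analytic_Int[OF Z \<Gamma> anH] by simp
qed

subsection \<open>Laws of controlled processes\<close>

lemma coded_prod: "coded (borel :: ('x::borel_space \<times> 'a::borel_space) measure)"
  using coded_pair[OF coded_borel[where 's='x] coded_borel[where 's='a]] by (simp add: borel_prod)

lemma measurable_fst_borel [measurable]:
    "fst \<in> (borel :: ('x::borel_space \<times> 'a::borel_space) measure) \<rightarrow>\<^sub>M borel"
  and measurable_snd_borel [measurable]:
    "snd \<in> (borel :: ('x::borel_space \<times> 'a::borel_space) measure) \<rightarrow>\<^sub>M borel"
  unfolding borel_prod[symmetric] by (rule measurable_fst, rule measurable_snd)

lemma measurable_Pair_borel: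
  fixes f :: "'s \<Rightarrow> 'x::borel_space" and g :: "'s \<Rightarrow> 'a::borel_space"
  shows "f \<in> M \<rightarrow>\<^sub>M borel \<Longrightarrow> g \<in> M \<rightarrow>\<^sub>M borel \<Longrightarrow> (\<lambda>x. (f x, g x)) \<in> M \<rightarrow>\<^sub>M borel"
  unfolding borel_prod[symmetric] by (rule measurable_Pair)

lemma space_hist: "space (hist k) = extensional {..<k} \<times> UNIV"
  by (auto simp: hist_def space_pair_measure space_PiM PiE_def)

lemma space_hist_nonempty: "space (hist k) \<noteq> {}"
proof -
  have "((\<lambda>_. undefined), undefined) \<in> space (hist k)" by (simp add: space_hist extensional_def)
  then show ?thesis by blast
qed

lemma measurable_hist_fst: "fst \<in> hist k \<rightarrow>\<^sub>M PiM {..<k} (\<lambda>_. borel)"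
  and measurable_hist_snd: "snd \<in> hist k \<rightarrow>\<^sub>M borel"
  unfolding hist_def by (rule measurable_fst, rule measurable_snd)

lemma measurable_hist_component: "i < k \<Longrightarrow> (\<lambda>s. fst s i) \<in> hist k \<rightarrow>\<^sub>M borel"
  by (rule measurable_compose[OF measurable_hist_fst measurable_component_singleton]) simp

definition trunc :: "nat \<Rightarrow> ('x, 'a) history \<Rightarrow> ('x, 'a) history" where
  "trunc k s = (restrict (fst s) {..<k}, fst (fst s k))"

lemma measurable_trunc: "trunc k \<in> hist (Suc k) \<rightarrow>\<^sub>M (hist k :: ('x::borel_space, 'a::borel_space) history measure)"
proof -
  have 1: "(\<lambda>s. restrict (fst s) {..<k}) \<in> (hist (Suc k) :: ('x, 'a) history measure) \<rightarrow>\<^sub>M PiM {..<k} (\<lambda>_. borel)"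
    by (rule measurable_compose[OF measurable_hist_fst measurable_restrict_subset]) auto
  have 2: "(\<lambda>s. fst (fst s k)) \<in> (hist (Suc k) :: ('x, 'a) history measure) \<rightarrow>\<^sub>M borel"
    by (rule measurable_compose[OF measurable_hist_component measurable_fst_borel]) simp
  have "(\<lambda>s. (restrict (fst s) {..<k}, fst (fst s k))) \<in> hist (Suc k) \<rightarrow>\<^sub>M (hist k :: ('x, 'a) history measure)"
    unfolding hist_def[of k] by (rule measurable_Pair[OF 1 2])
  then show ?thesis by (simp add: trunc_def[abs_def])
qed

definition state_law where
  "state_law q \<pi> x k = distr (hist_law q \<pi> x k) borel snd"

text \<open>The pair of time \<open>k\<close> enters the history only at time
  \<open>k + 1\<close>.\<close>

definition action_law where
  "action_law q \<pi> x k = distr (hist_law q \<pi> x (Suc k)) borel (\<lambda>s. fst s k)"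

locale process =
  fixes q :: "'x::borel_space \<times> 'a::borel_space \<Rightarrow> 'x measure" and \<pi> :: "('x, 'a) policy" and x :: 'x
  assumes q_kernel: "q \<in> borel \<rightarrow>\<^sub>M prob_algebra borel"
    and policy_kernel: "\<And>k. \<pi> k \<in> universal (hist k) \<rightarrow>\<^sub>M prob_algebra borel"
begin

lemma q_prob: "prob_space (q z)" and q_sets: "sets (q z) = sets borel"
  using measurable_space[OF q_kernel, of z] by (auto simp: space_prob_algebra)

lemma policy_prob: "s \<in> space (hist k) \<Longrightarrow> prob_space (\<pi> k s)"
  and policy_sets: "s \<in> space (hist k) \<Longrightarrow> sets (\<pi> k s) = sets borel"
  using measurable_space[OF policy_kernel, of s k]
  by (simp_all add: space_prob_algebra space_universal[OF space_hist_nonempty])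

definition move :: "nat \<Rightarrow> ('x, 'a) history \<Rightarrow> 'a \<Rightarrow> ('x, 'a) history measure" where
  "move k s a = distr (q (snd s, a)) (hist (Suc k)) (\<lambda>y'. ((fst s)(k := (snd s, a)), y'))"

definition step :: "nat \<Rightarrow> ('x, 'a) history \<Rightarrow> ('x, 'a) history measure" where
  "step k s = \<pi> k s \<bind> move k s"

lemma extend_measurable:
  "(\<lambda>((s, a), y'). ((fst s)(k := (snd s, a)), y')) \<in> (hist k \<Otimes>\<^sub>M borel) \<Otimes>\<^sub>M borel \<rightarrow>\<^sub>M (hist (Suc k) :: ('x, 'a) history measure)"
proof -
  let ?M = "((hist k :: ('x, 'a) history measure) \<Otimes>\<^sub>M (borel :: 'a measure)) \<Otimes>\<^sub>M (borel :: 'x measure)"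
  have s: "(\<lambda>x. fst (fst x)) \<in> ?M \<rightarrow>\<^sub>M hist k"
    by (rule measurable_compose[OF measurable_fst measurable_fst])
  have a: "(\<lambda>x. snd (fst x)) \<in> ?M \<rightarrow>\<^sub>M borel"
    by (rule measurable_compose[OF measurable_fst measurable_snd])
  have "(\<lambda>x. ((fst (fst (fst x)))(k := (snd (fst (fst x)), snd (fst x))), snd x)) \<in> ?M \<rightarrow>\<^sub>M (hist (Suc k) :: ('x, 'a) history measure)"
    unfolding hist_def[of "Suc k"]
  proof (rule measurable_Pair)
    show "(\<lambda>x. (fst (fst (fst x)))(k := (snd (fst (fst x)), snd (fst x)))) \<in> ?M \<rightarrow>\<^sub>M PiM {..<Suc k} (\<lambda>_. borel)"
    proof (rule measurable_fun_upd[where J="{..<k}"])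
      show "(\<lambda>x. fst (fst (fst x))) \<in> ?M \<rightarrow>\<^sub>M PiM {..<k} (\<lambda>_. borel)"
        by (rule measurable_compose[OF s measurable_hist_fst])
      show "(\<lambda>x. (snd (fst (fst x)), snd (fst x))) \<in> ?M \<rightarrow>\<^sub>M borel"
        by (rule measurable_Pair_borel[OF measurable_compose[OF s measurable_hist_snd] a])
    qed auto
  qed (rule measurable_snd)
  then show ?thesis by (simp add: split_beta')
qed

lemma extend_measurable1:
  assumes "s \<in> space (hist k)"
  shows "(\<lambda>y'. ((fst s)(k := (snd s, a)), y')) \<in> borel \<rightarrow>\<^sub>M (hist (Suc k) :: ('x, 'a) history measure)"
  using measurable_compose[OF measurable_Pair1'[of "(s, a)" "hist k \<Otimes>\<^sub>M borel" borel] extend_measurable[of k]] assms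
  by (simp add: space_pair_measure)

lemma move_measurable:
  "(\<lambda>(s, a). move k s a) \<in> hist k \<Otimes>\<^sub>M borel \<rightarrow>\<^sub>M prob_algebra (hist (Suc k))"
proof -
  have "(\<lambda>x. distr (q (snd (fst x), snd x)) (hist (Suc k)) (\<lambda>y'. ((fst (fst x))(k := (snd (fst x), snd x)), y')))
     \<in> (hist k :: ('x, 'a) history measure) \<Otimes>\<^sub>M borel \<rightarrow>\<^sub>M prob_algebra (hist (Suc k))"
  proof (rule measurable_distr_prob_space2)
    have "(\<lambda>x. (snd (fst x), snd x)) \<in> (hist k :: ('x, 'a) history measure) \<Otimes>\<^sub>M (borel :: 'a measure) \<rightarrow>\<^sub>M borel"
      by (rule measurable_Pair_borel[OF measurable_compose[OF measurable_fst measurable_hist_snd] measurable_snd])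
    then show "(\<lambda>x. q (snd (fst x), snd x)) \<in> (hist k :: ('x, 'a) history measure) \<Otimes>\<^sub>M borel \<rightarrow>\<^sub>M prob_algebra borel"
      by (rule measurable_compose[OF _ q_kernel])
    show "(\<lambda>(x, y'). ((fst (fst x))(k := (snd (fst x), snd x)), y')) \<in> (hist k \<Otimes>\<^sub>M borel) \<Otimes>\<^sub>M borel \<rightarrow>\<^sub>M (hist (Suc k) :: ('x, 'a) history measure)"
      using extend_measurable[of k] by (simp add: split_beta')
  qed
  then show ?thesis by (simp add: move_def split_beta')
qed

lemma move_measurable1:
  assumes "s \<in> space (hist k)"
  shows "move k s \<in> borel \<rightarrow>\<^sub>M prob_algebra (hist (Suc k))"
  using measurable_compose[OF measurable_Pair1'[OF assms] move_measurable[of k]] by simp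

text \<open>The policy is measurable for the universal sigma-algebra of histories, the move for the
  product sigma-algebra. Passing to \<open>universal (hist k) \<Otimes>\<^sub>M borel\<close> puts
  both on one space, where the kernels can be composed.\<close>

lemma step_kernel: "step k \<in> universal (hist k) \<rightarrow>\<^sub>M prob_algebra (hist (Suc k))"
proof -
  have id: "(\<lambda>s. s) \<in> universal (hist k) \<rightarrow>\<^sub>M (hist k :: ('x, 'a) history measure)"
    by (rule measurable_universal_mono) (auto simp: space_hist_nonempty)
  have "(\<lambda>z. (fst z, snd z)) \<in> universal (hist k) \<Otimes>\<^sub>M borel \<rightarrow>\<^sub>M (hist k :: ('x, 'a) history measure) \<Otimes>\<^sub>M (borel :: 'a measure)"
    by (rule measurable_Pair[OF measurable_compose[OF measurable_fst id] measurable_snd])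
  from measurable_compose[OF this move_measurable[of k]]
  have "(\<lambda>(s, a). move k s a) \<in> universal (hist k) \<Otimes>\<^sub>M borel \<rightarrow>\<^sub>M prob_algebra (hist (Suc k))"
    by (simp add: split_beta')
  from measurable_bind_prob_space2[OF policy_kernel[of k] this]
  show ?thesis by (simp add: step_def[abs_def])
qed

lemma hist_law_Suc: "hist_law q \<pi> x (Suc k) = completion (hist_law q \<pi> x k) \<bind> step k"
  by (simp add: step_def[abs_def] move_def[abs_def] split_beta')

sublocale step: universal_kernel "hist k" "hist (Suc k)" "step k" for k
  by unfold_locales (rule step_kernel, rule space_hist_nonempty)

lemma hist_law_prob_sets: "prob_space (hist_law q \<pi> x k) \<and> sets (hist_law q \<pi> x k) = sets (hist k)"
proof (induction k)
  case 0
  have "((\<lambda>_. undefined), x) \<in> space (hist 0 :: ('x, 'a) history measure)" by (simp add: space_hist extensional_def)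
  from prob_space_return[OF this] show ?case by simp
next
  case (Suc k)
  then show ?case
    unfolding hist_law_Suc using step.prob_space_bind_universal step.sets_bind_universal by simp
qed

lemma hist_law_prob: "prob_space (hist_law q \<pi> x k)"
  and hist_law_sets: "sets (hist_law q \<pi> x k) = sets (hist k)"
  using hist_law_prob_sets by simp_all

lemma hist_law_space: "space (hist_law q \<pi> x k) = space (hist k)"
  by (rule sets_eq_imp_space_eq[OF hist_law_sets])

lemma measurable_hist_law: "f \<in> hist k \<rightarrow>\<^sub>M N \<Longrightarrow> f \<in> hist_law q \<pi> x k \<rightarrow>\<^sub>M N"
  by (simp only: measurable_cong_sets[OF hist_law_sets refl])

lemma nn_integral_step:
  assumes g: "g \<in> borel_measurable (hist (Suc k))" and s: "s \<in> space (hist k)"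
  shows "(\<integral>\<^sup>+ t. g t \<partial>step k s) = (\<integral>\<^sup>+ a. \<integral>\<^sup>+ y'. g ((fst s)(k := (snd s, a)), y') \<partial>q (snd s, a) \<partial>\<pi> k s)"
proof -
  have m: "move k s \<in> \<pi> k s \<rightarrow>\<^sub>M subprob_algebra (hist (Suc k))"
    using measurable_prob_algebraD[OF move_measurable1[OF s]]
    by (simp only: measurable_cong_sets[OF policy_sets[OF s] refl])
  have "(\<integral>\<^sup>+ t. g t \<partial>step k s) = (\<integral>\<^sup>+ a. \<integral>\<^sup>+ t. g t \<partial>move k s a \<partial>\<pi> k s)"
    unfolding step_def by (rule nn_integral_bind[OF g m])
  also have "\<dots> = (\<integral>\<^sup>+ a. \<integral>\<^sup>+ y'. g ((fst s)(k := (snd s, a)), y') \<partial>q (snd s, a) \<partial>\<pi> k s)"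
  proof (rule nn_integral_cong)
    fix a
    have "(\<lambda>y'. ((fst s)(k := (snd s, a)), y')) \<in> q (snd s, a) \<rightarrow>\<^sub>M hist (Suc k)"
      using extend_measurable1[OF s] by (simp only: measurable_cong_sets[OF q_sets refl])
    then show "(\<integral>\<^sup>+ t. g t \<partial>move k s a) = (\<integral>\<^sup>+ y'. g ((fst s)(k := (snd s, a)), y') \<partial>q (snd s, a))"
      unfolding move_def by (rule nn_integral_distr) (use g in simp)
  qed
  finally show ?thesis .
qed

lemma nn_integral_hist_law_Suc:
  assumes g: "g \<in> borel_measurable (hist (Suc k))"
  shows "(\<integral>\<^sup>+ t. g t \<partial>hist_law q \<pi> x (Suc k)) =
    (\<integral>\<^sup>+ s. \<integral>\<^sup>+ a. \<integral>\<^sup>+ y'. g ((fst s)(k := (snd s, a)), y') \<partial>q (snd s, a) \<partial>\<pi> k s \<partial>hist_law q \<pi> x k)"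
proof -
  have "(\<integral>\<^sup>+ t. g t \<partial>hist_law q \<pi> x (Suc k)) = (\<integral>\<^sup>+ s. \<integral>\<^sup>+ t. g t \<partial>step k s \<partial>completion (hist_law q \<pi> x k))"
    unfolding hist_law_Suc
    by (rule nn_integral_bind[OF g step.kernel_completion_subprob[OF hist_law_prob hist_law_sets]])
  also have "\<dots> = (\<integral>\<^sup>+ s. \<integral>\<^sup>+ t. g t \<partial>step k s \<partial>hist_law q \<pi> x k)"
    by (rule nn_integral_completion)
  also have "\<dots> = (\<integral>\<^sup>+ s. \<integral>\<^sup>+ a. \<integral>\<^sup>+ y'. g ((fst s)(k := (snd s, a)), y') \<partial>q (snd s, a) \<partial>\<pi> k s \<partial>hist_law q \<pi> x k)"
    by (rule nn_integral_cong) (simp add: nn_integral_step[OF g] hist_law_space)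
  finally show ?thesis .
qed

text \<open>The state appended at the end is forgotten and \<open>q\<close> and the policy have
  total mass 1, so both inner integrals collapse. This consistency makes the marginals used in
  \<open>ex_traj_law\<close> projective.\<close>

lemma distr_trunc: "distr (hist_law q \<pi> x (Suc k)) (hist k) (trunc k) = hist_law q \<pi> x k"
proof (rule measure_eqI)
  show "sets (distr (hist_law q \<pi> x (Suc k)) (hist k) (trunc k)) = sets (hist_law q \<pi> x k)"
    by (simp add: hist_law_sets)
  fix E assume "E \<in> sets (distr (hist_law q \<pi> x (Suc k)) (hist k) (trunc k))"
  then have E: "E \<in> sets (hist k)" by simp
  have ind: "indicator E \<in> borel_measurable (hist k)" using E by simp
  have gm: "(\<lambda>t. indicator E (trunc k t) :: ennreal) \<in> borel_measurable (hist (Suc k))"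
    by (rule measurable_compose[OF measurable_trunc ind])
  have "emeasure (distr (hist_law q \<pi> x (Suc k)) (hist k) (trunc k)) E = (\<integral>\<^sup>+ s. indicator E s \<partial>distr (hist_law q \<pi> x (Suc k)) (hist k) (trunc k))"
    using E by simp
  also have "\<dots> = (\<integral>\<^sup>+ t. indicator E (trunc k t) \<partial>hist_law q \<pi> x (Suc k))"
    by (rule nn_integral_distr[OF measurable_hist_law[OF measurable_trunc] ]) (use E in simp)
  also have "\<dots> = (\<integral>\<^sup>+ s. \<integral>\<^sup>+ a. \<integral>\<^sup>+ y'. indicator E (trunc k ((fst s)(k := (snd s, a)), y')) \<partial>q (snd s, a) \<partial>\<pi> k s \<partial>hist_law q \<pi> x k)"
    by (rule nn_integral_hist_law_Suc[OF gm])
  also have "\<dots> = (\<integral>\<^sup>+ s. indicator E s \<partial>hist_law q \<pi> x k)"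
  proof (rule nn_integral_cong)
    fix s assume "s \<in> space (hist_law q \<pi> x k)"
    then have s: "s \<in> space (hist k)" by (simp add: hist_law_space)
    then have "restrict (fst s) {..<k} = fst s" by (auto simp: space_hist extensional_restrict)
    moreover have "restrict ((fst s)(k := z)) {..<k} = restrict (fst s) {..<k}" for z
      by (auto simp: restrict_def)
    ultimately have t: "trunc k ((fst s)(k := (snd s, a)), y') = s" for a y'
      by (simp add: trunc_def)
    show "(\<integral>\<^sup>+ a. \<integral>\<^sup>+ y'. indicator E (trunc k ((fst s)(k := (snd s, a)), y')) \<partial>q (snd s, a) \<partial>\<pi> k s) = (indicator E s :: ennreal)"
      unfolding t using prob_space.emeasure_space_1[OF q_prob] prob_space.emeasure_space_1[OF policy_prob[OF s]]
      by simp
  qed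
  also have "\<dots> = emeasure (hist_law q \<pi> x k) E" using E by (simp add: hist_law_sets)
  finally show "emeasure (distr (hist_law q \<pi> x (Suc k)) (hist k) (trunc k)) E = emeasure (hist_law q \<pi> x k) E" .
qed

section \<open>Marginal laws of states and of state-action pairs\<close>

lemma state_law_prob: "prob_space (state_law q \<pi> x k)"
  unfolding state_law_def
  by (rule prob_space.prob_space_distr[OF hist_law_prob measurable_hist_law[OF measurable_hist_snd]])

lemma state_law_sets: "sets (state_law q \<pi> x k) = sets borel" by (simp add: state_law_def)

lemma action_law_prob: "prob_space (action_law q \<pi> x k)"
  unfolding action_law_def
  by (rule prob_space.prob_space_distr[OF hist_law_prob measurable_hist_law[OF measurable_hist_component]]) simp

lemma action_law_sets: "sets (action_law q \<pi> x k) = sets borel" by (simp add: action_law_def)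

lemma state_law_0: "state_law q \<pi> x 0 = return borel x"
proof -
  have "((\<lambda>_. undefined), x) \<in> space (hist 0 :: ('x, 'a) history measure)" by (simp add: space_hist extensional_def)
  from distr_return[OF measurable_hist_snd this] show ?thesis
    unfolding state_law_def by simp
qed

lemma distr_action_law_fst: "distr (action_law q \<pi> x k) borel fst = state_law q \<pi> x k"
proof -
  have "distr (action_law q \<pi> x k) borel fst = distr (hist_law q \<pi> x (Suc k)) borel (fst \<circ> (\<lambda>s. fst s k))"
    unfolding action_law_def
    by (rule distr_distr[OF measurable_fst_borel measurable_hist_law[OF measurable_hist_component]]) simp
  also have "fst \<circ> (\<lambda>s. fst s k) = snd \<circ> trunc k" by (auto simp: trunc_def)
  also have "distr (hist_law q \<pi> x (Suc k)) borel (snd \<circ> trunc k) = distr (distr (hist_law q \<pi> x (Suc k)) (hist k) (trunc k)) borel snd"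
    by (rule distr_distr[symmetric, OF measurable_hist_snd measurable_hist_law[OF measurable_trunc]])
  finally show ?thesis unfolding distr_trunc state_law_def .
qed

lemma nn_integral_action_law:
  assumes g: "g \<in> borel_measurable borel"
  shows "(\<integral>\<^sup>+ z. g z \<partial>action_law q \<pi> x k) = (\<integral>\<^sup>+ s. \<integral>\<^sup>+ a. g (snd s, a) \<partial>\<pi> k s \<partial>hist_law q \<pi> x k)"
proof -
  have c: "(\<lambda>s. fst s k) \<in> hist (Suc k) \<rightarrow>\<^sub>M (borel :: ('x \<times> 'a) measure)" by (rule measurable_hist_component) simp
  have "(\<integral>\<^sup>+ z. g z \<partial>action_law q \<pi> x k) = (\<integral>\<^sup>+ t. g (fst t k) \<partial>hist_law q \<pi> x (Suc k))"
    unfolding action_law_def by (rule nn_integral_distr[OF measurable_hist_law[OF c]]) (use g in simp)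
  also have "\<dots> = (\<integral>\<^sup>+ s. \<integral>\<^sup>+ a. \<integral>\<^sup>+ y'. g (snd s, a) \<partial>q (snd s, a) \<partial>\<pi> k s \<partial>hist_law q \<pi> x k)"
    by (subst nn_integral_hist_law_Suc[OF measurable_compose[OF c g]]) simp
  also have "\<dots> = (\<integral>\<^sup>+ s. \<integral>\<^sup>+ a. g (snd s, a) \<partial>\<pi> k s \<partial>hist_law q \<pi> x k)"
    using prob_space.emeasure_space_1[OF q_prob] by simp
  finally show ?thesis .
qed

lemma q_universal: "q \<in> universal borel \<rightarrow>\<^sub>M prob_algebra borel"
  by (rule measurable_universal_mono[OF q_kernel]) simp

sublocale trans: universal_kernel borel borel q
  by unfold_locales (rule q_universal, simp)

text \<open>Given the whole history, the next state depends on the last pair alone. Costs of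
  arbitrary history-dependent policies can therefore be studied through the laws of single states
  and pairs.\<close>

lemma state_law_Suc: "state_law q \<pi> x (Suc k) = completion (action_law q \<pi> x k) \<bind> q"
proof (rule measure_eqI)
  show "sets (state_law q \<pi> x (Suc k)) = sets (completion (action_law q \<pi> x k) \<bind> q)"
    using trans.sets_bind_universal[OF action_law_prob action_law_sets] by (simp add: state_law_sets)
  fix E assume "E \<in> sets (state_law q \<pi> x (Suc k))"
  then have E: "E \<in> sets borel" by (simp add: state_law_sets)
  have gm: "(\<lambda>t. indicator E (snd t) :: ennreal) \<in> borel_measurable (hist (Suc k) :: ('x, 'a) history measure)"
    by (rule measurable_compose[OF measurable_hist_snd]) (use E in simp)
  have qE: "(\<lambda>z. emeasure (q z) E) \<in> borel_measurable borel"
    by (rule measurable_compose[OF measurable_prob_algebraD[OF q_kernel] measurable_emeasure_subprob_algebra[OF E]])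
  have "emeasure (state_law q \<pi> x (Suc k)) E = (\<integral>\<^sup>+ y. indicator E y \<partial>state_law q \<pi> x (Suc k))"
    using E by (simp add: state_law_sets)
  also have "\<dots> = (\<integral>\<^sup>+ t. indicator E (snd t) \<partial>hist_law q \<pi> x (Suc k))"
    unfolding state_law_def
    by (rule nn_integral_distr[OF measurable_hist_law[OF measurable_hist_snd]]) (use E in simp)
  also have "\<dots> = (\<integral>\<^sup>+ s. \<integral>\<^sup>+ a. \<integral>\<^sup>+ y'. indicator E y' \<partial>q (snd s, a) \<partial>\<pi> k s \<partial>hist_law q \<pi> x k)"
    by (subst nn_integral_hist_law_Suc[OF gm]) simp
  also have "\<dots> = (\<integral>\<^sup>+ s. \<integral>\<^sup>+ a. emeasure (q (snd s, a)) E \<partial>\<pi> k s \<partial>hist_law q \<pi> x k)"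
    using E by (simp add: q_sets)
  also have "\<dots> = (\<integral>\<^sup>+ z. emeasure (q z) E \<partial>action_law q \<pi> x k)"
    by (rule nn_integral_action_law[OF qE, symmetric])
  also have "\<dots> = (\<integral>\<^sup>+ z. emeasure (q z) E \<partial>completion (action_law q \<pi> x k))"
    by (rule nn_integral_completion[symmetric])
  also have "\<dots> = emeasure (completion (action_law q \<pi> x k) \<bind> q) E"
    by (rule emeasure_bind_prob_algebra[symmetric, OF trans.completion_in_prob[OF action_law_prob action_law_sets]
          trans.kernel_completion[OF action_law_prob action_law_sets] E])
  finally show "emeasure (state_law q \<pi> x (Suc k)) E = emeasure (completion (action_law q \<pi> x k) \<bind> q) E" .
qed

text \<open>\<open>S\<close> is squeezed between the Borel set \<open>S1\<close> and
  \<open>S1 \<union> T\<close> with \<open>T\<close> null. The Borel set \<open>?B\<close> is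
  disjoint from \<open>S\<close>, so its sections are null for the policy and it is null itself by
  the integral formula; off \<open>?B\<close> and \<open>T\<close> every point lies in
  \<open>S\<close>.\<close>

lemma AE_action_law:
  assumes S: "S \<in> sets (universal borel)"
    and full: "\<And>s. s \<in> space (hist k) \<Longrightarrow> emeasure (completion (\<pi> k s)) {a. (snd s, a) \<in> S} = 1"
  shows "AE z in action_law q \<pi> x k. z \<in> S"
proof -
  have "S \<in> sets (completion (action_law q \<pi> x k))"
    by (rule sets_universalD[OF S action_law_prob action_law_sets])
  then obtain S1 N T where S1: "S = S1 \<union> N" "N \<subseteq> T" "T \<in> null_sets (action_law q \<pi> x k)" "S1 \<in> sets (action_law q \<pi> x k)"
    by (rule sets_completionE)
  let ?B = "- (S1 \<union> T)"
  have B: "?B \<in> sets borel"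
    using S1(3,4) sets.compl_sets[of "S1 \<union> T" borel] by (auto simp: action_law_sets Compl_eq_Diff_UNIV null_sets_def)
  have "emeasure (action_law q \<pi> x k) ?B = (\<integral>\<^sup>+ z. indicator ?B z \<partial>action_law q \<pi> x k)"
    using B by (simp add: action_law_sets)
  also have "\<dots> = (\<integral>\<^sup>+ s. \<integral>\<^sup>+ a. indicator ?B (snd s, a) \<partial>\<pi> k s \<partial>hist_law q \<pi> x k)"
    by (rule nn_integral_action_law) (use B in simp)
  also have "\<dots> = (\<integral>\<^sup>+ s. 0 \<partial>hist_law q \<pi> x k)"
  proof (rule nn_integral_cong)
    fix s assume "s \<in> space (hist_law q \<pi> x k)"
    then have s: "s \<in> space (hist k)" by (simp add: hist_law_space)
    interpret C: prob_space "completion (\<pi> k s)"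
      by (rule prob_space.prob_space_completion[OF policy_prob[OF s]])
    let ?By = "{a. (snd s, a) \<in> ?B}" and ?Sy = "{a. (snd s, a) \<in> S}"
    have "Pair (snd s) \<in> borel \<rightarrow>\<^sub>M (borel :: ('x \<times> 'a) measure)"
      by (rule measurable_Pair_borel) auto
    from measurable_sets[OF this B] have By: "?By \<in> sets (\<pi> k s)"
      by (simp add: policy_sets[OF s] vimage_def)
    \<comment> \<open>Nonmeasurable sets have \<open>emeasure\<close> 0, so the value 1 includes
      measurability.\<close>
    have Sy: "?Sy \<in> sets (completion (\<pi> k s))"
      using full[OF s] emeasure_notin_sets[of ?Sy "completion (\<pi> k s)"] by fastforce
    have "AE a in completion (\<pi> k s). a \<in> ?Sy"
      using full[OF s] C.AE_in_set_eq_1[OF Sy] by (simp add: C.emeasure_eq_measure)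
    then have ae: "AE a in \<pi> k s. a \<notin> ?By"
      unfolding AE_completion_iff by eventually_elim (use S1 in blast)
    have "(\<integral>\<^sup>+ a. indicator ?B (snd s, a) \<partial>\<pi> k s) = (\<integral>\<^sup>+ a. 0 \<partial>\<pi> k s)"
      by (rule nn_integral_cong_AE) (use ae in \<open>eventually_elim, simp\<close>)
    then show "(\<integral>\<^sup>+ a. indicator ?B (snd s, a) \<partial>\<pi> k s) = (0 :: ennreal)" by simp
  qed
  finally have "?B \<in> null_sets (action_law q \<pi> x k)" using B by (intro null_setsI) (simp_all add: action_law_sets)
  then have "AE z in action_law q \<pi> x k. z \<notin> ?B" by (rule AE_not_in)
  moreover have "AE z in action_law q \<pi> x k. z \<notin> T" by (rule AE_not_in[OF S1(3)])
  ultimately show ?thesis by eventually_elim (use S1 in blast)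
qed

subsection \<open>Existence and uniqueness of the trajectory law\<close>

definition traj_map :: "nat \<Rightarrow> (nat \<Rightarrow> 'x \<times> 'a) \<Rightarrow> ('x, 'a) history" where
  "traj_map k \<omega> = (restrict \<omega> {..<k}, fst (\<omega> k))"

lemma measurable_traj_map:
  assumes "{..k} \<subseteq> I"
  shows "traj_map k \<in> PiM I (\<lambda>_. borel) \<rightarrow>\<^sub>M hist k"
proof -
  have 1: "(\<lambda>\<omega>. restrict \<omega> {..<k}) \<in> PiM I (\<lambda>_. borel) \<rightarrow>\<^sub>M PiM {..<k} (\<lambda>_. borel :: ('x \<times> 'a) measure)"
    by (rule measurable_restrict_subset) (use assms in auto)
  have "(\<lambda>\<omega>. \<omega> k) \<in> PiM I (\<lambda>_. borel) \<rightarrow>\<^sub>M (borel :: ('x \<times> 'a) measure)"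
    by (rule measurable_component_singleton) (use assms in auto)
  from measurable_compose[OF this measurable_fst_borel]
  have 2: "(\<lambda>\<omega>. fst (\<omega> k)) \<in> PiM I (\<lambda>_. borel :: ('x \<times> 'a) measure) \<rightarrow>\<^sub>M (borel :: 'x measure)" .
  show ?thesis unfolding traj_map_def[abs_def] hist_def by (rule measurable_Pair[OF 1 2])
qed

abbreviation is_traj_law :: "(nat \<Rightarrow> 'x \<times> 'a) measure \<Rightarrow> bool" where
  "is_traj_law P \<equiv> prob_space P \<and> sets P = sets (\<Pi>\<^sub>M i\<in>UNIV. borel) \<and>
     (\<forall>k. distr P (hist k) (traj_map k) = hist_law q \<pi> x k)"

lemma is_traj_law_unique:
  assumes P: "is_traj_law P" and Q: "is_traj_law Q"
  shows "P = Q"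
proof (rule measure_eqI_PiM_infinite[where I=UNIV and M="\<lambda>_. borel :: ('x \<times> 'a) measure"])
  fix A :: "nat \<Rightarrow> ('x \<times> 'a) set" and J :: "nat set"
  assume J: "finite J" and A: "\<And>i. i \<in> J \<Longrightarrow> A i \<in> sets borel"
  obtain k where k: "J \<subseteq> {..<k}" using J finite_nat_iff_bounded by auto
  have E: "{s \<in> space (hist k). \<forall>i\<in>J. fst s i \<in> A i} \<in> sets (hist k)" (is "?E \<in> _")
  proof (rule sets.sets_Collect_finite_All[OF _ J])
    fix i assume i: "i \<in> J"
    have "(\<lambda>s. fst s i) -` A i \<inter> space (hist k) \<in> sets (hist k)"
      by (rule measurable_sets[OF measurable_hist_component A[OF i]]) (use k i in auto)
    also have "(\<lambda>s. fst s i) -` A i \<inter> space (hist k) = {s \<in> space (hist k). fst s i \<in> A i}" by auto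
    finally show "{s \<in> space (hist k). fst s i \<in> A i} \<in> sets (hist k)" .
  qed
  have *: "emeasure R (prod_emb UNIV (\<lambda>_. borel) J (Pi\<^sub>E J A)) = emeasure (hist_law q \<pi> x k) ?E" if R: "is_traj_law R" for R
  proof -
    have sR: "space R = UNIV" using R sets_eq_imp_space_eq[of R "\<Pi>\<^sub>M i\<in>UNIV. borel"] by (auto simp: space_PiM)
    have "traj_map k \<in> (\<Pi>\<^sub>M i\<in>UNIV. borel) \<rightarrow>\<^sub>M hist k" by (rule measurable_traj_map) simp
    then have tm: "traj_map k \<in> R \<rightarrow>\<^sub>M hist k"
      using R by (simp only: measurable_cong_sets[of R "\<Pi>\<^sub>M i\<in>UNIV. borel", OF _ refl])
    have "emeasure (hist_law q \<pi> x k) ?E = emeasure (distr R (hist k) (traj_map k)) ?E"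
      using R by simp
    also have "\<dots> = emeasure R (traj_map k -` ?E \<inter> space R)" by (rule emeasure_distr[OF tm E])
    also have "traj_map k -` ?E \<inter> space R = prod_emb UNIV (\<lambda>_. borel) J (Pi\<^sub>E J A)"
      using k sR by (auto simp: prod_emb_def space_PiM traj_map_def space_hist PiE_def Pi_def)
    finally show ?thesis ..
  qed
  show "emeasure P (prod_emb UNIV (\<lambda>_. borel) J (Pi\<^sub>E J A)) = emeasure Q (prod_emb UNIV (\<lambda>_. borel) J (Pi\<^sub>E J A))"
    using *[OF P] *[OF Q] by simp
next
  show "finite_measure P" using P prob_space.finite_measure by blast
qed (use P Q in auto)

text \<open>
  Kolmogorov's extension theorem is available for Polish spaces only; it is applied to the codes of
  the state-action pairs.
\<close>

lemma ex_traj_law: "\<exists>P. is_traj_law P"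
proof -
  obtain e d where e: "e \<in> (borel :: ('x \<times> 'a) measure) \<rightarrow>\<^sub>M (borel :: real measure)" and d: "d \<in> borel \<rightarrow>\<^sub>M (borel :: ('x \<times> 'a) measure)"
    and de: "\<And>s. d (e s) = s"
    using coded_prod unfolding coded_def by auto
  define enc :: "nat set \<Rightarrow> ('x, 'a) history \<Rightarrow> nat \<Rightarrow> real" where "enc J s = (\<lambda>i\<in>J. e (fst s i))" for J s
  have enc: "enc J \<in> hist k \<rightarrow>\<^sub>M PiM J (\<lambda>_. borel)" if "J \<subseteq> {..<k}" for J k
    unfolding enc_def[abs_def]
    by (rule measurable_restrict, rule measurable_compose[OF measurable_hist_component e]) (use that in auto)
  define marg where "marg k J = distr (hist_law q \<pi> x k) (PiM J (\<lambda>_. borel)) (enc J)" for k J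
  have marg_prob: "prob_space (marg k J)" if "J \<subseteq> {..<k}" for k J
    unfolding marg_def by (rule prob_space.prob_space_distr[OF hist_law_prob measurable_hist_law[OF enc[OF that]]])
  have marg_Suc: "marg (Suc k) J = marg k J" if J: "J \<subseteq> {..<k}" for k J
  proof -
    have "enc J (trunc k s) = enc J s" for s
      unfolding enc_def trunc_def using J by (intro ext) (auto simp: restrict_def dest: subsetD)
    then have "enc J = enc J \<circ> trunc k" by auto
    then have "marg (Suc k) J = distr (hist_law q \<pi> x (Suc k)) (PiM J (\<lambda>_. borel)) (enc J \<circ> trunc k)"
      unfolding marg_def by simp
    also have "\<dots> = distr (distr (hist_law q \<pi> x (Suc k)) (hist k) (trunc k)) (PiM J (\<lambda>_. borel)) (enc J)"
      by (rule distr_distr[symmetric, OF enc[OF J] measurable_hist_law[OF measurable_trunc]])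
    finally show ?thesis unfolding distr_trunc marg_def .
  qed
  have marg_eq: "marg m J = marg k J" if J: "J \<subseteq> {..<k}" and km: "k \<le> m" for k m J
    using km
  proof (induction rule: dec_induct)
    case (step n)
    have "J \<subseteq> {..<n}" using J step(1) by force
    then show ?case using marg_Suc step.IH by simp
  qed simp
  have marg_eq': "marg m J = marg k J" if "J \<subseteq> {..<k}" "J \<subseteq> {..<m}" for k m J
    using marg_eq[of J k m] marg_eq[of J m k] that by (cases "k \<le> m") auto
  \<comment> \<open>Any time beyond all elements of \<open>J\<close> gives the same marginal. For
    empty \<open>J\<close> the value of \<open>Max\<close> is unspecified, which is harmless for the
    same reason.\<close>
  define F where "F J = marg (Suc (Max J)) J" for J
  have Jsub: "J \<subseteq> {..<Suc (Max J)}" if "finite J" for J :: "nat set"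
    using that by (auto simp: less_Suc_eq_le)
  have F_eq: "F J = marg k J" if "J \<subseteq> {..<k}" for J k
    unfolding F_def by (rule marg_eq'[OF that Jsub]) (rule finite_subset[OF that], simp)
  interpret PF: polish_projective UNIV F
  proof (unfold polish_projective_def projective_family_def, intro conjI allI impI)
    fix J H :: "nat set" assume JH: "J \<subseteq> H" "finite H"
    let ?k = "Suc (Max H)"
    have H: "H \<subseteq> {..<?k}" by (rule Jsub[OF JH(2)])
    have J: "J \<subseteq> {..<?k}" using JH H by auto
    have "(\<lambda>f. restrict f J) \<circ> enc H = enc J"
      using JH(1) by (auto simp: enc_def restrict_def fun_eq_iff)
    then have "distr (marg ?k H) (PiM J (\<lambda>_. borel)) (\<lambda>f. restrict f J) = marg ?k J"
      unfolding marg_def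
      by (subst distr_distr[OF measurable_restrict_subset[OF JH(1)] measurable_hist_law[OF enc[OF H]]]) simp
    then show "F J = distr (F H) (PiM J (\<lambda>_. borel)) (\<lambda>f. restrict f J)"
      using F_eq[OF H] F_eq[OF J] by simp
  next
    fix J :: "nat set" assume "finite J"
    then show "prob_space (F J)" unfolding F_def by (rule marg_prob[OF Jsub])
  qed
  have dc: "(\<lambda>f. d (f i)) \<in> PiM I (\<lambda>_. borel) \<rightarrow>\<^sub>M borel" if "i \<in> I" for i :: nat and I
    by (rule measurable_compose[OF measurable_component_singleton[OF that] d])
  have dm: "(\<lambda>\<omega> i. d (\<omega> i)) \<in> PiM UNIV (\<lambda>_. borel) \<rightarrow>\<^sub>M PiM UNIV (\<lambda>_::nat. borel :: ('x \<times> 'a) measure)"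
    by (rule measurable_PiM_single') (auto intro!: dc)
  have dl: "(\<lambda>\<omega> i. d (\<omega> i)) \<in> PF.lim \<rightarrow>\<^sub>M PiM UNIV (\<lambda>_::nat. borel :: ('x \<times> 'a) measure)"
    using dm by (simp only: measurable_cong_sets[OF PF.sets_lim refl])
  let ?P = "distr PF.lim (PiM UNIV (\<lambda>_::nat. borel :: ('x \<times> 'a) measure)) (\<lambda>\<omega> i. d (\<omega> i))"
  have "distr ?P (hist k) (traj_map k) = hist_law q \<pi> x k" for k
  proof -
    let ?J = "{..<Suc k}"
    have tm: "traj_map k \<in> PiM UNIV (\<lambda>_. borel) \<rightarrow>\<^sub>M hist k" by (rule measurable_traj_map) simp
    define G where "G f = traj_map k (\<lambda>i\<in>?J. d (f i))" for f :: "nat \<Rightarrow> real"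
    have rm: "(\<lambda>\<omega>. restrict \<omega> ?J) \<in> PF.lim \<rightarrow>\<^sub>M PiM ?J (\<lambda>_. borel)"
      using measurable_restrict_subset[of ?J UNIV "\<lambda>_. borel :: real measure"]
      by (simp only: measurable_cong_sets[OF PF.sets_lim refl] subset_UNIV)
    have "(\<lambda>f. \<lambda>i\<in>?J. d (f i)) \<in> PiM ?J (\<lambda>_. borel) \<rightarrow>\<^sub>M PiM ?J (\<lambda>_. borel)"
      by (rule measurable_restrict, rule dc)
    from measurable_compose[OF this measurable_traj_map[of k]]
    have Gm: "G \<in> PiM ?J (\<lambda>_. borel) \<rightarrow>\<^sub>M hist k"
      unfolding G_def[abs_def] by (simp add: subset_eq less_Suc_eq_le)
    have "distr PF.lim (PiM ?J (\<lambda>_. borel)) (\<lambda>\<omega>. restrict \<omega> ?J) = F ?J"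
    proof (rule measure_eqI)
      show "sets (distr PF.lim (PiM ?J (\<lambda>_. borel)) (\<lambda>\<omega>. restrict \<omega> ?J)) = sets (F ?J)"
        by (simp add: PF.sets_P)
      fix X assume "X \<in> sets (distr PF.lim (PiM ?J (\<lambda>_. borel)) (\<lambda>\<omega>. restrict \<omega> ?J))"
      then have X: "X \<in> sets (PiM ?J (\<lambda>_. borel :: real measure))" by simp
      have "emeasure (distr PF.lim (PiM ?J (\<lambda>_. borel)) (\<lambda>\<omega>. restrict \<omega> ?J)) X = emeasure PF.lim (prod_emb UNIV (\<lambda>_. borel) ?J X)"
        by (subst emeasure_distr[OF rm X]) (simp add: prod_emb_def space_PiM)
      also have "\<dots> = emeasure (F ?J) X" by (rule PF.emeasure_lim_emb) (use X in auto)
      finally show "emeasure (distr PF.lim (PiM ?J (\<lambda>_. borel)) (\<lambda>\<omega>. restrict \<omega> ?J)) X = emeasure (F ?J) X" .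
    qed
    then have lim: "distr PF.lim (PiM ?J (\<lambda>_. borel)) (\<lambda>\<omega>. restrict \<omega> ?J) = marg (Suc k) ?J"
      using F_eq[of ?J "Suc k"] by simp
    have "distr ?P (hist k) (traj_map k) = distr PF.lim (hist k) (traj_map k \<circ> (\<lambda>\<omega> i. d (\<omega> i)))"
      by (rule distr_distr[OF tm dl])
    also have "traj_map k \<circ> (\<lambda>\<omega> i. d (\<omega> i)) = G \<circ> (\<lambda>\<omega>. restrict \<omega> ?J)"
      by (auto simp: G_def traj_map_def restrict_def fun_eq_iff)
    also have "distr PF.lim (hist k) (G \<circ> (\<lambda>\<omega>. restrict \<omega> ?J)) = distr (marg (Suc k) ?J) (hist k) G"
      unfolding lim[symmetric] by (rule distr_distr[symmetric, OF Gm rm])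
    also have "\<dots> = distr (hist_law q \<pi> x (Suc k)) (hist k) (G \<circ> enc ?J)"
      unfolding marg_def by (rule distr_distr[OF Gm measurable_hist_law[OF enc]]) simp
    also have "G \<circ> enc ?J = trunc k"
      by (auto simp: G_def enc_def traj_map_def trunc_def restrict_def fun_eq_iff de)
    finally show ?thesis unfolding distr_trunc .
  qed
  moreover have "prob_space ?P" by (rule PF.P.prob_space_distr[OF dl])
  ultimately show ?thesis by (intro exI[of _ ?P]) simp
qed

lemma traj_law: "is_traj_law (traj_law q \<pi> x)"
proof -
  have eq: "traj_law q \<pi> x = (THE P. is_traj_law P)"
    by (simp add: traj_law_def traj_map_def[abs_def])
  show ?thesis unfolding eq
    using theI'[of is_traj_law] ex_traj_law is_traj_law_unique by blast
qed

lemma traj_prob: "prob_space (traj_law q \<pi> x)"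
  and traj_sets: "sets (traj_law q \<pi> x) = sets (\<Pi>\<^sub>M i\<in>UNIV. borel)"
  and traj_distr: "distr (traj_law q \<pi> x) (hist k) (traj_map k) = hist_law q \<pi> x k"
  using traj_law by auto

lemma traj_component: "(\<lambda>\<omega>. \<omega> k) \<in> traj_law q \<pi> x \<rightarrow>\<^sub>M borel"
  unfolding measurable_cong_sets[OF traj_sets refl] by (rule measurable_component_singleton) simp

lemma distr_traj_component: "distr (traj_law q \<pi> x) borel (\<lambda>\<omega>. \<omega> k) = action_law q \<pi> x k"
proof -
  have tm: "traj_map (Suc k) \<in> traj_law q \<pi> x \<rightarrow>\<^sub>M hist (Suc k)"
    unfolding measurable_cong_sets[OF traj_sets refl] by (rule measurable_traj_map) simp
  have c: "(\<lambda>s. fst s k) \<in> hist (Suc k) \<rightarrow>\<^sub>M (borel :: ('x \<times> 'a) measure)" by (rule measurable_hist_component) simp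
  have "action_law q \<pi> x k = distr (traj_law q \<pi> x) borel ((\<lambda>s. fst s k) \<circ> traj_map (Suc k))"
    unfolding action_law_def traj_distr[symmetric] by (rule distr_distr[OF c tm])
  also have "(\<lambda>s. fst s k) \<circ> traj_map (Suc k) = (\<lambda>\<omega>. \<omega> k)" by (auto simp: traj_map_def)
  finally show ?thesis ..
qed

text \<open>A real function that agrees with the cost almost everywhere at every time removes the
  infinities; linearity then reduces the expectation over trajectories to the laws of the single
  pairs.\<close>

lemma eint_traj_sum:
  fixes c :: "'x \<times> 'a \<Rightarrow> ereal" and r :: "'x \<times> 'a \<Rightarrow> real" and \<beta> :: "nat \<Rightarrow> real"
  assumes r: "r \<in> universal borel \<rightarrow>\<^sub>M borel" and cr: "\<And>k. AE z in action_law q \<pi> x k. c z = ereal (r z)"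
    and int: "\<And>k. integrable (completion (action_law q \<pi> x k)) r"
  shows "eint (traj_law q \<pi> x) (\<lambda>\<omega>. \<Sum>k<n. ereal (\<beta> k) * c (\<omega> k)) =
    ereal (\<Sum>k<n. \<beta> k * integral\<^sup>L (completion (action_law q \<pi> x k)) r)"
proof -
  let ?T = "traj_law q \<pi> x"
  have ae: "AE \<omega> in ?T. c (\<omega> k) = ereal (r (\<omega> k))" for k
    by (rule AE_distrD[OF traj_component]) (unfold distr_traj_component, rule cr)
  have "AE \<omega> in completion ?T. \<forall>k. c (\<omega> k) = ereal (r (\<omega> k))"
    unfolding AE_completion_iff using ae by (simp add: AE_all_countable)
  then have "AE \<omega> in completion ?T. (\<Sum>k<n. ereal (\<beta> k) * c (\<omega> k)) = ereal (\<Sum>k<n. \<beta> k * r (\<omega> k))"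
    by eventually_elim simp
  then have "eint ?T (\<lambda>\<omega>. \<Sum>k<n. ereal (\<beta> k) * c (\<omega> k)) = eint ?T (\<lambda>\<omega>. ereal (\<Sum>k<n. \<beta> k * r (\<omega> k)))"
    by (rule eint_cong_AE)
  also have "\<dots> = ereal (\<integral>\<omega>. (\<Sum>k<n. \<beta> k * r (\<omega> k)) \<partial>completion ?T)"
  proof (rule eint_integrable)
    show "integrable (completion ?T) (\<lambda>\<omega>. \<Sum>k<n. \<beta> k * r (\<omega> k))"
      using completion_distr(1)[OF traj_prob traj_component r] int
      by (intro Bochner_Integration.integrable_sum integrable_mult_right) (simp add: distr_traj_component)
  qed
  also have "(\<integral>\<omega>. (\<Sum>k<n. \<beta> k * r (\<omega> k)) \<partial>completion ?T) = (\<Sum>k<n. \<beta> k * (\<integral>\<omega>. r (\<omega> k) \<partial>completion ?T))"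
    using completion_distr(1)[OF traj_prob traj_component r] int
    by (subst Bochner_Integration.integral_sum) (auto simp: distr_traj_component)
  also have "\<dots> = (\<Sum>k<n. \<beta> k * integral\<^sup>L (completion (action_law q \<pi> x k)) r)"
    using completion_distr(2)[OF traj_prob traj_component r] by (simp add: distr_traj_component)
  finally show ?thesis .
qed

end

subsection \<open>Policies\<close>

lemma process_policy:
  assumes "q \<in> borel \<rightarrow>\<^sub>M prob_algebra borel" "\<pi> \<in> policies A"
  shows "process q \<pi>"
  using assms unfolding policies_def process_def by auto

lemma (in process) AE_graph:
  assumes "\<pi> \<in> policies A" "graph A \<in> sets (universal borel)"
  shows "AE z in action_law q \<pi> x k. z \<in> graph A"
proof (rule AE_action_law[OF assms(2)])
  fix s :: "('x, 'a) history" assume "s \<in> space (hist k)"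
  then have "emeasure (completion (\<pi> k s)) (A (snd s)) = 1"
    using assms(1) unfolding policies_def by (cases s) auto
  then show "emeasure (completion (\<pi> k s)) {a. (snd s, a) \<in> graph A} = 1" by (simp add: graph_def)
qed

text \<open>\<open>S\<close> is arbitrary: points are Borel, so the complement of \<open>b\<close>
  is a Dirac null set and all its subsets are measurable for the completion. The action sets,
  sections of an analytic graph, need not be Borel.\<close>

lemma emeasure_completion_return:
  fixes b :: "'s::borel_space"
  assumes "b \<in> S"
  shows "emeasure (completion (return borel b)) S = 1"
proof -
  have b: "{b} \<in> sets (borel :: 's measure)"
    using coded_eq_measurable[OF coded_borel, of "\<lambda>x. x" "borel :: 's measure" "\<lambda>_. b"] by simp
  interpret R: prob_space "return borel b" by (rule prob_space_return) simp
  interpret C: prob_space "completion (return borel b)" by (rule R.prob_space_completion)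
  have "UNIV - {b} \<in> null_sets (return borel b)"
    using b sets.compl_sets[OF b] by (intro null_setsI) auto
  then have "S - {b} \<in> sets (completion (return borel b))"
    by (intro sets_completionI[of _ "{}" "S - {b}" "UNIV - {b}"]) auto
  then have "{b} \<union> (S - {b}) \<in> sets (completion (return borel b))" using b by (intro sets.Un) auto
  moreover have "{b} \<union> (S - {b}) = S" using assms by auto
  ultimately have S: "S \<in> sets (completion (return borel b))" by simp
  have "1 = emeasure (completion (return borel b)) {b}" using b by simp
  also have "\<dots> \<le> emeasure (completion (return borel b)) S" by (rule emeasure_mono) (use assms S in auto)
  finally show ?thesis using C.emeasure_le_1[of S] by (intro antisym) auto
qed

definition markov_policy :: "(nat \<Rightarrow> 'x \<Rightarrow> 'a::topological_space) \<Rightarrow> ('x, 'a) policy" where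
  "markov_policy \<phi> = (\<lambda>k s. return borel (\<phi> k (snd s)))"

lemma markov_policy:
  fixes A :: "'x::borel_space \<Rightarrow> 'a::borel_space set"
  assumes \<phi>: "\<And>k. \<phi> k \<in> universal borel \<rightarrow>\<^sub>M borel" and A: "\<And>k y. \<phi> k y \<in> A y"
  shows "markov_policy \<phi> \<in> policies A" "nonrandomized A (markov_policy \<phi>)" "Markov (markov_policy \<phi>)"
proof -
  have "markov_policy \<phi> k \<in> universal (hist k) \<rightarrow>\<^sub>M prob_algebra borel" for k
  proof -
    have "snd \<in> universal (hist k) \<rightarrow>\<^sub>M universal (borel :: 'x measure)"
      by (rule measurable_universal_universal[OF measurable_universal_mono[OF measurable_hist_snd]])
         (rule space_hist_nonempty)+
    from measurable_compose[OF measurable_compose[OF this \<phi>] measurable_return_prob_space]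
    show ?thesis by (simp add: markov_policy_def)
  qed
  then show "markov_policy \<phi> \<in> policies A"
    using A unfolding policies_def by (auto simp: markov_policy_def emeasure_completion_return)
  show "nonrandomized A (markov_policy \<phi>)"
    using A unfolding nonrandomized_def by (auto simp: markov_policy_def)
  show "Markov (markov_policy \<phi>)"
    unfolding Markov_def by (intro exI[of _ "\<lambda>k y. return borel (\<phi> k y)"]) (auto simp: markov_policy_def)
qed

lemma stationary_markov_policy: "stationary (markov_policy (\<lambda>k. \<phi>))"
  unfolding stationary_def by (intro exI[of _ "\<lambda>y. return borel (\<phi> y)"]) (auto simp: markov_policy_def)

text \<open>The graph of a universally measurable map is universally measurable, by comparing codes,
  and each Dirac kernel of the policy charges its section fully.\<close>

lemma AE_markov_policy:
  fixes \<phi> :: "nat \<Rightarrow> 'x::borel_space \<Rightarrow> 'a::borel_space"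
  assumes q: "q \<in> borel \<rightarrow>\<^sub>M prob_algebra borel" and \<phi>: "\<And>k. \<phi> k \<in> universal borel \<rightarrow>\<^sub>M borel"
  shows "AE z in action_law q (markov_policy \<phi>) x k. snd z = \<phi> k (fst z)"
proof -
  have "markov_policy \<phi> \<in> policies (\<lambda>_. UNIV)" by (rule markov_policy(1)[OF \<phi>]) simp
  then interpret process q "markov_policy \<phi>" x by (rule process_policy[OF q])
  let ?S = "{z \<in> space (universal borel). snd z = \<phi> k (fst z)}"
  have "fst \<in> universal (borel :: ('x \<times> 'a) measure) \<rightarrow>\<^sub>M universal (borel :: 'x measure)"
    by (rule measurable_universal_universal[OF measurable_universal_mono[OF measurable_fst_borel]]) simp_all
  from measurable_compose[OF this \<phi>]
  have m: "(\<lambda>z. \<phi> k (fst z)) \<in> universal (borel :: ('x \<times> 'a) measure) \<rightarrow>\<^sub>M borel" .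
  have "?S \<in> sets (universal borel)"
    by (rule coded_eq_measurable[OF coded_borel measurable_universal_mono[OF measurable_snd_borel] m]) simp
  then have "AE z in action_law q (markov_policy \<phi>) x k. z \<in> ?S"
    by (rule AE_action_law) (auto simp: markov_policy_def emeasure_completion_return)
  then show ?thesis by eventually_elim simp
qed

subsection \<open>Lower semianalytic functions and selectors\<close>

text \<open>Strict sublevel sets commute with infima: an infimum is below \<open>r\<close> iff some
  member is. The sets for \<le> are countable intersections of strict ones, and conversely the
  strict ones are countable unions.\<close>

definition lsa :: "('x::borel_space \<Rightarrow> real) \<Rightarrow> bool" where
  "lsa f \<longleftrightarrow> (\<forall>r. analytic {x. f x < r})"

lemma lsaD: "lsa f \<Longrightarrow> analytic {x. f x < r}"
  by (simp add: lsa_def)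

lemma lsa_measurable: "lsa f \<Longrightarrow> f \<in> universal borel \<rightarrow>\<^sub>M borel"
  by (rule lsa_universal[OF coded_borel lsaD])

lemma lsa_const: "lsa (\<lambda>_ :: 'x::borel_space. r)"
proof -
  have "{x :: 'x::borel_space. r < s} \<in> sets borel" for s by (cases "r < s") auto
  then show ?thesis unfolding lsa_def by (intro allI analytic_borel[OF coded_borel])
qed

lemma lsa_diff_const:
  assumes "lsa f" shows "lsa (\<lambda>x. f x - r)"
proof -
  have "{x. f x - r < s} = {x. f x < s + r}" for s by auto
  then show ?thesis unfolding lsa_def using lsaD[OF assms] by simp
qed

text \<open>Being below \<open>r\<close> infinitely often gives only \<open>g \<le> r\<close>; the
  rational \<open>s\<close> strictly below \<open>r\<close> secures the strict inequality and keeps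
  the union countable.\<close>

lemma liminf_less_iff:
  fixes f :: "nat \<Rightarrow> real" and g :: real
  assumes "ereal g = liminf (\<lambda>n. ereal (f n))"
  shows "g < r \<longleftrightarrow> (\<exists>s::rat. of_rat s < r \<and> (\<forall>m. \<exists>n\<ge>m. f n < of_rat s))"
proof
  assume "g < r"
  then obtain s where s: "g < of_rat s" "of_rat s < r" using of_rat_dense by blast
  have "liminf (\<lambda>n. ereal (f n)) < ereal (of_rat s)" unfolding assms[symmetric] using s by simp
  then have "\<not> (\<forall>\<^sub>F n in sequentially. ereal (of_rat s) \<le> ereal (f n))"
    using Liminf_bounded[of "ereal (of_rat s)" "\<lambda>n. ereal (f n)" sequentially] by (auto simp: not_le)
  then have "\<forall>m. \<exists>n\<ge>m. f n < of_rat s"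
    unfolding eventually_sequentially by (auto simp: not_le)
  then show "\<exists>s::rat. of_rat s < r \<and> (\<forall>m. \<exists>n\<ge>m. f n < of_rat s)" using s by blast
next
  assume "\<exists>s::rat. of_rat s < r \<and> (\<forall>m. \<exists>n\<ge>m. f n < of_rat s)"
  then obtain s :: rat where s: "of_rat s < r" and fr: "\<forall>m. \<exists>n\<ge>m. f n < of_rat s" by blast
  have "ereal g \<le> ereal (of_rat s)"
  proof (rule ccontr)
    assume "\<not> ?thesis"
    then have "ereal (of_rat s) < liminf (\<lambda>n. ereal (f n))" using assms by simp
    then have "\<forall>\<^sub>F n in sequentially. ereal (of_rat s) < ereal (f n)" by (rule less_LiminfD)
    then show False using fr unfolding eventually_sequentially by (auto simp: not_le) (metis less_asym)
  qed
  then show "g < r" using s by simp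
qed

lemma lsa_liminf:
  assumes f: "\<And>n. lsa (f n)" and g: "\<And>x. ereal (g x) = liminf (\<lambda>n. ereal (f n x))"
  shows "lsa g"
  unfolding lsa_def
proof
  fix r
  have eq: "{x. g x < r} = (\<Union>s::rat. if of_rat s < r then (\<Inter>m. \<Union>n. if m \<le> n then {x. f n x < of_rat s} else {}) else {})"
    using liminf_less_iff[OF g] by (auto split: if_splits)
  have emp: "analytic ({} :: 'a set)" by (simp add: analytic_def)
  show "analytic {x. g x < r}"
    unfolding eq
  proof (rule analytic_UN_countable[OF coded_borel])
    fix s :: rat
    have "analytic (\<Inter>m. \<Union>n. if m \<le> n then {x. f n x < of_rat s} else {})"
      by (intro analytic_INT analytic_UN coded_borel) (simp add: emp lsaD[OF f])
    then show "analytic (if of_rat s < r then (\<Inter>m. \<Union>n. if m \<le> n then {x. f n x < of_rat s} else {}) else {})"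
      by (simp add: emp)
  qed
qed

text \<open>The set where \<open>G\<close> is below \<open>u\<close> need not be analytic, as
  \<open>u\<close> is only universally measurable. So one selector is taken for each constant level
  \<open>(j + 1) * \<delta>\<close>, and at \<open>x\<close> the one for the least such level above
  \<open>u x\<close> is used; that level exceeds \<open>u x\<close> by at most \<delta>.\<close>

lemma approximate_selector:
  fixes A :: "'x::borel_space \<Rightarrow> 'a::borel_space set"
  assumes G: "\<And>r. analytic {z\<in>graph A. G z < r}" and u: "u \<in> universal borel \<rightarrow>\<^sub>M borel"
    and ex: "\<And>x. \<exists>a\<in>A x. G (x, a) < u x" and \<delta>: "0 < (\<delta>::real)"
  shows "\<exists>\<phi>. \<phi> \<in> universal borel \<rightarrow>\<^sub>M borel \<and> (\<forall>x. \<phi> x \<in> A x \<and> G (x, \<phi> x) < u x + \<delta>)"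
proof -
  have "\<forall>j::int. \<exists>\<phi>\<in>universal borel \<rightarrow>\<^sub>M borel. \<forall>x a. (x, a) \<in> {z\<in>graph A. G z < (of_int j + 1) * \<delta>} \<longrightarrow>
      (x, \<phi> x) \<in> {z\<in>graph A. G z < (of_int j + 1) * \<delta>}"
    by (rule allI, rule jankov_von_neumann[OF G])
  from choice[OF this[unfolded Bex_def]]
  obtain \<phi> where sel': "\<forall>j::int. \<phi> j \<in> universal borel \<rightarrow>\<^sub>M borel \<and>
      (\<forall>x a. (x, a) \<in> {z\<in>graph A. G z < (of_int j + 1) * \<delta>} \<longrightarrow> (x, \<phi> j x) \<in> {z\<in>graph A. G z < (of_int j + 1) * \<delta>})"
    by (rule exE)
  have \<phi>: "\<And>j::int. \<phi> j \<in> universal borel \<rightarrow>\<^sub>M borel"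
    and sel: "\<And>j x a. (x, a) \<in> {z\<in>graph A. G z < (of_int j + 1) * \<delta>} \<Longrightarrow> (x, \<phi> j x) \<in> {z\<in>graph A. G z < (of_int j + 1) * \<delta>}"
    using sel' by blast+
  let ?j = "\<lambda>x. \<lfloor>u x / \<delta>\<rfloor>"
  have jm: "?j \<in> universal borel \<rightarrow>\<^sub>M count_space UNIV"
    by (rule measurable_compose[OF u]) measurable
  have "(\<lambda>x. \<phi> (?j x) x) \<in> universal borel \<rightarrow>\<^sub>M borel"
    by (rule measurable_compose_countable[where f=\<phi>, OF \<phi> jm])
  moreover have "\<phi> (?j x) x \<in> A x \<and> G (x, \<phi> (?j x) x) < u x + \<delta>" for x
  proof -
    have 1: "u x < (of_int (?j x) + 1) * \<delta>"
      using real_of_int_floor_add_one_gt[of "u x / \<delta>"] \<delta> by (simp add: field_simps)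
    have 2: "of_int (?j x) * \<delta> \<le> u x"
      by (rule pos_le_divide_eq[OF \<delta>, THEN iffD1, OF of_int_floor_le])
    obtain a where "a \<in> A x" "G (x, a) < u x" using ex by blast
    then have "(x, a) \<in> {z\<in>graph A. G z < (of_int (?j x) + 1) * \<delta>}" using 1 by (simp add: graph_def)
    from sel[OF this] have "\<phi> (?j x) x \<in> A x" "G (x, \<phi> (?j x) x) < (of_int (?j x) + 1) * \<delta>"
      by (simp_all add: graph_def)
    then show ?thesis using 2 by (simp add: distrib_right)
  qed
  ultimately show ?thesis by blast
qed

text \<open>Needed where integrability is still to be proved, namely for the drift of the weight
  along the process.\<close>

lemma (in universal_kernel) nn_integral_bind_universal:
  fixes f :: "'r \<Rightarrow> real"
  assumes p: "prob_space p" "sets p = sets M" and f: "f \<in> universal N \<rightarrow>\<^sub>M borel"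
  shows "(\<integral>\<^sup>+ y. ennreal (f y) \<partial>(completion p \<bind> K)) = (\<integral>\<^sup>+ x. \<integral>\<^sup>+ y. ennreal (f y) \<partial>K x \<partial>completion p)"
proof -
  obtain g where g: "g \<in> borel_measurable N" and ae1: "AE y in completion p \<bind> K. f y = g y"
     and ae2: "AE x in completion p. AE y in K x. f y = g y"
    using version_bind[OF p f] .
  have "(\<integral>\<^sup>+ y. ennreal (f y) \<partial>(completion p \<bind> K)) = (\<integral>\<^sup>+ y. ennreal (g y) \<partial>(completion p \<bind> K))"
    by (rule nn_integral_cong_AE) (use ae1 in \<open>eventually_elim, simp\<close>)
  also have "\<dots> = (\<integral>\<^sup>+ x. \<integral>\<^sup>+ y. ennreal (g y) \<partial>K x \<partial>completion p)"
    by (rule nn_integral_bind[OF _ kernel_completion_subprob[OF p]]) (use g in measurable)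
  also have "\<dots> = (\<integral>\<^sup>+ x. \<integral>\<^sup>+ y. ennreal (f y) \<partial>K x \<partial>completion p)"
  proof (rule nn_integral_cong_AE, use ae2 in eventually_elim)
    fix x assume "AE y in K x. f y = g y"
    then show "(\<integral>\<^sup>+ y. ennreal (g y) \<partial>K x) = (\<integral>\<^sup>+ y. ennreal (f y) \<partial>K x)"
      by (intro nn_integral_cong_AE) (elim eventually_mono, simp)
  qed
  finally show ?thesis .
qed

subsection \<open>The discounted problem\<close>

locale mdp_UC =
  fixes A :: "'x::borel_space \<Rightarrow> 'a::borel_space set"
    and c :: "'x \<times> 'a \<Rightarrow> ereal"
    and q :: "'x \<times> 'a \<Rightarrow> 'x measure"
    and w :: "'x \<Rightarrow> real" and b C l :: real
  assumes mdp: "borel_mdp A c q"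
    and w_measurable: "w \<in> universal borel \<rightarrow>\<^sub>M borel" and w_ge_1: "\<And>x. 1 \<le> w x"
    and b: "0 \<le> b" and C: "0 \<le> C" and l: "0 \<le> l" "l < 1"
    and c_bound: "\<And>x. (SUP a\<in>A x. \<bar>c (x, a)\<bar>) \<le> ereal (C * w x)"
    and w_bound: "\<And>x. (SUP a\<in>A x. eint (q (x, a)) (\<lambda>y. ereal (w y))) \<le> ereal (l * w x + b)"
begin

lemma A_ne: "A x \<noteq> {}" and graph_analytic: "analytic (graph A)"
  and c_lsa: "analytic {z\<in>graph A. c z \<le> ereal r}" and q_kernel: "q \<in> borel \<rightarrow>\<^sub>M prob_algebra borel"
  using mdp unfolding borel_mdp_def lower_semianalytic_on_def by auto

lemma w_pos: "0 < w x" and w_nonneg: "0 \<le> w x"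
  using w_ge_1[of x] by auto

lemma graph_universal: "graph A \<in> sets (universal borel)"
  by (rule analytic_universal[OF coded_prod graph_analytic])

lemma q_prob: "prob_space (q z)" and q_sets: "sets (q z) = sets borel"
  using measurable_space[OF q_kernel, of z] by (auto simp: space_prob_algebra)

lemma q_measurable: "f \<in> universal borel \<rightarrow>\<^sub>M N \<Longrightarrow> f \<in> completion (q z) \<rightarrow>\<^sub>M N"
  by (rule measurable_universalD[OF _ q_prob q_sets])

text \<open>The weight bound makes the cost finite on the graph, so nothing is lost there. The value
  0 elsewhere keeps the function universally measurable.\<close>

definition cr :: "'x \<times> 'a \<Rightarrow> real" where
  "cr z = (if z \<in> graph A then real_of_ereal (c z) else 0)"

lemma c_cr: "z \<in> graph A \<Longrightarrow> c z = ereal (cr z)"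
  and cr_bound: "z \<in> graph A \<Longrightarrow> \<bar>cr z\<bar> \<le> C * w (fst z)"
proof -
  assume z: "z \<in> graph A"
  then have "\<bar>c z\<bar> \<le> (SUP a\<in>A (fst z). \<bar>c (fst z, a)\<bar>)"
    by (intro SUP_upper2[of "snd z"]) (auto simp: graph_def)
  also note c_bound
  finally have *: "\<bar>c z\<bar> \<le> ereal (C * w (fst z))" .
  then show "c z = ereal (cr z)" using z unfolding cr_def by (cases "c z") auto
  with * show "\<bar>cr z\<bar> \<le> C * w (fst z)" by simp
qed

lemma cr_less_analytic: "analytic {z\<in>graph A. cr z < r}"
proof -
  have eq: "{z\<in>graph A. cr z < r} = (\<Union>s::rat. if of_rat s < r then {z\<in>graph A. c z \<le> ereal (of_rat s)} else {})"
  proof (intro set_eqI iffI)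
    fix z assume z: "z \<in> {z\<in>graph A. cr z < r}"
    then obtain s where "cr z < of_rat s" "of_rat s < r" using of_rat_dense by blast
    then show "z \<in> (\<Union>s::rat. if of_rat s < r then {z\<in>graph A. c z \<le> ereal (of_rat s)} else {})"
      using z c_cr[of z] by (auto intro!: exI[of _ s])
  next
    fix z assume "z \<in> (\<Union>s::rat. if of_rat s < r then {z\<in>graph A. c z \<le> ereal (of_rat s)} else {})"
    then show "z \<in> {z\<in>graph A. cr z < r}" using c_cr[of z] by (auto split: if_splits)
  qed
  show ?thesis unfolding eq
    by (rule analytic_UN_countable[OF coded_prod]) (simp add: c_lsa, simp add: analytic_def)
qed

lemma cr_measurable: "cr \<in> universal borel \<rightarrow>\<^sub>M borel"
  unfolding borel_measurable_iff_less
proof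
  fix r
  have "{z\<in>graph A. cr z < r} \<in> sets (universal borel)"
    by (rule analytic_universal[OF coded_prod cr_less_analytic])
  moreover have "space (universal borel) - graph A \<in> sets (universal (borel :: ('x \<times> 'a) measure))"
    by (rule sets.compl_sets[OF graph_universal])
  moreover have "{z\<in>space (universal borel). cr z < r} =
      {z\<in>graph A. cr z < r} \<union> (if 0 < r then space (universal borel) - graph A else {})"
    by (auto simp: cr_def)
  ultimately show "{z\<in>space (universal borel). cr z < r} \<in> sets (universal borel)" by auto
qed

lemma w_nn: "z \<in> graph A \<Longrightarrow> (\<integral>\<^sup>+ y. ennreal (w y) \<partial>q z) \<le> ennreal (l * w (fst z) + b)"
proof -
  assume z: "z \<in> graph A"
  then have "eint (q z) (\<lambda>y. ereal (w y)) \<le> (SUP a\<in>A (fst z). eint (q (fst z, a)) (\<lambda>y. ereal (w y)))"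
    by (intro SUP_upper2[of "snd z"]) (auto simp: graph_def)
  also note w_bound
  finally have fin: "eint (q z) (\<lambda>y. ereal (w y)) \<le> ereal (l * w (fst z) + b)" .
  have eqw: "eint (q z) (\<lambda>y. ereal (w y)) = enn2ereal (\<integral>\<^sup>+ y. ennreal (w y) \<partial>q z)"
  proof -
    have "ennreal (- w y) = 0" for y using w_nonneg[of y] by (intro ennreal_neg) simp
    then show ?thesis unfolding eint_def by (simp add: nn_integral_completion zero_ennreal.rep_eq)
  qed
  have "enn2ereal (\<integral>\<^sup>+ y. ennreal (w y) \<partial>q z) \<le> enn2ereal (ennreal (l * w (fst z) + b))"
  proof -
    have "enn2ereal (ennreal (l * w (fst z) + b)) = ereal (l * w (fst z) + b)"
      by (rule enn2ereal_ennreal) (use l(1) w_nonneg[of "fst z"] b in simp)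
    then show ?thesis using fin eqw by simp
  qed
  then show ?thesis by (simp add: less_eq_ennreal.rep_eq)
qed

abbreviation I :: "'x \<times> 'a \<Rightarrow> ('x \<Rightarrow> real) \<Rightarrow> real" where
  "I z f \<equiv> integral\<^sup>L (completion (q z)) f"

lemma w_integrable: "z \<in> graph A \<Longrightarrow> integrable (completion (q z)) w"
  and w_integral: "z \<in> graph A \<Longrightarrow> I z w \<le> l * w (fst z) + b"
proof -
  assume z: "z \<in> graph A"
  have le: "(\<integral>\<^sup>+ y. ennreal (w y) \<partial>completion (q z)) \<le> ennreal (l * w (fst z) + b)"
    unfolding nn_integral_completion by (rule w_nn[OF z])
  have m: "w \<in> borel_measurable (completion (q z))" by (rule q_measurable[OF w_measurable])
  show "integrable (completion (q z)) w"
    by (rule integrableI_nonneg[OF m]) (use w_nonneg le in \<open>auto intro: le_less_trans\<close>)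
  have "I z w = enn2real (\<integral>\<^sup>+ y. ennreal (w y) \<partial>completion (q z))"
    by (rule integral_eq_nn_integral[OF m]) (use w_nonneg in auto)
  also have "\<dots> \<le> enn2real (ennreal (l * w (fst z) + b))"
    by (rule enn2real_mono[OF le]) simp
  also have "\<dots> = l * w (fst z) + b"
    by (rule enn2real_ennreal) (use l(1) w_nonneg[of "fst z"] b in simp)
  finally show "I z w \<le> l * w (fst z) + b" .
qed

definition bounded_lsa :: "real \<Rightarrow> ('x \<Rightarrow> real) \<Rightarrow> bool" where
  "bounded_lsa K f \<longleftrightarrow> lsa f \<and> 0 \<le> K \<and> (\<forall>x. \<bar>f x\<bar> \<le> K * w x)"

lemma integrable_bounded:
  assumes z: "z \<in> graph A" and f: "f \<in> universal borel \<rightarrow>\<^sub>M borel" and bd: "\<And>x. \<bar>f x\<bar> \<le> K * w x"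
  shows "integrable (completion (q z)) f"
  by (rule Bochner_Integration.integrable_bound[OF integrable_mult_right[OF w_integrable[OF z], of K] q_measurable[OF f]])
     (use bd in \<open>auto intro: order_trans[OF _ abs_ge_self]\<close>)

lemma bounded_lsa_integrable: "z \<in> graph A \<Longrightarrow> bounded_lsa K f \<Longrightarrow> integrable (completion (q z)) f"
  by (rule integrable_bounded[of _ _ K]) (auto simp: bounded_lsa_def lsa_measurable)

lemma integral_bound:
  assumes z: "z \<in> graph A" and f: "integrable (completion (q z)) f" and bd: "\<And>x. \<bar>f x\<bar> \<le> K * w x" and K: "0 \<le> K"
  shows "\<bar>I z f\<bar> \<le> K * (l * w (fst z) + b)"
proof -
  have "\<bar>I z f\<bar> \<le> I z (\<lambda>x. K * w x)"
    using f w_integrable[OF z] bd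
    by (intro order_trans[OF integral_abs_bound] integral_mono) auto
  also have "\<dots> = K * I z w" by simp
  also have "\<dots> \<le> K * (l * w (fst z) + b)" by (rule mult_left_mono[OF w_integral[OF z] K])
  finally show ?thesis .
qed

definition Q :: "real \<Rightarrow> ('x \<Rightarrow> real) \<Rightarrow> 'x \<times> 'a \<Rightarrow> real" where
  "Q \<alpha> v z = cr z + \<alpha> * I z v"

lemma Q_less_analytic:
  assumes \<alpha>: "0 < \<alpha>" and v: "bounded_lsa K v"
  shows "analytic {z\<in>graph A. Q \<alpha> v z < r}"
proof -
  have eq: "{z\<in>graph A. Q \<alpha> v z < r} = (\<Union>s::rat. {z\<in>graph A. cr z < of_rat s} \<inter> {z\<in>graph A. I z v < (r - of_rat s) / \<alpha>})"
  proof (intro set_eqI iffI)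
    fix z assume z: "z \<in> {z\<in>graph A. Q \<alpha> v z < r}"
    then have "cr z < r - \<alpha> * I z v" by (simp add: Q_def)
    then obtain s where s: "cr z < of_rat s" "of_rat s < r - \<alpha> * I z v" using of_rat_dense by blast
    then have "I z v < (r - of_rat s) / \<alpha>" using \<alpha> by (simp add: field_simps)
    then show "z \<in> (\<Union>s::rat. {z\<in>graph A. cr z < of_rat s} \<inter> {z\<in>graph A. I z v < (r - of_rat s) / \<alpha>})"
      using z s by blast
  next
    fix z assume "z \<in> (\<Union>s::rat. {z\<in>graph A. cr z < of_rat s} \<inter> {z\<in>graph A. I z v < (r - of_rat s) / \<alpha>})"
    then obtain s :: rat where s: "z \<in> graph A" "cr z < of_rat s" "I z v < (r - of_rat s) / \<alpha>" by blast
    then have "\<alpha> * I z v < r - of_rat s" using \<alpha> by (simp add: field_simps)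
    then show "z \<in> {z\<in>graph A. Q \<alpha> v z < r}" using s by (simp add: Q_def)
  qed
  have "analytic {z\<in>graph A. I z v < s}" for s
    by (rule analytic_integral_less[OF coded_prod _ q_kernel graph_analytic bounded_lsa_integrable[OF _ v]])
       (use v in \<open>simp_all add: bounded_lsa_def lsa_def\<close>)
  then show ?thesis unfolding eq
    by (intro analytic_UN_countable[OF coded_prod] analytic_Int[OF coded_prod] cr_less_analytic)
qed

lemma Q_bound:
  assumes z: "z \<in> graph A" and \<alpha>: "0 \<le> \<alpha>" "\<alpha> \<le> 1" and v: "bounded_lsa K v"
  shows "\<bar>Q \<alpha> v z\<bar> \<le> (C + K * (l + b)) * w (fst z)"
proof -
  have K: "0 \<le> K" "\<And>x. \<bar>v x\<bar> \<le> K * w x" using v by (auto simp: bounded_lsa_def)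
  have "\<bar>I z v\<bar> \<le> K * (l * w (fst z) + b)"
    by (rule integral_bound[OF z bounded_lsa_integrable[OF z v] K(2,1)])
  also have "\<dots> \<le> K * (l * w (fst z) + b * w (fst z))"
    using b w_ge_1[of "fst z"] K(1) by (intro mult_left_mono add_left_mono) (simp_all add: mult_le_cancel_left1)
  finally have 1: "\<bar>I z v\<bar> \<le> K * (l + b) * w (fst z)" by (simp add: algebra_simps)
  have "\<bar>\<alpha> * I z v\<bar> \<le> 1 * \<bar>I z v\<bar>"
    unfolding abs_mult using \<alpha> by (intro mult_right_mono) auto
  then have "\<bar>Q \<alpha> v z\<bar> \<le> C * w (fst z) + K * (l + b) * w (fst z)"
    unfolding Q_def using cr_bound[OF z] 1 by linarith
  then show ?thesis by (simp add: algebra_simps)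
qed

section \<open>The discounted Bellman operator and its fixed point\<close>

definition T :: "real \<Rightarrow> ('x \<Rightarrow> real) \<Rightarrow> 'x \<Rightarrow> real" where
  "T \<alpha> v x = (INF a\<in>A x. Q \<alpha> v (x, a))"

context
  fixes \<alpha> :: real assumes \<alpha>: "0 < \<alpha>" "\<alpha> < 1"
begin

lemma T_bdd:
  assumes v: "bounded_lsa K v"
  shows "bdd_below ((\<lambda>a. Q \<alpha> v (x, a)) ` A x)"
proof (rule bdd_belowI2)
  fix a assume "a \<in> A x"
  then show "- ((C + K * (l + b)) * w x) \<le> Q \<alpha> v (x, a)"
    using Q_bound[of "(x, a)" \<alpha>, OF _ _ _ v] \<alpha> by (simp add: graph_def abs_le_iff)
qed

lemma T_le: "bounded_lsa K v \<Longrightarrow> a \<in> A x \<Longrightarrow> T \<alpha> v x \<le> Q \<alpha> v (x, a)"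
  unfolding T_def by (rule cINF_lower[OF T_bdd])

lemma T_ge: "(\<And>a. a \<in> A x \<Longrightarrow> m \<le> Q \<alpha> v (x, a)) \<Longrightarrow> m \<le> T \<alpha> v x"
  unfolding T_def by (rule cINF_greatest[OF A_ne])

lemma T_less_iff: "bounded_lsa K v \<Longrightarrow> T \<alpha> v x < r \<longleftrightarrow> (\<exists>a\<in>A x. Q \<alpha> v (x, a) < r)"
  unfolding T_def by (rule cINF_less_iff[OF A_ne T_bdd])

text \<open>The strict sublevel set of an infimum over actions is the projection of that of
  \<open>Q\<close>. Projections of Borel sets may fail to be Borel, whereas analytic sets are closed
  under projection.\<close>

lemma bounded_lsa_T:
  assumes v: "bounded_lsa K v"
  shows "bounded_lsa (C + K * (l + b)) (T \<alpha> v)"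
  unfolding bounded_lsa_def
proof (intro conjI allI)
  show "lsa (T \<alpha> v)"
    unfolding lsa_def
  proof
    fix r
    have "{x. T \<alpha> v x < r} = fst ` {z\<in>graph A. Q \<alpha> v z < r}"
      unfolding T_less_iff[OF v] by (force simp: graph_def)
    then show "analytic {x. T \<alpha> v x < r}"
      using analytic_image[OF Q_less_analytic[OF \<alpha>(1) v] measurable_fst_borel] by simp
  qed
  show "0 \<le> C + K * (l + b)" using C l b v by (auto simp: bounded_lsa_def)
  fix x
  have Qb: "\<bar>Q \<alpha> v (x, a)\<bar> \<le> (C + K * (l + b)) * w x" if "a \<in> A x" for a
    using Q_bound[of "(x, a)" \<alpha>, OF _ _ _ v] \<alpha> that by (simp add: graph_def)
  obtain a where a: "a \<in> A x" using A_ne by blast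
  have "T \<alpha> v x \<le> (C + K * (l + b)) * w x"
    using T_le[OF v a] Qb[OF a] by linarith
  moreover have "- ((C + K * (l + b)) * w x) \<le> T \<alpha> v x"
    by (rule T_ge) (use Qb in \<open>force simp: abs_le_iff\<close>)
  ultimately show "\<bar>T \<alpha> v x\<bar> \<le> (C + K * (l + b)) * w x" by linarith
qed

text \<open>
  The constants satisfy \<open>\<alpha> * b = (\<gamma> - \<alpha>) * \<kappa>\<close>, which absorbs the drift constant \<open>b\<close> of the weight \<open>w\<close>.
\<close>

definition \<kappa> where "\<kappa> = 2 * \<alpha> * b / (1 - \<alpha>)"
definition \<gamma> where "\<gamma> = (1 + \<alpha>) / 2"

lemma \<kappa>_nonneg: "0 \<le> \<kappa>" and \<gamma>: "0 < \<gamma>" "\<gamma> < 1"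
  using \<alpha> b by (auto simp: \<kappa>_def \<gamma>_def)

lemma weight_drift: "\<alpha> * (l * w x + b + \<kappa>) \<le> \<gamma> * (w x + \<kappa>)"
proof -
  have "\<alpha> * b = (\<gamma> - \<alpha>) * \<kappa>" using \<alpha> by (simp add: \<kappa>_def \<gamma>_def field_simps)
  moreover have "\<alpha> * (l * w x) \<le> \<gamma> * w x"
  proof -
    have "\<alpha> * l \<le> \<gamma> * 1" using \<alpha> l by (intro mult_mono) (auto simp: \<gamma>_def)
    then show ?thesis using mult_right_mono[OF _ w_nonneg[of x], of "\<alpha> * l" \<gamma>] by (simp add: mult.assoc)
  qed
  ultimately show ?thesis by (simp add: algebra_simps)
qed

text \<open>The infima are compared action by action. Integrating the bound on \<open>v - u\<close>
  against \<open>q\<close> produces the integral of \<open>w + \<kappa>\<close>, which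
  \<open>weight_drift\<close> turns back into a multiple of \<open>w + \<kappa>\<close>.\<close>

lemma T_contraction:
  assumes v: "bounded_lsa K v" and u: "bounded_lsa K' u" and \<delta>: "0 \<le> \<delta>"
    and close: "\<And>y. \<bar>v y - u y\<bar> \<le> \<delta> * (w y + \<kappa>)"
  shows "\<bar>T \<alpha> v x - T \<alpha> u x\<bar> \<le> \<gamma> * \<delta> * (w x + \<kappa>)"
proof -
  have main: "T \<alpha> v1 x \<le> T \<alpha> v2 x + \<gamma> * \<delta> * (w x + \<kappa>)"
    if v1: "bounded_lsa K1 v1" and v2: "bounded_lsa K2 v2" and cl: "\<And>y. v1 y - v2 y \<le> \<delta> * (w y + \<kappa>)" for v1 v2 K1 K2
  proof -
    have "T \<alpha> v1 x - \<gamma> * \<delta> * (w x + \<kappa>) \<le> T \<alpha> v2 x"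
    proof (rule T_ge)
      fix a assume a: "a \<in> A x"
      then have z: "(x, a) \<in> graph A" by (simp add: graph_def)
      interpret cp: prob_space "completion (q (x, a))" by (rule prob_space.prob_space_completion[OF q_prob])
      have i: "integrable (completion (q (x, a))) v1" "integrable (completion (q (x, a))) v2"
        "integrable (completion (q (x, a))) w"
        using bounded_lsa_integrable[OF z v1] bounded_lsa_integrable[OF z v2] w_integrable[OF z] by auto
      have "I (x, a) v1 - I (x, a) v2 = I (x, a) (\<lambda>y. v1 y - v2 y)" using i by simp
      also have "\<dots> \<le> I (x, a) (\<lambda>y. \<delta> * (w y + \<kappa>))" by (rule integral_mono) (use i cl in auto)
      also have "\<dots> = \<delta> * (I (x, a) w + \<kappa>)" using i cp.prob_space by simp
      also have "\<dots> \<le> \<delta> * (l * w x + b + \<kappa>)"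
        using w_integral[OF z] \<delta> by (intro mult_left_mono) auto
      finally have "\<alpha> * (I (x, a) v1 - I (x, a) v2) \<le> \<alpha> * (\<delta> * (l * w x + b + \<kappa>))"
        using \<alpha> by (intro mult_left_mono) auto
      also have "\<dots> = \<delta> * (\<alpha> * (l * w x + b + \<kappa>))" by simp
      also have "\<dots> \<le> \<delta> * (\<gamma> * (w x + \<kappa>))" by (rule mult_left_mono[OF weight_drift \<delta>])
      finally have "Q \<alpha> v1 (x, a) \<le> Q \<alpha> v2 (x, a) + \<gamma> * \<delta> * (w x + \<kappa>)"
        unfolding Q_def by (simp add: algebra_simps)
      then show "T \<alpha> v1 x - \<gamma> * \<delta> * (w x + \<kappa>) \<le> Q \<alpha> v2 (x, a)"
        using T_le[OF v1 a] by linarith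
    qed
    then show ?thesis by linarith
  qed
  have "v y - u y \<le> \<delta> * (w y + \<kappa>)" "u y - v y \<le> \<delta> * (w y + \<kappa>)" for y
    using close[of y] by linarith+
  from main[OF v u this(1)] main[OF u v this(2)] show ?thesis by linarith
qed

definition V :: "nat \<Rightarrow> 'x \<Rightarrow> real" where "V n = (T \<alpha> ^^ n) (\<lambda>_. 0)"

lemma V_simps: "V 0 = (\<lambda>_. 0)" "V (Suc n) = T \<alpha> (V n)"
  by (simp_all add: V_def)

lemma V_bounded_lsa: "\<exists>K. bounded_lsa K (V n)"
proof (induction n)
  case 0
  show ?case unfolding V_simps bounded_lsa_def by (intro exI[of _ 0]) (simp add: lsa_const)
next
  case (Suc n)
  then show ?case unfolding V_simps using bounded_lsa_T by blast
qed

lemma V_diff: "\<bar>V (Suc n) x - V n x\<bar> \<le> \<gamma> ^ n * C * (w x + \<kappa>)"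
proof (induction n arbitrary: x)
  case 0
  have b0: "bounded_lsa 0 (\<lambda>_::'x. 0)" unfolding bounded_lsa_def by (simp add: lsa_const)
  from bounded_lsa_T[OF b0] have "\<bar>V (Suc 0) x\<bar> \<le> C * w x"
    unfolding V_simps by (simp add: bounded_lsa_def)
  also have "\<dots> \<le> C * (w x + \<kappa>)" using C \<kappa>_nonneg by (intro mult_left_mono) auto
  finally show ?case by (simp add: V_simps(1))
next
  case (Suc n)
  obtain K K' where K: "bounded_lsa K (V (Suc n))" "bounded_lsa K' (V n)" using V_bounded_lsa by blast
  have "\<bar>T \<alpha> (V (Suc n)) x - T \<alpha> (V n) x\<bar> \<le> \<gamma> * (\<gamma> ^ n * C) * (w x + \<kappa>)"
    by (rule T_contraction[OF K _ Suc]) (use C \<gamma> in auto)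
  then show ?case by (simp add: V_simps(2)[of "Suc n"] V_simps(2)[of n] mult.assoc)
qed

text \<open>Value iteration from 0. The limit is again lower semianalytic because it is a liminf,
  and the geometric error bound, uniform in the weight \<open>w + \<kappa>\<close>, lets
  \<open>T\<close> pass to the limit by the contraction estimate.\<close>

lemma fixed_point: "\<exists>v K. bounded_lsa K v \<and> (\<forall>x. T \<alpha> v x = v x)"
proof -
  define v where "v x = lim (\<lambda>n. V n x)" for x
  have sg: "summable (\<lambda>n. \<gamma> ^ n * (C * (w x + \<kappa>)))" for x
    using \<gamma> by (intro summable_mult2 summable_geometric) simp
  have sD: "summable (\<lambda>n. V (Suc n) x - V n x)" for x
    by (rule summable_comparison_test'[OF sg[of x], of 0]) (use V_diff in \<open>simp add: mult.assoc\<close>)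
  have lim: "(\<lambda>n. V n x) \<longlonglongrightarrow> v x" for x
  proof -
    have "(\<Sum>k<n. V (Suc k) x - V k x) = V n x" for n
      using sum_lessThan_telescope[of "\<lambda>k. V k x" n] by (simp add: V_simps(1))
    with summable_LIMSEQ[OF sD[of x]] have "convergent (\<lambda>n. V n x)" by (auto simp: convergent_def)
    then show ?thesis unfolding v_def by (simp add: convergent_LIMSEQ_iff)
  qed
  have tail: "\<bar>V m x - V n x\<bar> \<le> \<gamma> ^ n * (C / (1 - \<gamma>)) * (w x + \<kappa>)" if "n \<le> m" for m n x
  proof -
    have "\<bar>V m x - V n x\<bar> \<le> (\<Sum>k=n..<m. \<gamma> ^ k * C * (w x + \<kappa>))"
      using that
    proof (induction rule: dec_induct)
      case (step m)
      then show ?case using V_diff[of m x] by simp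
    qed simp
    also have "\<dots> = (\<Sum>k=n..<m. \<gamma> ^ k) * (C * (w x + \<kappa>))" by (simp add: sum_distrib_right mult.assoc)
    also have "(\<Sum>k=n..<m. \<gamma> ^ k) = (\<gamma> ^ n - \<gamma> ^ m) / (1 - \<gamma>)"
      using sum_gp_multiplied[of n "m - 1" \<gamma>] that \<gamma>
      by (cases "n = m") (auto simp: field_simps sum_gp atLeastLessThanSuc_atLeastAtMost[symmetric] Suc_diff_Suc)
    also have "\<dots> * (C * (w x + \<kappa>)) \<le> (\<gamma> ^ n / (1 - \<gamma>)) * (C * (w x + \<kappa>))"
      using \<gamma> C w_nonneg[of x] \<kappa>_nonneg by (intro mult_right_mono divide_right_mono) auto
    also have "\<dots> = \<gamma> ^ n * (C / (1 - \<gamma>)) * (w x + \<kappa>)" by simp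
    finally show ?thesis .
  qed
  have vV: "\<bar>v x - V n x\<bar> \<le> \<gamma> ^ n * (C / (1 - \<gamma>)) * (w x + \<kappa>)" for n x
  proof (rule LIMSEQ_le_const2)
    show "(\<lambda>m. \<bar>V m x - V n x\<bar>) \<longlonglongrightarrow> \<bar>v x - V n x\<bar>"
      by (intro tendsto_intros lim)
    show "\<exists>N. \<forall>m\<ge>N. \<bar>V m x - V n x\<bar> \<le> \<gamma> ^ n * (C / (1 - \<gamma>)) * (w x + \<kappa>)"
      using tail by blast
  qed
  let ?K = "C / (1 - \<gamma>) * (1 + \<kappa>)"
  have v: "bounded_lsa ?K v"
    unfolding bounded_lsa_def
  proof (intro conjI allI)
    show "lsa v"
    proof (rule lsa_liminf)
      show "lsa (V n)" for n using V_bounded_lsa[of n] by (auto simp: bounded_lsa_def)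
      show "ereal (v x) = liminf (\<lambda>n. ereal (V n x))" for x
        using lim_imp_Liminf[of sequentially "\<lambda>n. ereal (V n x)" "ereal (v x)"] lim[of x] by simp
    qed
    show "0 \<le> ?K" using C \<gamma> \<kappa>_nonneg by auto
    fix x
    have "\<bar>v x\<bar> \<le> C / (1 - \<gamma>) * (w x + \<kappa>)" using vV[of x 0] by (simp add: V_simps(1))
    also have "\<dots> \<le> C / (1 - \<gamma>) * (w x + \<kappa> * w x)"
      using C \<gamma> \<kappa>_nonneg w_ge_1[of x] by (intro mult_left_mono add_left_mono) (simp_all add: mult_le_cancel_left1)
    also have "w x + \<kappa> * w x = (1 + \<kappa>) * w x" by (simp add: distrib_right)
    finally show "\<bar>v x\<bar> \<le> ?K * w x" by (simp add: mult.assoc)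
  qed
  have "T \<alpha> v x = v x" for x
  proof (rule LIMSEQ_unique)
    show "(\<lambda>n. V (Suc n) x) \<longlonglongrightarrow> v x" using lim by (rule LIMSEQ_Suc)
    have bd: "\<bar>V (Suc n) x - T \<alpha> v x\<bar> \<le> \<gamma> * (\<gamma> ^ n * (C / (1 - \<gamma>))) * (w x + \<kappa>)" for n
    proof -
      obtain K where "bounded_lsa K (V n)" using V_bounded_lsa by blast
      then show ?thesis unfolding V_simps(2)
        by (rule T_contraction[OF _ v]) (use vV C \<gamma> in \<open>auto simp: abs_minus_commute\<close>)
    qed
    have "(\<lambda>n. \<gamma> * (\<gamma> ^ n * (C / (1 - \<gamma>))) * (w x + \<kappa>)) \<longlonglongrightarrow> \<gamma> * (0 * (C / (1 - \<gamma>))) * (w x + \<kappa>)"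
      using \<gamma> by (intro tendsto_intros LIMSEQ_power_zero) auto
    then have z: "(\<lambda>n. \<gamma> * (\<gamma> ^ n * (C / (1 - \<gamma>))) * (w x + \<kappa>)) \<longlonglongrightarrow> 0" by simp
    have "(\<lambda>n. V (Suc n) x - T \<alpha> v x) \<longlonglongrightarrow> 0"
    proof (rule Lim_null_comparison[OF _ z])
      show "\<forall>\<^sub>F n in sequentially. norm (V (Suc n) x - T \<alpha> v x) \<le> \<gamma> * (\<gamma> ^ n * (C / (1 - \<gamma>))) * (w x + \<kappa>)"
        by (rule always_eventually) (unfold real_norm_def, rule allI, rule bd)
    qed
    then show "(\<lambda>n. V (Suc n) x) \<longlonglongrightarrow> T \<alpha> v x" by (simp add: LIM_zero_iff)
  qed
  with v show ?thesis by blast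
qed

end

end

subsection \<open>Costs of policies\<close>

lemma AE_return_eq: "AE y in return borel (x :: 'x::borel_space). y = x"
proof -
  have "Measurable.pred borel (\<lambda>y :: 'x. y = x)"
    using coded_eq_measurable[OF coded_borel, of "\<lambda>y. y" "borel :: 'x measure" "\<lambda>_. x"] by (simp add: pred_def)
  then show ?thesis by (subst AE_return) auto
qed

locale mdp_policy = mdp_UC A c q w b C l
  for A :: "'x::borel_space \<Rightarrow> 'a::borel_space set" and c q w b C l +
  fixes \<pi> :: "('x, 'a) policy" and x :: 'x
  assumes policy: "\<pi> \<in> policies A"
begin

sublocale P: process q \<pi> x by (rule process_policy[OF q_kernel policy])

abbreviation E :: "nat \<Rightarrow> ('x \<Rightarrow> real) \<Rightarrow> real" where
  "E k f \<equiv> integral\<^sup>L (completion (state_law q \<pi> x k)) f"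

abbreviation N :: "nat \<Rightarrow> ('x \<times> 'a) measure" where
  "N k \<equiv> completion (action_law q \<pi> x k)"

definition U :: "nat \<Rightarrow> real" where
  "U k = integral\<^sup>L (N k) cr"

text \<open>A bound preserved by the drift: \<open>l * W + b = l * w x + b / (1 - l)\<close>, which
  is at most \<open>W\<close>, and \<open>w x \<le> W\<close> holds at time 0.\<close>

definition W :: real where "W = w x + b / (1 - l)"

lemma AE_N: "AE z in N k. z \<in> graph A"
  unfolding AE_completion_iff by (rule P.AE_graph[OF policy graph_universal])

lemma state_measurable: "f \<in> universal borel \<rightarrow>\<^sub>M borel \<Longrightarrow> f \<in> borel_measurable (completion (state_law q \<pi> x k))"
  for f :: "'x \<Rightarrow> real"
  by (rule measurable_universalD[OF _ P.state_law_prob P.state_law_sets])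

lemma action_measurable: "f \<in> universal borel \<rightarrow>\<^sub>M borel \<Longrightarrow> f \<in> borel_measurable (N k)"
  for f :: "'x \<times> 'a \<Rightarrow> real"
  by (rule measurable_universalD[OF _ P.action_law_prob P.action_law_sets])

lemma fst_action: "fst \<in> action_law q \<pi> x k \<rightarrow>\<^sub>M borel"
  using measurable_fst_borel by (simp only: measurable_cong_sets[OF P.action_law_sets refl])

lemma integrable_fst: "f \<in> universal borel \<rightarrow>\<^sub>M borel \<Longrightarrow>
    integrable (completion (state_law q \<pi> x k)) f \<longleftrightarrow> integrable (N k) (\<lambda>z. f (fst z))"
  and integral_fst: "f \<in> universal borel \<rightarrow>\<^sub>M borel \<Longrightarrow> E k f = (\<integral>z. f (fst z) \<partial>N k)"
  for f :: "'x \<Rightarrow> real"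
  using completion_distr[OF P.action_law_prob fst_action, of f k] unfolding P.distr_action_law_fst by auto

lemma E_0:
  assumes "f \<in> universal borel \<rightarrow>\<^sub>M borel"
  shows "E 0 f = f x" and "integrable (completion (state_law q \<pi> x 0)) f"
proof -
  interpret C: prob_space "completion (state_law q \<pi> x 0)"
    by (rule prob_space.prob_space_completion[OF P.state_law_prob])
  have ae: "AE y in completion (state_law q \<pi> x 0). f y = f x"
    unfolding AE_completion_iff P.state_law_0 using AE_return_eq by (rule eventually_mono) simp
  have "E 0 f = E 0 (\<lambda>_. f x)" by (rule integral_cong_AE[OF state_measurable[OF assms] _ ae]) simp
  then show "E 0 f = f x" using C.prob_space by simp
  show "integrable (completion (state_law q \<pi> x 0)) f"
    using integrable_cong_AE[OF state_measurable[OF assms] _ ae] by simp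
qed

lemma w_state: "integrable (completion (state_law q \<pi> x k)) w \<and> E k w \<le> W"
proof (induction k)
  case 0
  have "0 \<le> b / (1 - l)" using b l by simp
  then show ?case using E_0[OF w_measurable] by (simp add: W_def)
next
  case (Suc k)
  let ?M = "completion (state_law q \<pi> x (Suc k))"
  have i: "integrable (N k) (\<lambda>z. w (fst z))" using Suc integrable_fst[OF w_measurable] by simp
  interpret C: prob_space "N k" by (rule prob_space.prob_space_completion[OF P.action_law_prob])
  have "(\<integral>\<^sup>+ y. ennreal (w y) \<partial>?M) = (\<integral>\<^sup>+ y. ennreal (w y) \<partial>state_law q \<pi> x (Suc k))"
    by (rule nn_integral_completion)
  also have "\<dots> = (\<integral>\<^sup>+ z. \<integral>\<^sup>+ y. ennreal (w y) \<partial>q z \<partial>N k)"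
    unfolding P.state_law_Suc
    by (rule P.trans.nn_integral_bind_universal[OF P.action_law_prob P.action_law_sets w_measurable])
  also have "\<dots> \<le> (\<integral>\<^sup>+ z. ennreal (l * w (fst z) + b) \<partial>N k)"
    by (rule nn_integral_mono_AE, rule eventually_mono[OF AE_N]) (rule w_nn)
  also have "\<dots> = ennreal (\<integral>z. l * w (fst z) + b \<partial>N k)"
    by (rule nn_integral_eq_integral) (use i l w_nonneg b in auto)
  also have "(\<integral>z. l * w (fst z) + b \<partial>N k) = l * E k w + b"
    using i C.prob_space by (simp add: integral_fst[OF w_measurable])
  finally have le: "(\<integral>\<^sup>+ y. ennreal (w y) \<partial>?M) \<le> ennreal (l * E k w + b)" .
  have E0: "0 \<le> E k w" by (rule integral_nonneg_AE) (simp add: w_nonneg)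
  have m: "w \<in> borel_measurable ?M" by (rule state_measurable[OF w_measurable])
  have "integrable ?M w"
    by (rule integrableI_nonneg[OF m]) (use w_nonneg le in \<open>auto intro: le_less_trans\<close>)
  moreover have "E (Suc k) w \<le> W"
  proof -
    have "E (Suc k) w = enn2real (\<integral>\<^sup>+ y. ennreal (w y) \<partial>?M)"
      by (rule integral_eq_nn_integral[OF m]) (use w_nonneg in auto)
    also have "\<dots> \<le> enn2real (ennreal (l * E k w + b))" by (rule enn2real_mono[OF le]) simp
    also have "\<dots> = l * E k w + b" by (rule enn2real_ennreal) (use l E0 b in simp)
    also have "\<dots> \<le> l * W + b" using Suc l by (simp add: mult_left_mono)
    also have "\<dots> = l * w x + b / (1 - l)" using l by (simp add: W_def field_simps)
    also have "\<dots> \<le> W" using l w_nonneg[of x] unfolding W_def by (simp add: mult_left_le_one_le)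
    finally show ?thesis .
  qed
  ultimately show ?case ..
qed

context
  fixes f :: "'x \<Rightarrow> real" and K :: real
  assumes f: "f \<in> universal borel \<rightarrow>\<^sub>M borel" and fK: "\<And>y. \<bar>f y\<bar> \<le> K * w y" and K: "0 \<le> K"
begin

lemma state_integrable: "integrable (completion (state_law q \<pi> x k)) f"
  by (rule Bochner_Integration.integrable_bound[OF integrable_mult_right[where c=K, OF conjunct1[OF w_state]] state_measurable[OF f]])
     (use fK in \<open>auto intro: order_trans[OF _ abs_ge_self]\<close>)

lemma state_integral_bound: "\<bar>E k f\<bar> \<le> K * W"
proof -
  have "\<bar>E k f\<bar> \<le> E k (\<lambda>y. K * w y)"
    using state_integrable w_state fK by (intro order_trans[OF integral_abs_bound] integral_mono) auto
  also have "\<dots> = K * E k w" by simp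
  also have "\<dots> \<le> K * W" using w_state K by (intro mult_left_mono) auto
  finally show ?thesis .
qed

lemma action_fst_integrable: "integrable (N k) (\<lambda>z. f (fst z))"
  using state_integrable integrable_fst[OF f] by simp

lemma action_I_integrable: "integrable (N k) (\<lambda>z. I z f)"
  and action_I_integral: "(\<integral>z. I z f \<partial>N k) = E (Suc k) f"
proof -
  have "integrable (completion (N k \<bind> q)) f" using state_integrable[of "Suc k"] by (simp only: P.state_law_Suc)
  note P.trans.integrable_integral_kernel[OF P.action_law_prob P.action_law_sets f this]
    P.trans.integral_bind_universal[OF P.action_law_prob P.action_law_sets f this]
  then show "integrable (N k) (\<lambda>z. I z f)" "(\<integral>z. I z f \<partial>N k) = E (Suc k) f"
    by (simp_all only: P.state_law_Suc)
qed

end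

lemma cr_integrable: "integrable (N k) cr"
proof -
  have w: "integrable (N k) (\<lambda>z. C * w (fst z))"
    using w_state integrable_fst[OF w_measurable] by simp
  show ?thesis
  proof (rule Bochner_Integration.integrable_bound[OF w action_measurable[OF cr_measurable]])
    show "AE z in N k. norm (cr z) \<le> norm (C * w (fst z))"
      by (rule eventually_mono[OF AE_N]) (use cr_bound in \<open>auto intro: order_trans[OF _ abs_ge_self]\<close>)
  qed
qed

lemma bounded_lsaD:
  assumes "bounded_lsa K h"
  shows "h \<in> universal borel \<rightarrow>\<^sub>M borel" "\<And>y. \<bar>h y\<bar> \<le> K * w y" "0 \<le> K"
  using assms by (auto simp: bounded_lsa_def lsa_measurable)

lemma Q_integral:
  assumes h: "bounded_lsa K h"
  shows "integrable (N k) (Q \<alpha> h)" "(\<integral>z. Q \<alpha> h z \<partial>N k) = U k + \<alpha> * E (Suc k) h"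
  using cr_integrable action_I_integrable[OF bounded_lsaD[OF h]] action_I_integral[OF bounded_lsaD[OF h]]
  unfolding Q_def[abs_def] U_def by simp_all

lemma step_le:
  assumes h: "bounded_lsa K h" and le: "AE z in N k. Q \<alpha> h z \<le> h (fst z) + d"
  shows "U k + \<alpha> * E (Suc k) h \<le> E k h + d"
proof -
  interpret C: prob_space "N k" by (rule prob_space.prob_space_completion[OF P.action_law_prob])
  note i = action_fst_integrable[OF bounded_lsaD[OF h]]
  have "(\<integral>z. Q \<alpha> h z \<partial>N k) \<le> (\<integral>z. h (fst z) + d \<partial>N k)"
    by (rule integral_mono_AE[OF Q_integral(1)[OF h] _ le]) (use i in simp)
  then show ?thesis
    using i C.prob_space by (simp add: Q_integral(2)[OF h] integral_fst[OF bounded_lsaD(1)[OF h]])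
qed

lemma step_ge:
  assumes h: "bounded_lsa K h" and ge: "\<And>z. z \<in> graph A \<Longrightarrow> h (fst z) \<le> Q \<alpha> h z"
  shows "E k h \<le> U k + \<alpha> * E (Suc k) h"
proof -
  have "(\<integral>z. h (fst z) \<partial>N k) \<le> (\<integral>z. Q \<alpha> h z \<partial>N k)"
    by (rule integral_mono_AE[OF action_fst_integrable[OF bounded_lsaD[OF h]] Q_integral(1)[OF h] eventually_mono[OF AE_N ge]])
  then show ?thesis
    by (simp add: Q_integral(2)[OF h] integral_fst[OF bounded_lsaD(1)[OF h]])
qed

section \<open>Discounted and average costs as series of marginal expectations\<close>

lemma eint_cost:
  "eint (traj_law q \<pi> x) (\<lambda>\<omega>. \<Sum>k<n. ereal (\<beta> k) * c (\<omega> k)) = ereal (\<Sum>k<n. \<beta> k * U k)"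
  unfolding U_def
proof (rule P.eint_traj_sum[OF cr_measurable _ cr_integrable])
  show "AE z in action_law q \<pi> x k. c z = ereal (cr z)" for k
    using AE_N[of k] unfolding AE_completion_iff by (rule eventually_mono) (rule c_cr)
qed

lemma J_fin_eq: "J_fin c q n \<pi> x = ereal (\<Sum>k<n. U k)"
  using eint_cost[where \<beta>="\<lambda>_. 1"] by (simp add: J_fin_def one_ereal_def[symmetric])

lemma J_avg_eq: "J_avg c q \<pi> x = limsup (\<lambda>n. ereal ((\<Sum>k<n. U k) / real n))"
  unfolding J_avg_def
proof (rule Limsup_eq)
  show "\<forall>\<^sub>F n in sequentially. J_fin c q n \<pi> x / ereal (real n) = ereal ((\<Sum>k<n. U k) / real n)"
    using eventually_gt_at_top[of 0] by eventually_elim (simp add: J_fin_eq)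
qed

lemma v_pol_eq: "v_pol c q \<alpha> \<pi> x = limsup (\<lambda>n. ereal (\<Sum>k<n. \<alpha> ^ k * U k))"
  by (simp add: v_pol_def eint_cost)

lemma discounted_ge:
  assumes h: "bounded_lsa K h" and ge: "\<And>z. z \<in> graph A \<Longrightarrow> h (fst z) \<le> Q \<alpha> h z" and \<alpha>: "0 \<le> \<alpha>"
  shows "h x - \<alpha> ^ n * (K * W) \<le> (\<Sum>k<n. \<alpha> ^ k * U k)"
proof -
  have "h x \<le> (\<Sum>k<n. \<alpha> ^ k * U k) + \<alpha> ^ n * E n h"
  proof (induction n)
    case 0
    then show ?case using E_0[OF bounded_lsaD(1)[OF h]] by simp
  next
    case (Suc n)
    have "\<alpha> ^ n * E n h \<le> \<alpha> ^ n * (U n + \<alpha> * E (Suc n) h)"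
      using \<alpha> by (intro mult_left_mono step_ge[OF h ge]) auto
    then show ?case using Suc by (simp add: algebra_simps)
  qed
  moreover have "\<alpha> ^ n * E n h \<le> \<alpha> ^ n * (K * W)"
    using state_integral_bound[OF bounded_lsaD[OF h], of n] \<alpha> by (intro mult_left_mono) auto
  ultimately show ?thesis by linarith
qed

text \<open>Telescoping of the one-step inequalities. The case \<open>\<alpha> = 1\<close> is
  included on purpose: it bounds undiscounted sums by means of the optimality inequality.\<close>

lemma discounted_le:
  assumes h: "bounded_lsa K h" and le: "\<And>k. AE z in N k. Q \<alpha> h z \<le> h (fst z) + d k" and \<alpha>: "0 \<le> \<alpha>" "\<alpha> \<le> 1"
  shows "(\<Sum>k<n. \<alpha> ^ k * U k) \<le> h x + (\<Sum>k<n. \<alpha> ^ k * d k) + \<alpha> ^ n * (K * W)"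
proof -
  have "(\<Sum>k<n. \<alpha> ^ k * U k) + \<alpha> ^ n * E n h \<le> h x + (\<Sum>k<n. \<alpha> ^ k * d k)"
  proof (induction n)
    case 0
    then show ?case using E_0[OF bounded_lsaD(1)[OF h]] by simp
  next
    case (Suc n)
    have "\<alpha> ^ n * (U n + \<alpha> * E (Suc n) h) \<le> \<alpha> ^ n * (E n h + d n)"
      using \<alpha> by (intro mult_left_mono step_le[OF h le]) auto
    then show ?case using Suc by (simp add: algebra_simps)
  qed
  moreover have "- (\<alpha> ^ n * (K * W)) \<le> \<alpha> ^ n * E n h"
  proof -
    have "\<alpha> ^ n * (- (K * W)) \<le> \<alpha> ^ n * E n h"
      using state_integral_bound[OF bounded_lsaD[OF h], of n] \<alpha> by (intro mult_left_mono) auto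
    then show ?thesis by simp
  qed
  ultimately show ?thesis by linarith
qed

lemma v_pol_ge:
  assumes h: "bounded_lsa K h" and ge: "\<And>z. z \<in> graph A \<Longrightarrow> h (fst z) \<le> Q \<alpha> h z" and \<alpha>: "0 \<le> \<alpha>" "\<alpha> < 1"
  shows "ereal (h x) \<le> v_pol c q \<alpha> \<pi> x"
proof -
  have "(\<lambda>n. h x - \<alpha> ^ n * (K * W)) \<longlonglongrightarrow> h x - 0 * (K * W)"
    using \<alpha> by (intro tendsto_intros LIMSEQ_power_zero) auto
  then have "(\<lambda>n. ereal (h x - \<alpha> ^ n * (K * W))) \<longlonglongrightarrow> ereal (h x)" by simp
  then have "ereal (h x) = limsup (\<lambda>n. ereal (h x - \<alpha> ^ n * (K * W)))"
    by (intro lim_imp_Limsup[symmetric]) auto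
  also have "\<dots> \<le> limsup (\<lambda>n. ereal (\<Sum>k<n. \<alpha> ^ k * U k))"
    by (intro Limsup_mono always_eventually) (simp add: discounted_ge[OF h ge \<alpha>(1)])
  finally show ?thesis unfolding v_pol_eq .
qed

text \<open>The partial sums of \<open>U k - r\<close> are nonpositive from \<open>n0\<close> on.
  Abel summation writes the discounted sum as a combination of them with nonnegative weights, so
  only the finitely many early ones can contribute positively, and they come with the factor
  \<open>1 - \<alpha>\<close>. The constant \<open>D\<close> does not depend on \<alpha>.\<close>

lemma tauberian:
  assumes n0: "\<And>n. n0 \<le> n \<Longrightarrow> (\<Sum>k<n. U k) \<le> r * real n"
  shows "\<exists>D\<ge>0. \<forall>\<alpha> n. 0 \<le> \<alpha> \<longrightarrow> \<alpha> < 1 \<longrightarrow> n0 \<le> n \<longrightarrow> (\<Sum>k<n. \<alpha> ^ k * (U k - r)) \<le> (1 - \<alpha>) * D"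
proof -
  define S where "S n = (\<Sum>k<n. U k - r)" for n
  have S: "S n \<le> 0" if "n0 \<le> n" for n
    using n0[OF that] unfolding S_def by (simp add: sum_subtractf mult.commute)
  have abel: "(\<Sum>k<n. \<alpha> ^ k * (U k - r)) = \<alpha> ^ n * S n + (1 - \<alpha>) * (\<Sum>k<n. \<alpha> ^ k * S (Suc k))" for n \<alpha>
  proof (induction n)
    case (Suc n)
    have S_Suc: "S (Suc n) = S n + (U n - r)" by (simp add: S_def)
    then show ?case using Suc by (simp add: S_Suc algebra_simps)
  qed (simp add: S_def)
  let ?D = "\<Sum>k<n0. \<bar>S (Suc k)\<bar>"
  have "(\<Sum>k<n. \<alpha> ^ k * (U k - r)) \<le> (1 - \<alpha>) * ?D" if \<alpha>: "0 \<le> \<alpha>" "\<alpha> < 1" and n: "n0 \<le> n" for \<alpha> n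
  proof -
    have "(\<Sum>k<n. \<alpha> ^ k * S (Suc k)) \<le> (\<Sum>k<n. if k < n0 then \<bar>S (Suc k)\<bar> else 0)"
    proof (rule sum_mono)
      fix k
      show "\<alpha> ^ k * S (Suc k) \<le> (if k < n0 then \<bar>S (Suc k)\<bar> else 0)"
      proof (cases "k < n0")
        case True
        have "\<alpha> ^ k * S (Suc k) \<le> \<alpha> ^ k * \<bar>S (Suc k)\<bar>" using \<alpha> by (intro mult_left_mono) auto
        also have "\<dots> \<le> 1 * \<bar>S (Suc k)\<bar>" using \<alpha> by (intro mult_right_mono power_le_one) auto
        finally show ?thesis using True by simp
      next
        case False
        then show ?thesis using S[of "Suc k"] \<alpha> by (simp add: mult_nonneg_nonpos)
      qed
    qed
    also have "\<dots> = ?D"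
      using n by (intro sum.mono_neutral_cong_right) auto
    finally have "(1 - \<alpha>) * (\<Sum>k<n. \<alpha> ^ k * S (Suc k)) \<le> (1 - \<alpha>) * ?D" using \<alpha> by (intro mult_left_mono) auto
    moreover have "\<alpha> ^ n * S n \<le> 0" using S[OF n] \<alpha> by (simp add: mult_nonneg_nonpos)
    ultimately show ?thesis unfolding abel by linarith
  qed
  then show ?thesis by (intro exI[of _ ?D]) (auto intro: sum_nonneg)
qed

lemma J_avg_ge:
  fixes v :: "nat \<Rightarrow> 'x \<Rightarrow> real"
  assumes a: "\<And>n. 0 < a n" "\<And>n. a n < 1" "a \<longlonglongrightarrow> 1" and v: "\<And>n. \<exists>K. bounded_lsa K (v n)"
    and ge: "\<And>n z. z \<in> graph A \<Longrightarrow> v n (fst z) \<le> Q (a n) (v n) z"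
    and lim: "(\<lambda>n. (1 - a n) * v n x) \<longlonglongrightarrow> \<rho>"
  shows "ereal \<rho> \<le> J_avg c q \<pi> x"
proof (rule ccontr)
  assume "\<not> ?thesis"
  then have "J_avg c q \<pi> x < ereal \<rho>" by simp
  from ereal_dense2[OF this] obtain r where r: "J_avg c q \<pi> x < ereal r" "r < \<rho>" by auto
  have "\<forall>\<^sub>F n in sequentially. ereal ((\<Sum>k<n. U k) / real n) < ereal r"
    using r(1) unfolding J_avg_eq by (rule Limsup_lessD)
  then have "\<forall>\<^sub>F n in sequentially. (\<Sum>k<n. U k) \<le> r * real n"
    using eventually_gt_at_top[of 0] by eventually_elim (simp add: field_simps)
  then obtain n0 where "\<And>n. n0 \<le> n \<Longrightarrow> (\<Sum>k<n. U k) \<le> r * real n"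
    unfolding eventually_sequentially by blast
  from tauberian[OF this] obtain D where D: "0 \<le> D"
    "\<And>\<alpha> n. 0 \<le> \<alpha> \<Longrightarrow> \<alpha> < 1 \<Longrightarrow> n0 \<le> n \<Longrightarrow> (\<Sum>k<n. \<alpha> ^ k * (U k - r)) \<le> (1 - \<alpha>) * D" by blast
  \<comment> \<open>Within one \<open>m\<close> the horizon tends to infinity and removes the powers
    of \<open>?a\<close>. Afterwards \<open>m\<close> tends to infinity; as \<open>D\<close> is the
    same for all \<open>m\<close>, the error vanishes and \<open>\<rho> \<le> r\<close> contradicts
    the choice of \<open>r\<close>.\<close>
  have key: "(1 - a m) * v m x \<le> r + (1 - a m) * (1 - a m) * D" for m
  proof -
    obtain K where K: "bounded_lsa K (v m)" using v by blast
    let ?a = "a m"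
    have a': "0 \<le> ?a" "?a < 1" using a(1)[of m] a(2)[of m] by auto
    have gp: "(\<Sum>k<n. ?a ^ k) = (1 - ?a ^ n) / (1 - ?a)" for n
      using a' by (simp add: sum_gp_strict)
    have "(1 - ?a) * (v m x - ?a ^ n * (K * W)) \<le> r * (1 - ?a ^ n) + (1 - ?a) * ((1 - ?a) * D)" if "n0 \<le> n" for n
    proof -
      have "v m x - ?a ^ n * (K * W) \<le> (\<Sum>k<n. ?a ^ k * U k)"
        by (rule discounted_ge[OF K ge a'(1)])
      also have "\<dots> = (\<Sum>k<n. ?a ^ k * (U k - r)) + r * (\<Sum>k<n. ?a ^ k)"
        by (simp add: sum_distrib_left sum.distrib[symmetric] algebra_simps)
      also have "\<dots> \<le> (1 - ?a) * D + r * ((1 - ?a ^ n) / (1 - ?a))"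
        unfolding gp using D(2)[OF a' that] by simp
      finally have "(1 - ?a) * (v m x - ?a ^ n * (K * W)) \<le> (1 - ?a) * ((1 - ?a) * D + r * ((1 - ?a ^ n) / (1 - ?a)))"
        using a' by (intro mult_left_mono) auto
      also have "\<dots> = (1 - ?a) * ((1 - ?a) * D) + r * (1 - ?a ^ n)"
        using a' by (simp add: distrib_left)
      finally show ?thesis by simp
    qed
    then have ev: "\<exists>N. \<forall>n\<ge>N. (1 - ?a) * (v m x - ?a ^ n * (K * W)) \<le> r * (1 - ?a ^ n) + (1 - ?a) * ((1 - ?a) * D)" by blast
    have p: "(\<lambda>n. ?a ^ n) \<longlonglongrightarrow> 0" using a' by (intro LIMSEQ_power_zero) auto
    have 1: "(\<lambda>n. (1 - ?a) * (v m x - ?a ^ n * (K * W))) \<longlonglongrightarrow> (1 - ?a) * (v m x - 0 * (K * W))"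
      and 2: "(\<lambda>n. r * (1 - ?a ^ n) + (1 - ?a) * ((1 - ?a) * D)) \<longlonglongrightarrow> r * (1 - 0) + (1 - ?a) * ((1 - ?a) * D)"
      by (intro tendsto_intros p)+
    have "(1 - ?a) * (v m x - 0 * (K * W)) \<le> r * (1 - 0) + (1 - ?a) * ((1 - ?a) * D)"
      by (rule LIMSEQ_le[OF 1 2 ev])
    then show ?thesis by (simp add: mult.assoc)
  qed
  have "(\<lambda>m. r + (1 - a m) * (1 - a m) * D) \<longlonglongrightarrow> r + (1 - 1) * (1 - 1) * D"
    by (intro tendsto_intros a(3))
  from LIMSEQ_le[OF lim this] key have "\<rho> \<le> r" by auto
  then show False using r(2) by simp
qed

end

section \<open>Policies built from near-minimizing selectors\<close>

context mdp_UC
begin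

lemma Q_AE_markov:
  assumes \<phi>: "\<And>k. \<phi> k \<in> universal borel \<rightarrow>\<^sub>M borel" and le: "\<And>k y. Q \<alpha> h (y, \<phi> k y) \<le> h y + d k"
  shows "AE z in completion (action_law q (markov_policy \<phi>) x k). Q \<alpha> h z \<le> h (fst z) + d k"
  unfolding AE_completion_iff using AE_markov_policy[where x=x and k=k, OF q_kernel \<phi>]
proof (rule eventually_mono)
  fix z assume "snd z = \<phi> k (fst z)"
  then show "Q \<alpha> h z \<le> h (fst z) + d k" using le[where k=k and y="fst z"] by (metis prod.collapse)
qed

lemma v_opt_eq:
  assumes \<alpha>: "0 < \<alpha>" "\<alpha> < 1" and h: "bounded_lsa K h" and fixp: "\<And>x. T \<alpha> h x = h x"
  shows "v_opt A c q \<alpha> x = ereal (h x)"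
proof (rule antisym)
  have ge: "h (fst z) \<le> Q \<alpha> h z" if "z \<in> graph A" for z
    using T_le[OF \<alpha> h, of "snd z" "fst z"] that by (auto simp: fixp graph_def)
  show "ereal (h x) \<le> v_opt A c q \<alpha> x"
    unfolding v_opt_def
  proof (rule INF_greatest)
    fix \<pi> assume "\<pi> \<in> policies A"
    then interpret mdp_policy A c q w b C l \<pi> x by unfold_locales
    show "ereal (h x) \<le> v_pol c q \<alpha> \<pi> x" by (rule v_pol_ge[OF h ge]) (use \<alpha> in auto)
  qed
  show "v_opt A c q \<alpha> x \<le> ereal (h x)"
  proof (rule ereal_le_epsilon2)
    fix e :: real assume e: "0 < e"
    \<comment> \<open>The selector loses \<open>2 * \<epsilon>\<close> per stage, \<epsilon> for
      near-minimality and \<epsilon> for the discretization in \<open>approximate_selector\<close>;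
      discounted over all stages this is \<open>2 * \<epsilon> / (1 - \<alpha>) = e\<close>.\<close>
    define \<epsilon> where "\<epsilon> = e * (1 - \<alpha>) / 2"
    have \<epsilon>: "0 < \<epsilon>" using e \<alpha> by (simp add: \<epsilon>_def)
    have hm: "(\<lambda>x. h x + \<epsilon>) \<in> universal borel \<rightarrow>\<^sub>M borel"
      by (intro borel_measurable_add lsa_measurable) (use h in \<open>auto simp: bounded_lsa_def lsa_const\<close>)
    have ex: "\<exists>a\<in>A x. Q \<alpha> h (x, a) < h x + \<epsilon>" for x
      using T_less_iff[OF \<alpha> h, of x "h x + \<epsilon>"] \<epsilon> by (simp add: fixp)
    from approximate_selector[OF Q_less_analytic[OF \<alpha>(1) h] hm ex \<epsilon>] obtain \<phi> where
      \<phi>: "\<phi> \<in> universal borel \<rightarrow>\<^sub>M borel" "\<And>x. \<phi> x \<in> A x" "\<And>x. Q \<alpha> h (x, \<phi> x) < h x + \<epsilon> + \<epsilon>" by blast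
    let ?\<pi> = "markov_policy (\<lambda>_. \<phi>)"
    have pol: "?\<pi> \<in> policies A" by (rule markov_policy(1)) (use \<phi> in auto)
    interpret mdp_policy A c q w b C l ?\<pi> x by unfold_locales (rule pol)
    have "Q \<alpha> h (y, \<phi> y) \<le> h y + 2 * \<epsilon>" for y using \<phi>(3)[of y] by simp
    then have ae: "AE z in N k. Q \<alpha> h z \<le> h (fst z) + 2 * \<epsilon>" for k
      by (intro Q_AE_markov[where d="\<lambda>_. 2 * \<epsilon>"] \<phi>(1))
    have S: "(\<Sum>k<n. \<alpha> ^ k * U k) \<le> h x + e + \<alpha> ^ n * (K * W)" for n
    proof -
      have "(\<Sum>k<n. \<alpha> ^ k * U k) \<le> h x + (\<Sum>k<n. \<alpha> ^ k * (2 * \<epsilon>)) + \<alpha> ^ n * (K * W)"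
        by (rule discounted_le[OF h ae]) (use \<alpha> in auto)
      also have "(\<Sum>k<n. \<alpha> ^ k * (2 * \<epsilon>)) = (\<Sum>k<n. \<alpha> ^ k) * (2 * \<epsilon>)" by (simp add: sum_distrib_right)
      also have "(\<Sum>k<n. \<alpha> ^ k) = (1 - \<alpha> ^ n) / (1 - \<alpha>)" using \<alpha> by (simp add: sum_gp_strict)
      also have "\<dots> * (2 * \<epsilon>) = (1 - \<alpha> ^ n) * e" using \<alpha> by (simp add: \<epsilon>_def)
      also have "\<dots> \<le> 1 * e" using \<alpha> e by (intro mult_right_mono) auto
      finally show ?thesis by simp
    qed
    have "(\<lambda>n. h x + e + \<alpha> ^ n * (K * W)) \<longlonglongrightarrow> h x + e + 0 * (K * W)"
      using \<alpha> by (intro tendsto_intros LIMSEQ_power_zero) auto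
    then have lim: "(\<lambda>n. ereal (h x + e + \<alpha> ^ n * (K * W))) \<longlonglongrightarrow> ereal (h x + e)" by simp
    have "v_opt A c q \<alpha> x \<le> v_pol c q \<alpha> ?\<pi> x" unfolding v_opt_def by (rule INF_lower[OF pol])
    also have "\<dots> \<le> limsup (\<lambda>n. ereal (h x + e + \<alpha> ^ n * (K * W)))"
      unfolding v_pol_eq by (intro Limsup_mono always_eventually) (simp add: S)
    also have "\<dots> = ereal (h x + e)" by (rule lim_imp_Limsup[OF _ lim]) simp
    finally show "v_opt A c q \<alpha> x \<le> ereal (h x) + ereal e" by simp
  qed
qed

lemma v_opt_real:
  assumes \<alpha>: "0 < \<alpha>" "\<alpha> < 1"
  shows "\<exists>h K. bounded_lsa K h \<and> (\<forall>x. v_opt A c q \<alpha> x = ereal (h x)) \<and> (\<forall>z\<in>graph A. h (fst z) \<le> Q \<alpha> h z)"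
proof -
  obtain h K where h: "bounded_lsa K h" "\<forall>x. T \<alpha> h x = h x" using fixed_point[OF \<alpha>] by blast
  have "h (fst z) \<le> Q \<alpha> h z" if "z \<in> graph A" for z
    using T_le[OF \<alpha> h(1), of "snd z" "fst z"] that h(2) by (auto simp: graph_def)
  moreover have "v_opt A c q \<alpha> x = ereal (h x)" for x
    by (rule v_opt_eq[OF \<alpha> h(1)]) (use h(2) in simp)
  ultimately show ?thesis using h(1) by blast
qed

text \<open>Covers both kinds of policy: summable errors, bounded in total by \<open>D\<close> with
  \<open>e = 0\<close>, disappear in the average, and a constant error is passed on as
  \<open>e\<close> with \<open>D = 0\<close>. The terms in \<open>h\<close> are bounded in
  expectation, hence negligible after division by \<open>n\<close>.\<close>

lemma J_avg_markov_le:
  assumes h: "bounded_lsa K h" and \<phi>: "\<And>k. \<phi> k \<in> universal borel \<rightarrow>\<^sub>M borel" "\<And>k y. \<phi> k y \<in> A y"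
    and le: "\<And>k y. Q 1 h (y, \<phi> k y) \<le> h y + (\<rho> + \<epsilon> k)" and sum: "\<And>n. (\<Sum>k<n. \<epsilon> k) \<le> D + real n * e"
  shows "J_avg c q (markov_policy \<phi>) x \<le> ereal (\<rho> + e)"
proof -
  have pol: "markov_policy \<phi> \<in> policies A" by (rule markov_policy(1)[OF \<phi>])
  interpret mdp_policy A c q w b C l "markov_policy \<phi>" x by unfold_locales (rule pol)
  have ae: "AE z in N k. Q 1 h z \<le> h (fst z) + (\<rho> + \<epsilon> k)" for k
    by (rule Q_AE_markov[OF \<phi>(1) le])
  have S: "(\<Sum>k<n. U k) \<le> real n * (\<rho> + e) + (h x + D + K * W)" for n
    using discounted_le[where \<alpha>=1 and d="\<lambda>k. \<rho> + \<epsilon> k" and n=n, OF h ae] sum[of n]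
    by (simp add: sum.distrib algebra_simps)
  have "(\<lambda>n. (\<rho> + e) + (h x + D + K * W) / real n) \<longlonglongrightarrow> (\<rho> + e) + 0"
    by (intro tendsto_intros lim_const_over_n)
  then have lim: "(\<lambda>n. ereal ((\<rho> + e) + (h x + D + K * W) / real n)) \<longlonglongrightarrow> ereal (\<rho> + e)" by simp
  have "J_avg c q (markov_policy \<phi>) x \<le> limsup (\<lambda>n. ereal ((\<rho> + e) + (h x + D + K * W) / real n))"
    unfolding J_avg_eq
  proof (rule Limsup_mono)
    show "\<forall>\<^sub>F n in sequentially. ereal ((\<Sum>k<n. U k) / real n) \<le> ereal ((\<rho> + e) + (h x + D + K * W) / real n)"
      using eventually_gt_at_top[of 0]
    proof eventually_elim
      case (elim n)
      then show ?case using divide_right_mono[OF S[of n], of "real n"] by (simp add: add_divide_distrib)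
    qed
  qed
  also have "\<dots> = ereal (\<rho> + e)" by (rule lim_imp_Limsup[OF _ lim]) simp
  finally show ?thesis .
qed

end

subsection \<open>The average cost optimality inequality\<close>

text \<open>Universal measurability refers to probability measures, while the dominating measure is
  merely finite. Normalization keeps the null sets; under the zero measure every subset is
  measurable for the completion.\<close>

lemma sets_universalD_finite:
  assumes S: "S \<in> sets (universal M)" and ne: "space M \<noteq> {}" and \<nu>: "finite_measure \<nu>" "sets \<nu> = sets M"
  shows "S \<in> sets (completion \<nu>)"
proof -
  interpret finite_measure \<nu> by fact
  have sp: "space \<nu> = space M" by (rule sets_eq_imp_space_eq[OF \<nu>(2)])
  have Ssub: "S \<subseteq> space \<nu>" using sets.sets_into_space[OF S] ne sp by simp
  show ?thesis
  proof (cases "emeasure \<nu> (space \<nu>) = 0")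
    case True
    then have "space \<nu> \<in> null_sets \<nu>" by (intro null_setsI) auto
    then show ?thesis using Ssub by (intro sets_completionI[of _ "{}" S "space \<nu>"]) auto
  next
    case False
    let ?p = "uniform_measure \<nu> (space \<nu>)"
    have p: "prob_space ?p" by (rule prob_space_uniform_measure[OF False]) simp
    have "sets ?p = sets M" using \<nu>(2) by simp
    from sets_universalD[OF S p this] obtain S1 N T where
      S1: "S = S1 \<union> N" "N \<subseteq> T" "T \<in> null_sets ?p" "S1 \<in> sets ?p"
      by (rule sets_completionE)
    have T: "T \<in> sets \<nu>" using S1(3) by auto
    have "emeasure \<nu> (space \<nu> \<inter> T) / emeasure \<nu> (space \<nu>) = 0"
      using S1(3) emeasure_uniform_measure[OF sets.top T] by auto
    then have "emeasure \<nu> (space \<nu> \<inter> T) = 0" by (simp add: ennreal_divide_eq_0_iff)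
    moreover have "space \<nu> \<inter> T = T" using sets.sets_into_space[OF T] by auto
    ultimately have "T \<in> null_sets \<nu>" using T by (intro null_setsI) simp_all
    then show ?thesis using S1 by (intro sets_completionI[of S S1 N T]) auto
  qed
qed

text \<open>Domination is known on measurable sets only, so \<open>S\<close> is replaced by a
  measurable superset of equal measure for the dominating \<nu>.\<close>

lemma emeasure_completion_mono:
  assumes le: "\<And>B. B \<in> sets M \<Longrightarrow> emeasure p B \<le> emeasure \<nu> B" and sets: "sets p = sets M" "sets \<nu> = sets M"
    and S: "S \<in> sets (completion p)" "S \<in> sets (completion \<nu>)"
  shows "emeasure (completion p) S \<le> emeasure (completion \<nu>) S"
proof -
  obtain B where B: "B \<in> sets \<nu>" "S \<subseteq> B" "emeasure (completion \<nu>) S = emeasure \<nu> B"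
    using completion_upper[OF S(2)] by blast
  have "emeasure (completion p) S \<le> emeasure (completion p) B"
    by (rule emeasure_mono[OF B(2)]) (use B(1) sets in auto)
  also have "\<dots> = emeasure p B" using B(1) sets by simp
  also have "\<dots> \<le> emeasure \<nu> B" by (rule le) (use B(1) sets in auto)
  finally show ?thesis using B(3) by simp
qed

section \<open>Passage to the limit along the discount factors\<close>

context mdp_UC
begin

context
  fixes v :: "nat \<Rightarrow> 'x \<Rightarrow> real" and a :: "nat \<Rightarrow> real" and xbar :: 'x and K \<rho> :: real and h :: "'x \<Rightarrow> real"
  assumes a: "\<And>n. 0 < a n" "\<And>n. a n < 1" "a \<longlonglongrightarrow> 1"
    and v: "\<And>n. \<exists>K. bounded_lsa K (v n)"
    and K: "0 \<le> K" "\<And>n x. \<bar>v n x - v n xbar\<bar> \<le> K * w x"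
    and \<rho>: "(\<lambda>n. (1 - a n) * v n xbar) \<longlonglongrightarrow> \<rho>"
    and h: "\<And>x. ereal (h x) = liminf (\<lambda>n. ereal (v n x - v n xbar))"
begin

lemma diff_lsa: "bounded_lsa K (\<lambda>x. v n x - v n xbar)"
  using v[of n] K unfolding bounded_lsa_def by (auto intro: lsa_diff_const)

lemma liminf_bounded_lsa: "bounded_lsa K h"
  unfolding bounded_lsa_def
proof (intro conjI allI K(1))
  show "lsa h"
    by (rule lsa_liminf[OF _ h]) (use diff_lsa in \<open>auto simp: bounded_lsa_def\<close>)
  fix x
  have "ereal (- (K * w x)) \<le> ereal (v n x - v n xbar)" "ereal (v n x - v n xbar) \<le> ereal (K * w x)" for n
    using K(2)[of n x] by auto
  then have "ereal (- (K * w x)) \<le> ereal (h x)" "ereal (h x) \<le> ereal (K * w x)"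
    unfolding h by (intro Liminf_bounded Liminf_le always_eventually; simp)+
  then show "\<bar>h x\<bar> \<le> K * w x" by auto
qed

lemma h_measurable: "h \<in> universal borel \<rightarrow>\<^sub>M borel"
  and diff_measurable: "(\<lambda>x. v n x - v n xbar) \<in> universal borel \<rightarrow>\<^sub>M borel"
  using liminf_bounded_lsa diff_lsa by (auto simp: bounded_lsa_def lsa_measurable)

lemma frequently_below:
  assumes "0 < \<epsilon>"
  shows "\<exists>n\<ge>m. v n x - v n xbar < h x + \<epsilon>"
proof -
  have "h x < h x + \<epsilon>" using assms by simp
  then obtain s :: rat where s: "of_rat s < h x + \<epsilon>" "\<forall>m. \<exists>n\<ge>m. v n x - v n xbar < of_rat s"
    unfolding liminf_less_iff[OF h] by blast
  then obtain n where "n \<ge> m" "v n x - v n xbar < of_rat s" by blast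
  then show ?thesis using s(1) by (intro exI[of _ n]) simp
qed

text \<open>The points where some difference from index \<open>n\<close> on drops more than
  \<epsilon> below \<open>h\<close>. Only drops are recorded: \<open>h\<close> is a liminf, so every
  point leaves these sets, whereas rises above \<open>h\<close> may recur forever.\<close>

definition D :: "real \<Rightarrow> nat \<Rightarrow> 'x set" where
  "D \<epsilon> n = (\<Union>k\<in>{n..}. {y\<in>space (universal borel). v k y - v k xbar < h y - \<epsilon>})"

lemma D_sets: "D \<epsilon> n \<in> sets (universal borel)"
proof -
  have "(\<lambda>y. h y - \<epsilon>) \<in> universal borel \<rightarrow>\<^sub>M borel" using h_measurable by simp
  from borel_measurable_less[OF diff_measurable this]
  show ?thesis unfolding D_def by (intro sets.countable_UN'') auto
qed

lemma D_decseq: "decseq (D \<epsilon>)"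
  unfolding decseq_def D_def by (auto intro: order_trans)

lemma D_Inter:
  assumes "0 < \<epsilon>" shows "(\<Inter>n. D \<epsilon> n) = {}"
proof -
  have "\<exists>n. y \<notin> D \<epsilon> n" for y
  proof -
    have "ereal (h y - \<epsilon>) < liminf (\<lambda>n. ereal (v n y - v n xbar))"
      unfolding h[symmetric] using assms by simp
    then have "\<forall>\<^sub>F n in sequentially. ereal (h y - \<epsilon>) < ereal (v n y - v n xbar)" by (rule less_LiminfD)
    then obtain n where "\<forall>k\<ge>n. h y - \<epsilon> < v k y - v k xbar" unfolding eventually_sequentially by auto
    then have "y \<notin> D \<epsilon> n" unfolding D_def by (auto simp: not_less intro: less_imp_le)
    then show ?thesis ..
  qed
  then show ?thesis by blast
qed

text \<open>
  This takes the place of Egorov's theorem: outside \<open>D \<epsilon> n\<close> the integrands differ by at most \<open>\<epsilon>\<close>, and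
  \<open>D \<epsilon> n\<close> is uniformly small under the kernels dominated by \<open>\<nu>\<close>.
\<close>

lemma uniform_integral_below:
  assumes S: "S \<subseteq> A x" and \<nu>: "finite_measure \<nu>" "sets \<nu> = sets borel"
    and dom: "\<And>a B. a \<in> S \<Longrightarrow> B \<in> sets borel \<Longrightarrow> emeasure (q (x, a)) B \<le> emeasure \<nu> B"
    and ui: "\<And>\<delta>. 0 < \<delta> \<Longrightarrow> \<exists>L>0. \<forall>a\<in>S. I (x, a) (\<lambda>y. w y * indicator {y. L \<le> w y} y) \<le> \<delta>"
    and \<eta>: "0 < \<eta>"
  shows "\<forall>\<^sub>F n in sequentially. \<forall>a\<in>S. I (x, a) h - I (x, a) (\<lambda>y. v n y - v n xbar) \<le> \<eta>"
proof -
  \<comment> \<open>The final error is \<open>2 * K * (\<delta> + \<delta>)\<close>, one \<delta>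
    from the measure of \<open>?D n\<close> and one from the tail of the weight; this choice keeps
    it below \<open>\<eta> / 2\<close>. The summand 8 covers \<open>K = 0\<close>.\<close>
  define \<delta> where "\<delta> = \<eta> / (8 * K + 8)"
  have \<delta>: "0 < \<delta>" using \<eta> K(1) by (simp add: \<delta>_def)
  have K\<delta>: "4 * K * \<delta> \<le> \<eta> / 2" using \<eta> K(1) by (simp add: \<delta>_def field_simps)
  obtain L where L: "0 < L" "\<And>a. a \<in> S \<Longrightarrow> I (x, a) (\<lambda>y. w y * indicator {y. L \<le> w y} y) \<le> \<delta>"
    using ui[OF \<delta>] by blast
  let ?D = "D (\<eta> / 2)"
  interpret \<nu>: finite_measure \<nu> by fact
  have D\<nu>: "?D n \<in> sets (completion \<nu>)" for n by (rule sets_universalD_finite[OF D_sets _ \<nu>]) simp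
  have fin: "emeasure (completion \<nu>) B \<noteq> \<infinity>" if "B \<in> sets (completion \<nu>)" for B
  proof -
    have "emeasure (completion \<nu>) B \<le> emeasure (completion \<nu>) (space \<nu>)"
      using sets.sets_into_space[OF that] by (intro emeasure_mono) auto
    then show ?thesis using \<nu>.emeasure_finite[of "space \<nu>"] by (auto simp: top_unique)
  qed
  have "(\<lambda>n. emeasure (completion \<nu>) (?D n)) \<longlonglongrightarrow> emeasure (completion \<nu>) (\<Inter>n. ?D n)"
    by (rule Lim_emeasure_decseq[OF _ D_decseq fin]) (use D\<nu> in auto)
  then have lim: "(\<lambda>n. emeasure (completion \<nu>) (?D n)) \<longlonglongrightarrow> 0"
    using \<eta> by (simp add: D_Inter)
  have "\<forall>\<^sub>F n in sequentially. emeasure (completion \<nu>) (?D n) < ennreal (\<delta> / L)"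
    by (rule order_tendstoD(2)[OF lim]) (use \<delta> L in simp)
  then show ?thesis
  proof (rule eventually_mono, intro ballI)
    fix n a assume small: "emeasure (completion \<nu>) (?D n) < ennreal (\<delta> / L)" and a: "a \<in> S"
    let ?q = "completion (q (x, a))"
    let ?f = "\<lambda>y. w y * indicator {y. L \<le> w y} y"
    have z: "(x, a) \<in> graph A" using a S by (auto simp: graph_def)
    interpret C: prob_space ?q by (rule prob_space.prob_space_completion[OF q_prob])
    have Dq: "?D n \<in> sets ?q" by (rule sets_universalD[OF D_sets q_prob q_sets])
    have "emeasure ?q (?D n) \<le> emeasure (completion \<nu>) (?D n)"
      by (rule emeasure_completion_mono[where M=borel, OF dom[OF a] q_sets \<nu>(2) Dq D\<nu>])
    also note small
    finally have "C.prob (?D n) < \<delta> / L"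
      unfolding C.emeasure_eq_measure using \<delta> L by (simp add: ennreal_less_iff)
    then have LD: "L * C.prob (?D n) \<le> \<delta>" using L(1) by (simp add: field_simps)
    have wm: "{y\<in>space (universal borel). L \<le> w y} \<in> sets (universal borel)"
      using w_measurable by measurable
    have fm: "?f \<in> universal borel \<rightarrow>\<^sub>M borel"
      using wm by (intro borel_measurable_times w_measurable borel_measurable_indicator) simp
    have fi: "integrable ?q ?f"
      by (rule integrable_bounded[OF z fm, of 1]) (use w_nonneg in \<open>auto simp: indicator_def\<close>)
    have hi: "integrable ?q h" "integrable ?q (\<lambda>y. v n y - v n xbar)"
      by (rule bounded_lsa_integrable[OF z liminf_bounded_lsa], rule bounded_lsa_integrable[OF z diff_lsa])
    have Di: "integrable ?q (indicator (?D n) :: 'x \<Rightarrow> real)"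
      using Dq by (intro integrable_real_indicator) (auto simp: C.emeasure_eq_measure)
    have "I (x, a) h - I (x, a) (\<lambda>y. v n y - v n xbar) = I (x, a) (\<lambda>y. h y - (v n y - v n xbar))"
      using hi by simp
    also have "\<dots> \<le> I (x, a) (\<lambda>y. \<eta> / 2 + 2 * K * (L * indicator (?D n) y + ?f y))"
    proof (rule integral_mono)
      show "integrable ?q (\<lambda>y. h y - (v n y - v n xbar))" using hi by simp
      show "integrable ?q (\<lambda>y. \<eta> / 2 + 2 * K * (L * indicator (?D n) y + ?f y))" using Di fi by simp
      fix y
      show "h y - (v n y - v n xbar) \<le> \<eta> / 2 + 2 * K * (L * indicator (?D n) y + ?f y)"
      proof (cases "y \<in> ?D n")
        case True
        \<comment> \<open>On the exceptional set only the weight bound is left. Splitting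
          \<open>w\<close> at \<open>L\<close> gives the constant \<open>L\<close>, paid for by the
          small measure of the set, and a tail, paid for by uniform integrability.\<close>
        have "h y - (v n y - v n xbar) \<le> 2 * K * w y"
          using K(2)[of n y] liminf_bounded_lsa by (auto simp: bounded_lsa_def abs_le_iff dest!: spec[of _ y])
        also have "\<dots> \<le> 2 * K * (L + ?f y)"
          using K(1) L(1) by (intro mult_left_mono) (auto simp: indicator_def)
        finally show ?thesis using True \<eta> by simp
      next
        case False
        then have "\<not> v n y - v n xbar < h y - \<eta> / 2" unfolding D_def by auto
        moreover have "0 \<le> 2 * K * (L * indicator (?D n) y + ?f y)"
          using K(1) L(1) w_nonneg[of y] by simp
        ultimately show ?thesis by linarith
      qed
    qed
    also have "\<dots> = \<eta> / 2 + 2 * K * (L * C.prob (?D n) + I (x, a) ?f)"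
    proof -
      have "?D n \<inter> space (q (x, a)) = ?D n" using sets.sets_into_space[OF Dq] by auto
      then show ?thesis using Di fi Dq C.prob_space by simp
    qed
    also have "\<dots> \<le> \<eta> / 2 + 2 * K * (\<delta> + \<delta>)"
      using LD L(2)[OF a] K(1) by (intro add_left_mono mult_left_mono add_mono) auto
    also have "\<dots> \<le> \<eta>" using K\<delta> by simp
    finally show "I (x, a) h - I (x, a) (\<lambda>y. v n y - v n xbar) \<le> \<eta>" .
  qed
qed

text \<open>Five errors of size \<eta>: near-minimality of the action, the integral comparison,
  convergence of \<open>(1 - a n) * v n xbar\<close> to \<rho>, replacement of the factor
  \<open>a n\<close> by 1 before the integral, and the liminf at \<open>x\<close>. The first four
  hold from some index on, the last for infinitely many indices, so a common index exists; the
  action may depend on it.\<close>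

lemma optimality_inequality:
  assumes S: "S \<subseteq> A x" and \<nu>: "finite_measure \<nu>" "sets \<nu> = sets borel"
    and dom: "\<And>a B. a \<in> S \<Longrightarrow> B \<in> sets borel \<Longrightarrow> emeasure (q (x, a)) B \<le> emeasure \<nu> B"
    and ui: "\<And>\<delta>. 0 < \<delta> \<Longrightarrow> \<exists>L>0. \<forall>a\<in>S. I (x, a) (\<lambda>y. w y * indicator {y. L \<le> w y} y) \<le> \<delta>"
    and near: "\<forall>\<^sub>F n in sequentially. \<exists>a'\<in>S. Q (a n) (v n) (x, a') < v n x + \<eta>" and \<eta>: "0 < \<eta>"
  shows "\<exists>a'\<in>A x. Q 1 h (x, a') < \<rho> + h x + 5 * \<eta>"
proof -
  have e2: "\<forall>\<^sub>F n in sequentially. \<forall>a'\<in>S. I (x, a') h - I (x, a') (\<lambda>y. v n y - v n xbar) \<le> \<eta>"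
    by (rule uniform_integral_below[OF S \<nu> dom ui \<eta>])
  have e3: "\<forall>\<^sub>F n in sequentially. (1 - a n) * v n xbar < \<rho> + \<eta>"
    by (rule order_tendstoD(2)[OF \<rho>]) (use \<eta> in simp)
  have "(\<lambda>n. (1 - a n) * (K * (l * w x + b))) \<longlonglongrightarrow> (1 - 1) * (K * (l * w x + b))"
    by (intro tendsto_intros a(3))
  then have e4: "\<forall>\<^sub>F n in sequentially. (1 - a n) * (K * (l * w x + b)) < \<eta>"
    by (rule order_tendstoD(2)) (use \<eta> in simp)
  from near e2 e3 e4 have "\<forall>\<^sub>F n in sequentially.
      (\<exists>a'\<in>S. Q (a n) (v n) (x, a') < v n x + \<eta>) \<and>
      (\<forall>a'\<in>S. I (x, a') h - I (x, a') (\<lambda>y. v n y - v n xbar) \<le> \<eta>) \<and>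
      (1 - a n) * v n xbar < \<rho> + \<eta> \<and> (1 - a n) * (K * (l * w x + b)) < \<eta>"
    by eventually_elim blast
  then obtain m where m: "\<And>n. m \<le> n \<Longrightarrow>
      (\<exists>a'\<in>S. Q (a n) (v n) (x, a') < v n x + \<eta>) \<and>
      (\<forall>a'\<in>S. I (x, a') h - I (x, a') (\<lambda>y. v n y - v n xbar) \<le> \<eta>) \<and>
      (1 - a n) * v n xbar < \<rho> + \<eta> \<and> (1 - a n) * (K * (l * w x + b)) < \<eta>"
    unfolding eventually_sequentially by blast
  obtain n where n: "m \<le> n" "v n x - v n xbar < h x + \<eta>" using frequently_below[OF \<eta>, of m x] by blast
  then obtain a' where a': "a' \<in> S" "Q (a n) (v n) (x, a') < v n x + \<eta>" using m by blast
  let ?J = "I (x, a') (\<lambda>y. v n y - v n xbar)"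
  have z: "(x, a') \<in> graph A" using a'(1) S by (auto simp: graph_def)
  interpret C: prob_space "completion (q (x, a'))" by (rule prob_space.prob_space_completion[OF q_prob])
  have i: "integrable (completion (q (x, a'))) (\<lambda>y. v n y - v n xbar)"
    by (rule bounded_lsa_integrable[OF z diff_lsa])
  have "I (x, a') (\<lambda>y. (v n y - v n xbar) + v n xbar) = ?J + v n xbar"
    using C.prob_space by (subst Bochner_Integration.integral_add[OF i]) simp_all
  then have Iv: "I (x, a') (v n) = ?J + v n xbar" by simp
  have J: "\<bar>?J\<bar> \<le> K * (l * w x + b)"
    using integral_bound[OF z i K(2) K(1)] by simp
  have "(1 - a n) * ?J \<le> (1 - a n) * (K * (l * w x + b))"
    using J a(2)[of n] by (intro mult_left_mono) auto
  then have 1: "(1 - a n) * ?J \<le> \<eta>" using m[OF n(1)] by linarith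
  have 2: "I (x, a') h - ?J \<le> \<eta>" using m[OF n(1)] a'(1) by blast
  have 3: "(1 - a n) * v n xbar < \<rho> + \<eta>" using m[OF n(1)] by blast
  have 4: "cr (x, a') + a n * (?J + v n xbar) < v n x + \<eta>" using a'(2) unfolding Q_def Iv .
  have "Q 1 h (x, a') = cr (x, a') + I (x, a') h" by (simp add: Q_def)
  also have "\<dots> < \<rho> + h x + 5 * \<eta>" using 1 2 3 4 n(2) by (simp add: algebra_simps)
  finally show ?thesis using a'(1) S by blast
qed

lemma J_avg_lower:
  assumes ge: "\<And>n z. z \<in> graph A \<Longrightarrow> v n (fst z) \<le> Q (a n) (v n) z" and \<pi>: "\<pi> \<in> policies A"
  shows "ereal \<rho> \<le> J_avg c q \<pi> x"
proof -
  interpret mdp_policy A c q w b C l \<pi> x by unfold_locales (rule \<pi>)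
  have a0: "(\<lambda>n. (1 - a n) * (K * w x)) \<longlonglongrightarrow> (1 - 1) * (K * w x)" by (intro tendsto_intros a(3))
  \<comment> \<open>The differences stay within \<open>K * w x\<close>, so the limit \<rho> assumed
    at the reference state is the limit at every state.\<close>
  have "(\<lambda>n. (1 - a n) * (v n x - v n xbar)) \<longlonglongrightarrow> 0"
  proof (rule Lim_null_comparison)
    show "\<forall>\<^sub>F n in sequentially. norm ((1 - a n) * (v n x - v n xbar)) \<le> (1 - a n) * (K * w x)"
    proof (rule always_eventually, rule allI)
      fix n
      have "norm ((1 - a n) * (v n x - v n xbar)) = (1 - a n) * \<bar>v n x - v n xbar\<bar>"
        using a(2)[of n] by (simp add: abs_mult)
      also have "\<dots> \<le> (1 - a n) * (K * w x)" using a(2)[of n] K(2)[of n x] by (intro mult_left_mono) auto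
      finally show "norm ((1 - a n) * (v n x - v n xbar)) \<le> (1 - a n) * (K * w x)" .
    qed
    show "(\<lambda>n. (1 - a n) * (K * w x)) \<longlonglongrightarrow> 0" using a0 by simp
  qed
  from tendsto_add[OF this \<rho>] have "(\<lambda>n. (1 - a n) * v n x) \<longlonglongrightarrow> \<rho>"
    by (simp add: algebra_simps)
  then have lim: "(\<lambda>n. (1 - a n) * v n x) \<longlonglongrightarrow> \<rho>" .
  show ?thesis
    by (rule J_avg_ge[where a=a and v=v, OF a(1) a(2) a(3) v _ lim]) (rule ge)
qed

end

end

theorem theorem3p1:
  fixes A :: "'x::borel_space \<Rightarrow> 'a::borel_space set"
    and c :: "'x \<times> 'a \<Rightarrow> ereal"
    and q :: "'x \<times> 'a \<Rightarrow> 'x measure"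
    and w :: "'x \<Rightarrow> real"
    and xbar :: 'x
    and \<alpha> :: "nat \<Rightarrow> real"
    and \<rho> :: real
    and h_low :: "'x \<Rightarrow> ereal"
  assumes mdp: "borel_mdp A c q"
    and UC: "model_UC A c q w"
    and bounded: "(SUP \<beta>\<in>{0<..<1}. wnorm w (h_rel A c q xbar \<beta>)) < \<infinity>"
    and cpt: "\<And>x \<epsilon>. 0 < \<epsilon> \<Longrightarrow>
      \<exists>K. compact K \<and>
        (\<exists>\<beta>\<^sub>0. 0 < \<beta>\<^sub>0 \<and> \<beta>\<^sub>0 < 1 \<and> (\<forall>\<beta>\<in>{\<beta>\<^sub>0..<1}.
          (INF a\<in>K \<inter> A x. c (x, a) + ereal \<beta> * eint (q (x, a)) (v_opt A c q \<beta>))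
            \<le> v_opt A c q \<beta> x + ereal \<epsilon>)) \<and>
        (\<exists>\<nu>. finite_measure \<nu> \<and> sets \<nu> = sets borel \<and>
          (\<forall>B\<in>sets borel. (SUP a\<in>K \<inter> A x. emeasure (q (x, a)) B) \<le> emeasure \<nu> B)) \<and>
        ((\<lambda>l::real. SUP a\<in>K \<inter> A x.
            eint (q (x, a)) (\<lambda>y. ereal (w y * indicator {y. l \<le> w y} y))) \<longlongrightarrow> 0) at_top"
    and \<alpha>_range: "\<And>n. 0 < \<alpha> n \<and> \<alpha> n < 1"
    and \<alpha>_mono: "incseq \<alpha>"
    and \<alpha>_lim: "\<alpha> \<longlonglongrightarrow> 1"
    and \<rho>_lim: "(\<lambda>n. ereal (1 - \<alpha> n) * v_opt A c q (\<alpha> n) xbar) \<longlonglongrightarrow> ereal \<rho>"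
    and h_low: "\<And>x. h_low x = liminf (\<lambda>n. h_rel A c q xbar (\<alpha> n) x)"
  shows "(\<forall>x. g_star A c q x = ereal \<rho>)
    \<and> lower_semianalytic_on UNIV h_low \<and> h_low \<in> M_w w
    \<and> (\<forall>x. ereal \<rho> + h_low x \<ge> (INF a\<in>A x. c (x, a) + eint (q (x, a)) h_low))
    \<and> (\<exists>\<pi>. avg_optimal A c q \<pi> \<and> nonrandomized A \<pi> \<and> Markov \<pi>)
    \<and> (\<forall>\<epsilon>>0. \<exists>\<pi>. avg_eps_optimal A c q \<epsilon> \<pi> \<and> nonrandomized A \<pi> \<and> stationary \<pi>)"
proof -
  obtain b C l where "mdp_UC A c q w b C l"
    using mdp UC unfolding model_UC_def mdp_UC_def by blast
  then interpret mdp_UC A c q w b C l .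
  have \<alpha>: "0 < \<alpha> n" "\<alpha> n < 1" for n using \<alpha>_range by auto
  have "\<forall>n. \<exists>h. (\<exists>K. bounded_lsa K h) \<and> (\<forall>x. v_opt A c q (\<alpha> n) x = ereal (h x)) \<and> (\<forall>z\<in>graph A. h (fst z) \<le> Q (\<alpha> n) h z)"
    using v_opt_real[OF \<alpha>] by blast
  from choice[OF this] obtain v where v: "\<And>n. \<exists>K. bounded_lsa K (v n)"
    and v_opt: "\<And>n x. v_opt A c q (\<alpha> n) x = ereal (v n x)"
    and v_le: "\<And>n z. z \<in> graph A \<Longrightarrow> v n (fst z) \<le> Q (\<alpha> n) (v n) z" by blast
  have v_opt': "v_opt A c q (\<alpha> n) = (\<lambda>x. ereal (v n x))" for n using v_opt by (rule ext)
  have h_rel: "h_rel A c q xbar (\<alpha> n) x = ereal (v n x - v n xbar)" for n x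
    by (simp add: h_rel_def v_opt)
  obtain K where K: "0 \<le> K" "\<And>n x. \<bar>v n x - v n xbar\<bar> \<le> K * w x"
  proof -
    let ?s = "SUP \<beta>\<in>{0<..<1}. wnorm w (h_rel A c q xbar \<beta>)"
    have le: "ereal (\<bar>v n x - v n xbar\<bar> / w x) \<le> ?s" for n x
    proof -
      have "ereal (\<bar>v n x - v n xbar\<bar> / w x) = \<bar>h_rel A c q xbar (\<alpha> n) x\<bar> / ereal (w x)"
        using w_pos[of x] by (simp add: h_rel)
      also have "\<dots> \<le> wnorm w (h_rel A c q xbar (\<alpha> n))" unfolding wnorm_def by (rule SUP_upper) simp
      also have "\<dots> \<le> ?s" by (rule SUP_upper) (use \<alpha> in auto)
      finally show ?thesis .
    qed
    then have "0 \<le> ?s" using order_trans[OF _ le[of 0 xbar], of 0] w_nonneg[of xbar] by simp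
    then obtain K where K: "?s = ereal K" "0 \<le> K" using bounded by (cases ?s) auto
    have "\<bar>v n x - v n xbar\<bar> \<le> K * w x" for n x
      using le[of n x] w_pos[of x] unfolding K(1) by (simp add: field_simps)
    then show ?thesis using that K(2) by blast
  qed
  have \<rho>: "(\<lambda>n. (1 - \<alpha> n) * v n xbar) \<longlonglongrightarrow> \<rho>"
    using \<rho>_lim by (simp add: v_opt)
  define h where "h x = real_of_ereal (h_low x)" for x
  have low: "h_low x = liminf (\<lambda>n. ereal (v n x - v n xbar))" for x
    by (simp add: h_low h_rel)
  have hh: "h_low x = ereal (h x)" for x
  proof -
    have bd: "ereal (- (K * w x)) \<le> ereal (v n x - v n xbar)" "ereal (v n x - v n xbar) \<le> ereal (K * w x)" for n
      using K(2)[of n x] by auto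
    have "ereal (- (K * w x)) \<le> h_low x" unfolding low
      by (intro Liminf_bounded always_eventually) (use bd(1) in blast)
    moreover have "h_low x \<le> ereal (K * w x)" unfolding low
      by (rule Liminf_le[OF sequentially_bot always_eventually]) (use bd(2) in blast)
    ultimately show ?thesis unfolding h_def by (cases "h_low x") auto
  qed
  have h_low': "h_low = (\<lambda>x. ereal (h x))" using hh by (rule ext)
  have hlim: "ereal (h x) = liminf (\<lambda>n. ereal (v n x - v n xbar))" for x
    using hh low by simp
  note ctx = \<alpha> \<alpha>_lim v K \<rho> hlim
  have h: "bounded_lsa K h" by (rule liminf_bounded_lsa[OF ctx])
  have ex: "\<exists>a\<in>A x. Q 1 h (x, a) < \<rho> + h x + \<epsilon>" if "0 < \<epsilon>" for x \<epsilon>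
  proof -
    define \<eta> where "\<eta> = \<epsilon> / 5"
    have \<eta>: "0 < \<eta>" "0 < \<eta> / 2" using that by (auto simp: \<eta>_def)
    obtain S \<beta> \<nu> where \<beta>: "\<beta> < 1" and near: "\<And>\<beta>'. \<beta>' \<in> {\<beta>..<1} \<Longrightarrow>
          (INF a\<in>S \<inter> A x. c (x, a) + ereal \<beta>' * eint (q (x, a)) (v_opt A c q \<beta>')) \<le> v_opt A c q \<beta>' x + ereal (\<eta> / 2)"
      and \<nu>: "finite_measure \<nu>" "sets \<nu> = sets borel"
      and dom: "\<And>B. B \<in> sets borel \<Longrightarrow> (SUP a\<in>S \<inter> A x. emeasure (q (x, a)) B) \<le> emeasure \<nu> B"
      and ui: "((\<lambda>l::real. SUP a\<in>S \<inter> A x. eint (q (x, a)) (\<lambda>y. ereal (w y * indicator {y. l \<le> w y} y))) \<longlongrightarrow> 0) at_top"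
      using cpt[OF \<eta>(2), of x] by blast
    have zS: "(x, a) \<in> graph A" if "a \<in> S \<inter> A x" for a using that by (simp add: graph_def)
    have "\<exists>a\<in>A x. Q 1 h (x, a) < \<rho> + h x + 5 * \<eta>"
    proof (rule optimality_inequality[OF ctx, of "S \<inter> A x" x \<nu> \<eta>])
      show "emeasure (q (x, a)) B \<le> emeasure \<nu> B" if "a \<in> S \<inter> A x" "B \<in> sets borel" for a B
        by (rule order_trans[OF SUP_upper[OF that(1)] dom[OF that(2)]])
      show "\<exists>L>0. \<forall>a\<in>S \<inter> A x. I (x, a) (\<lambda>y. w y * indicator {y. L \<le> w y} y) \<le> \<delta>" if \<delta>: "0 < \<delta>" for \<delta>
      proof -
        let ?E = "\<lambda>L. SUP a\<in>S \<inter> A x. eint (q (x, a)) (\<lambda>y. ereal (w y * indicator {y. L \<le> w y} y))"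
        have "\<forall>\<^sub>F L in at_top. ?E L < ereal \<delta>"
          by (rule order_tendstoD(2)[OF ui]) (use \<delta> in simp)
        with eventually_gt_at_top[of 0] have "\<forall>\<^sub>F L in at_top. 0 < L \<and>
            ?E L < ereal \<delta>"
          by eventually_elim simp
        then obtain L :: real where L: "0 < L"
          "?E L < ereal \<delta>"
          using eventually_happens'[OF trivial_limit_at_top_linorder] by blast
        have "I (x, a) (\<lambda>y. w y * indicator {y. L \<le> w y} y) \<le> \<delta>" if a: "a \<in> S \<inter> A x" for a
        proof -
          have wm: "{y\<in>space (universal borel). L \<le> w y} \<in> sets (universal borel)"
            using w_measurable by measurable
          have "(\<lambda>y. w y * indicator {y. L \<le> w y} y) \<in> universal borel \<rightarrow>\<^sub>M borel"
            using wm by (intro borel_measurable_times w_measurable borel_measurable_indicator) simp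
          then have "integrable (completion (q (x, a))) (\<lambda>y. w y * indicator {y. L \<le> w y} y)"
            by (rule integrable_bounded[OF zS[OF a], of _ 1]) (use w_nonneg in \<open>auto simp: indicator_def\<close>)
          from eint_integrable[OF this]
          have "ereal (I (x, a) (\<lambda>y. w y * indicator {y. L \<le> w y} y)) = eint (q (x, a)) (\<lambda>y. ereal (w y * indicator {y. L \<le> w y} y))" ..
          also have "\<dots> \<le> ?E L"
            by (rule SUP_upper[OF a])
          also note L(2)
          finally show ?thesis by simp
        qed
        then show ?thesis using L(1) by blast
      qed
      have "\<forall>\<^sub>F n in sequentially. \<beta> < \<alpha> n" by (rule order_tendstoD(1)[OF \<alpha>_lim \<beta>])
      then show "\<forall>\<^sub>F n in sequentially. \<exists>a'\<in>S \<inter> A x. Q (\<alpha> n) (v n) (x, a') < v n x + \<eta>"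
      proof (rule eventually_mono)
        fix n assume "\<beta> < \<alpha> n"
        then have "\<alpha> n \<in> {\<beta>..<1}" using \<alpha>(2) by simp
        note near[OF this]
        \<comment> \<open>Only half of \<eta> was used, so the infimum is strictly below the bound
          and some action is as well. In particular \<open>S \<inter> A x\<close> is nonempty, since
          an empty infimum would be infinite.\<close>
        also have "v_opt A c q (\<alpha> n) x + ereal (\<eta> / 2) < ereal (v n x + \<eta>)" using \<eta> by (simp add: v_opt)
        finally obtain a where a: "a \<in> S \<inter> A x"
          "c (x, a) + ereal (\<alpha> n) * eint (q (x, a)) (v_opt A c q (\<alpha> n)) < ereal (v n x + \<eta>)"
          unfolding INF_less_iff by blast
        obtain K' where K': "bounded_lsa K' (v n)" using v by blast
        have "eint (q (x, a)) (v_opt A c q (\<alpha> n)) = ereal (I (x, a) (v n))"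
          unfolding v_opt' by (rule eint_integrable[OF bounded_lsa_integrable[OF zS[OF a(1)] K']])
        then have "Q (\<alpha> n) (v n) (x, a) < v n x + \<eta>"
          using a(2) c_cr[OF zS[OF a(1)]] by (simp add: Q_def)
        then show "\<exists>a'\<in>S \<inter> A x. Q (\<alpha> n) (v n) (x, a') < v n x + \<eta>" using a(1) by blast
      qed
    qed (use \<nu> \<eta> in auto)
    then show ?thesis by (simp add: \<eta>_def)
  qed
  have sel: "\<exists>\<phi>. \<phi> \<in> universal borel \<rightarrow>\<^sub>M borel \<and> (\<forall>x. \<phi> x \<in> A x \<and> Q 1 h (x, \<phi> x) \<le> h x + (\<rho> + \<epsilon>))" if \<epsilon>: "0 < \<epsilon>" for \<epsilon>
  proof -
    have "h \<in> universal borel \<rightarrow>\<^sub>M borel" using h by (simp add: bounded_lsa_def lsa_measurable)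
    then have u: "(\<lambda>x. \<rho> + h x + \<epsilon> / 2) \<in> universal borel \<rightarrow>\<^sub>M borel" by simp
    have \<epsilon>2: "0 < \<epsilon> / 2" using \<epsilon> by simp
    from approximate_selector[OF Q_less_analytic[OF zero_less_one h] u ex[OF \<epsilon>2] \<epsilon>2] obtain \<phi> where
      \<phi>: "\<phi> \<in> universal borel \<rightarrow>\<^sub>M borel" "\<And>x. \<phi> x \<in> A x" "\<And>x. Q 1 h (x, \<phi> x) < \<rho> + h x + \<epsilon> / 2 + \<epsilon> / 2" by blast
    have "Q 1 h (x, \<phi> x) \<le> h x + (\<rho> + \<epsilon>)" for x using \<phi>(3)[of x] by simp
    then show ?thesis using \<phi> by blast
  qed
  have lower: "ereal \<rho> \<le> J_avg c q \<pi> x" if "\<pi> \<in> policies A" for \<pi> x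
    by (rule J_avg_lower[OF ctx v_le that])
  obtain \<phi> where \<phi>: "\<And>k::nat. \<phi> k \<in> universal borel \<rightarrow>\<^sub>M borel" "\<And>k x. \<phi> k x \<in> A x"
    "\<And>k x. Q 1 h (x, \<phi> k x) \<le> h x + (\<rho> + (1/2) ^ k)"
  proof -
    have "\<forall>k::nat. \<exists>\<phi>. \<phi> \<in> universal borel \<rightarrow>\<^sub>M borel \<and> (\<forall>x. \<phi> x \<in> A x \<and> Q 1 h (x, \<phi> x) \<le> h x + (\<rho> + (1/2) ^ k))"
      by (rule allI, rule sel) simp
    from choice[OF this] that show ?thesis by blast
  qed
  have geo: "(\<Sum>k<n. (1/2::real) ^ k) \<le> 2 + real n * 0" for n
    by (simp add: sum_gp_strict)
  have opt: "J_avg c q (markov_policy \<phi>) x \<le> ereal \<rho>" for x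
    using J_avg_markov_le[OF h \<phi> geo, of x] by simp
  have pol: "markov_policy \<phi> \<in> policies A" "nonrandomized A (markov_policy \<phi>)" "Markov (markov_policy \<phi>)"
    by (rule markov_policy[OF \<phi>(1,2)])+
  have g: "g_star A c q x = ereal \<rho>" for x
  proof (rule antisym)
    show "g_star A c q x \<le> ereal \<rho>" unfolding g_star_def by (rule order_trans[OF INF_lower[OF pol(1)]]) (rule opt)
    show "ereal \<rho> \<le> g_star A c q x" unfolding g_star_def by (rule INF_greatest) (rule lower)
  qed
  have "avg_optimal A c q (markov_policy \<phi>)"
    unfolding avg_optimal_def g using pol(1) opt lower[OF pol(1)] by (auto intro: antisym)
  then have markov: "\<exists>\<pi>. avg_optimal A c q \<pi> \<and> nonrandomized A \<pi> \<and> Markov \<pi>" using pol by blast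
  have stat: "\<exists>\<pi>. avg_eps_optimal A c q \<epsilon> \<pi> \<and> nonrandomized A \<pi> \<and> stationary \<pi>" if \<epsilon>: "0 < \<epsilon>" for \<epsilon>
  proof -
    obtain \<psi> where \<psi>: "\<psi> \<in> universal borel \<rightarrow>\<^sub>M borel" "\<And>x. \<psi> x \<in> A x" "\<And>x. Q 1 h (x, \<psi> x) \<le> h x + (\<rho> + \<epsilon>)"
      using sel[OF \<epsilon>] by blast
    have "(\<Sum>k<n. \<epsilon>) \<le> 0 + real n * \<epsilon>" for n by simp
    from J_avg_markov_le[OF h \<psi>(1,2,3) this] have "J_avg c q (markov_policy (\<lambda>_. \<psi>)) x \<le> ereal \<rho> + ereal \<epsilon>" for x
      by simp
    moreover have "markov_policy (\<lambda>_. \<psi>) \<in> policies A" "nonrandomized A (markov_policy (\<lambda>_. \<psi>))"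
      by (rule markov_policy[OF \<psi>(1,2)])+
    ultimately show ?thesis
      unfolding avg_eps_optimal_def g using stationary_markov_policy by blast
  qed
  have lsa_low: "lower_semianalytic_on UNIV h_low"
    unfolding lower_semianalytic_on_def
  proof (intro conjI allI)
    show "analytic (UNIV :: 'x set)" by (rule analytic_borel[OF coded_borel]) simp
    fix r :: real
    have lt: "analytic {x. h x < s}" for s using h by (auto simp: bounded_lsa_def lsa_def)
    \<comment> \<open>Converts the strict sublevel sets of \<open>lsa\<close> into the weak ones of
      \<open>lower_semianalytic_on\<close>.\<close>
    have "{x \<in> UNIV. h_low x \<le> ereal r} = (\<Inter>n::nat. {x. h x < r + 1 / real (Suc n)})"
    proof (intro set_eqI iffI)
      fix x assume "x \<in> {x \<in> UNIV. h_low x \<le> ereal r}"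
      then have "h x \<le> r" by (simp add: hh)
      then show "x \<in> (\<Inter>n::nat. {x. h x < r + 1 / real (Suc n)})" by (auto intro: le_less_trans)
    next
      fix x assume x: "x \<in> (\<Inter>n::nat. {x. h x < r + 1 / real (Suc n)})"
      have "h x \<le> r"
      proof (rule field_le_epsilon)
        fix e :: real assume "0 < e"
        then obtain n where "1 / real (Suc n) < e" using nat_approx_posE by blast
        moreover have "h x < r + 1 / real (Suc n)" using x by blast
        ultimately show "h x \<le> r + e" by linarith
      qed
      then show "x \<in> {x \<in> UNIV. h_low x \<le> ereal r}" by (simp add: hh)
    qed
    then show "analytic {x \<in> UNIV. h_low x \<le> ereal r}" using analytic_INT[OF coded_borel lt] by simp
  qed
  have Mw: "h_low \<in> M_w w"
  proof -
    have "h \<in> universal borel \<rightarrow>\<^sub>M borel" using h by (simp add: bounded_lsa_def lsa_measurable)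
    then have "h_low \<in> universal borel \<rightarrow>\<^sub>M borel" unfolding h_low' by simp
    moreover have "wnorm w h_low \<le> ereal K"
      unfolding wnorm_def
    proof (rule SUP_least)
      fix x
      have "\<bar>h x\<bar> \<le> K * w x" using h by (simp add: bounded_lsa_def)
      then show "\<bar>h_low x\<bar> / ereal (w x) \<le> ereal K" using w_pos[of x] by (simp add: hh field_simps)
    qed
    then have "wnorm w h_low < \<infinity>" by (rule le_less_trans) simp
    ultimately show ?thesis unfolding M_w_def by simp
  qed
  have acoi: "(INF a\<in>A x. c (x, a) + eint (q (x, a)) h_low) \<le> ereal \<rho> + h_low x" for x
  proof (rule ereal_le_epsilon2)
    fix e :: real assume "0 < e"
    from ex[OF this] obtain a where a: "a \<in> A x" "Q 1 h (x, a) < \<rho> + h x + e" by blast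
    then have z: "(x, a) \<in> graph A" by (simp add: graph_def)
    have "eint (q (x, a)) h_low = ereal (I (x, a) h)"
      unfolding h_low' by (rule eint_integrable[OF bounded_lsa_integrable[OF z h]])
    then have "c (x, a) + eint (q (x, a)) h_low \<le> ereal \<rho> + h_low x + ereal e"
      using a(2) c_cr[OF z] by (simp add: Q_def hh)
    then show "(INF a\<in>A x. c (x, a) + eint (q (x, a)) h_low) \<le> ereal \<rho> + h_low x + ereal e"
      by (rule INF_lower2[OF a(1)])
  qed
  show ?thesis using g lsa_low Mw acoi markov stat by blast
qed

end
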